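(* Let $n\ge2$ be an integer, $m$ a squarefree positive integer, $K_{-m}=\mathbb{Q}(i\sqrt m)$, $\mathcal{O}$ an order in the ring of integers $\mathcal{O}_{-m}$ of $K_{-m}$ and $\mathcal{I}$ a nonzero ideal of $\mathcal{O}$. With the notation of the context, for $x\in\mathrm{Heis}_{2n-1}(\mathbb{R})-\mathrm{Heis}_{2n-1}(\mathbb{Q})$ let $$c'_{\mathcal{I}}(x)=\liminf_{(a,\alpha,c)\in\mathcal{E}'_{\mathcal{I}},\ |c|\to\infty}\ |c|\ d'_{\rm Cyg}\big(x,(a/c,\alpha/c)\big).$$ Then the set $\{c'_{\mathcal{I}}(x): x\in\mathrm{Heis}_{2n-1}(\mathbb{R})-\mathrm{Heis}_{2n-1}(\mathbb{Q})\}$ is a closed subset of $\mathbb{R}$.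
   Context: For $w,w'\in\mathbb{C}^{n-1}$ let $w'\cdot\overline w=\sum_{i=1}^{n-1}w'_i\overline{w_i}$ and $|w|^2=w\cdot\overline w$. Let $\mathrm{Heis}_{2n-1}(\mathbb{R})=\{(z,w)\in\mathbb{C}\times\mathbb{C}^{n-1}: 2\,\mathrm{Re}\,z-|w|^2=0\}$ with group law $(z,w)(z',w')=(z+z'+w'\cdot\overline w,\ w+w')$, and $\mathrm{Heis}_{2n-1}(\mathbb{Q})=\mathrm{Heis}_{2n-1}(\mathbb{R})\cap(K_{-m}\times K_{-m}^{\,n-1})$. The modified Cygan distance $d'_{\rm Cyg}$ is the unique left-invariant distance on $\mathrm{Heis}_{2n-1}(\mathbb{R})$ with $d'_{\rm Cyg}((z,w),(0,0))=\sqrt{2|z|+|w|^2}$. On $\mathbb{C}^{n+1}=\mathbb{C}\times\mathbb{C}^{n-1}\times\mathbb{C}$ with coordinates $(z_0,z,z_n)$, let $Q$ be the Hermitian form $-z_0\overline{z_n}-z_n\overline{z_0}+|z|^2$ and $\mathrm{SU}_Q$ the group of complex $(n+1)\times(n+1)$ matrices of determinant $1$ preserving $Q$. Let $\Gamma'$ be the set of matrices $g\in\mathrm{SU}_Q\cap\mathrm{SL}_{n+1}(\mathcal{O})$ whose image under the reduction morphism $\mathrm{SL}_{n+1}(\mathcal{O})\to\mathrm{SL}_{n+1}(\mathcal{O}/\mathcal{I})$ has all coefficients of its first column zero except the first one. Then $\mathcal{E}'_{\mathcal{I}}$ is the set of $(a,\alpha,c)\in\mathcal{O}\times\mathcal{I}^{n-1}\times\mathcal{I}$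 for which there exists a matrix in $\Gamma'$ of block form $\begin{pmatrix}a&\gamma&b\\ \alpha&A&\beta\\ c&\delta&d\end{pmatrix}$ (blocks relative to $\mathbb{C}\times\mathbb{C}^{n-1}\times\mathbb{C}$). (When $n=2$ and $\mathcal{O}=\mathcal{O}_{-m}$, this set coincides with the set of $(a,\alpha,c)\in\mathcal{O}_{-m}\times\mathcal{I}\times\mathcal{I}$ with $2\,\mathrm{Re}(a\overline c)=|\alpha|^2$ and $\langle a,\alpha,c\rangle=\mathcal{O}_{-m}$.) *)

theory Defs
  imports "HOL-Analysis.Analysis" "HOL-Computational_Algebra.Squarefree"
begin

unbundle no fps_syntax

section \<open>Orders of imaginary quadratic fields and their ideals, as sets of complex numbers\<close>

definition quad_field :: "nat \<Rightarrow> complex set" where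
  "quad_field m = {a + b * (\<i> * of_real (sqrt (real m))) | a b. a \<in> \<rat> \<and> b \<in> \<rat>}"

definition quad_integers :: "nat \<Rightarrow> complex set" where
  "quad_integers m = {x \<in> quad_field m. algebraic_int x}"

definition is_subring :: "'a::comm_ring_1 set \<Rightarrow> bool" where
  "is_subring R \<longleftrightarrow> 1 \<in> R \<and> (\<forall>x\<in>R. \<forall>y\<in>R. x - y \<in> R \<and> x * y \<in> R)"

text \<open>An order is a unitary subring of the ring of integers which is a free
  \<open>\<int>\<close>-module of rank 2 (equivalently, of finite index in the ring of integers).\<close>

definition is_order :: "nat \<Rightarrow> complex set \<Rightarrow> bool" where
  "is_order m R \<longleftrightarrow> is_subring R \<and> R \<subseteq> quad_integers m \<and>
     (\<exists>u v. (\<forall>p q :: int. of_int p * u + of_int q * v = 0 \<longrightarrow> p = 0 \<and> q = 0) \<and>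
            R = {of_int p * u + of_int q * v | p q :: int. True})"

definition is_ideal :: "'a::comm_ring_1 set \<Rightarrow> 'a set \<Rightarrow> bool" where
  "is_ideal R I \<longleftrightarrow> I \<subseteq> R \<and> 0 \<in> I \<and> (\<forall>x\<in>I. \<forall>y\<in>I. x - y \<in> I) \<and> (\<forall>r\<in>R. \<forall>x\<in>I. r * x \<in> I)"


section \<open>The Heisenberg group and the modified Cygan distance\<close>

text \<open>Throughout, \<open>\<complex>\<^sup>n\<^sup>-\<^sup>1\<close> is \<open>complex ^ 'k\<close> with \<open>CARD('k) = n - 1\<close>.\<close>

definition herm_dot :: "complex ^ 'k \<Rightarrow> complex ^ 'k::finite \<Rightarrow> complex" where
  "herm_dot w' w = (\<Sum>i\<in>UNIV. w' $ i * cnj (w $ i))"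

lemma herm_dot_self: "herm_dot w w = of_real ((norm w)\<^sup>2)"
proof -
  have "(norm w)\<^sup>2 = (\<Sum>i\<in>UNIV. (norm (w $ i))\<^sup>2)"
    by (simp add: norm_vec_def L2_set_def sum_nonneg)
  then show ?thesis
    by (simp add: herm_dot_def complex_norm_square del: of_real_power)
qed

type_synonym 'k heis = "complex \<times> (complex ^ 'k)"

definition heis :: "'k::finite heis set" where
  "heis = {(z, w). 2 * Re z - (norm w)\<^sup>2 = 0}"

definition heis_rat :: "nat \<Rightarrow> 'k::finite heis set" where
  "heis_rat m = heis \<inter> {(z, w). z \<in> quad_field m \<and> (\<forall>i. w $ i \<in> quad_field m)}"

fun heis_mult :: "'k::finite heis \<Rightarrow> 'k heis \<Rightarrow> 'k heis" where
  "heis_mult (z, w) (z', w') = (z + z' + herm_dot w' w, w + w')"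

fun heis_inv :: "'k::finite heis \<Rightarrow> 'k heis" where
  "heis_inv (z, w) = (cnj z, - w)"

fun cygan_gauge :: "'k::finite heis \<Rightarrow> real" where
  "cygan_gauge (z, w) = sqrt (2 * cmod z + (norm w)\<^sup>2)"

definition cygan_dist :: "'k::finite heis \<Rightarrow> 'k heis \<Rightarrow> real" where
  "cygan_dist x y = cygan_gauge (heis_mult (heis_inv y) x)"

lemma herm_dot_simps [simp]:
  "herm_dot (a + b) c = herm_dot a c + herm_dot b c"
  "herm_dot c (a + b) = herm_dot c a + herm_dot c b"
  "herm_dot (- a) b = - herm_dot a b"
  "herm_dot a (- b) = - herm_dot a b"
  "herm_dot 0 b = 0" "herm_dot b 0 = 0"
  "cnj (herm_dot a b) = herm_dot b a"
  by (simp_all add: herm_dot_def algebra_simps sum.distrib sum_negf)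

lemma cmod_herm_dot_le: "cmod (herm_dot a b) \<le> norm a * norm b"
proof -
  have "cmod (herm_dot a b) \<le> (\<Sum>i\<in>UNIV. \<bar>cmod (a $ i)\<bar> * \<bar>cmod (b $ i)\<bar>)"
    unfolding herm_dot_def by (rule order_trans[OF norm_sum]) (simp add: norm_mult)
  also have "\<dots> \<le> norm a * norm b"
    unfolding norm_vec_def by (rule L2_set_mult_ineq)
  finally show ?thesis .
qed

lemma heis_iff: "(z, w) \<in> heis \<longleftrightarrow> herm_dot w w = z + cnj z"
proof -
  have "herm_dot w w = z + cnj z \<longleftrightarrow> (norm w)\<^sup>2 = 2 * Re z"
    unfolding herm_dot_self complex_add_cnj of_real_eq_iff ..
  then show ?thesis
    by (auto simp: heis_def)
qed

lemma heis_mult_closed: "x \<in> heis \<Longrightarrow> y \<in> heis \<Longrightarrow> heis_mult x y \<in> heis"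
  by (cases x; cases y) (simp add: heis_iff algebra_simps)

lemma heis_inv_closed: "x \<in> heis \<Longrightarrow> heis_inv x \<in> heis"
  by (cases x) (simp add: heis_iff algebra_simps)

lemma heis_mult_assoc: "heis_mult (heis_mult x y) z = heis_mult x (heis_mult y z)"
  by (cases x; cases y; cases z) (simp add: algebra_simps)

lemma heis_mult_inv:
  "x \<in> heis \<Longrightarrow> heis_mult x (heis_inv x) = (0, 0)"
  "x \<in> heis \<Longrightarrow> heis_mult (heis_inv x) x = (0, 0)"
  by (cases x; simp add: heis_iff algebra_simps)+

lemma heis_mult_one [simp]: "heis_mult x (0, 0) = x" "heis_mult (0, 0) x = x"
  by (cases x; simp)+

lemma cygan_gauge_inv: "cygan_gauge (heis_inv x) = cygan_gauge x"
  by (cases x) simp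

lemma cygan_gauge_mult_le:
  assumes "x \<in> heis" "y \<in> heis"
  shows "cygan_gauge (heis_mult x y) \<le> cygan_gauge x + cygan_gauge y"
proof -
  obtain z w z' w' where xy: "x = (z, w)" "y = (z', w')" by fastforce
  define a b where "a = 2 * cmod z + (norm w)\<^sup>2" and "b = 2 * cmod z' + (norm w')\<^sup>2"
  have "(norm w)\<^sup>2 \<le> 2 * cmod z" "(norm w')\<^sup>2 \<le> 2 * cmod z'"
    using assms complex_Re_le_cmod[of z] complex_Re_le_cmod[of z'] by (auto simp: xy heis_def)
  then have ab: "2 * (norm w)\<^sup>2 \<le> a" "2 * (norm w')\<^sup>2 \<le> b"
    by (auto simp: a_def b_def)
  then have ab0: "0 \<le> a" "0 \<le> b"
    by (smt (verit) zero_le_power2)+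
  have "(2 * (norm w)\<^sup>2) * (2 * (norm w')\<^sup>2) \<le> a * b"
    by (rule mult_mono[OF ab]) (use ab0 in auto)
  then have "sqrt ((2 * norm w * norm w')\<^sup>2) \<le> sqrt (a * b)"
    by (intro real_sqrt_le_mono) (simp add: power2_eq_square algebra_simps)
  then have s: "2 * (norm w * norm w') \<le> sqrt a * sqrt b"
    by (simp add: real_sqrt_mult mult_ac)
  have "cmod (z + z' + herm_dot w' w) \<le> cmod z + cmod z' + norm w * norm w'"
    using norm_triangle_ineq[of "z + z'" "herm_dot w' w"] norm_triangle_ineq[of z z']
      cmod_herm_dot_le[of w' w] by (simp add: mult.commute)
  moreover have "(norm (w + w'))\<^sup>2 \<le> (norm w + norm w')\<^sup>2"
    by (intro power_mono norm_triangle_ineq) auto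
  ultimately have "2 * cmod (z + z' + herm_dot w' w) + (norm (w + w'))\<^sup>2
      \<le> a + b + 4 * (norm w * norm w')"
    by (simp add: a_def b_def power2_sum algebra_simps)
  also have "\<dots> \<le> (sqrt a + sqrt b)\<^sup>2"
    using s ab0 by (simp add: power2_sum mult_ac)
  finally have "sqrt (2 * cmod (z + z' + herm_dot w' w) + (norm (w + w'))\<^sup>2) \<le> sqrt a + sqrt b"
    using ab0 by (intro real_le_lsqrt) auto
  then show ?thesis by (simp add: xy a_def b_def)
qed

text \<open>The modified Cygan distance is characterised as the unique left-invariant distance with
  the prescribed distance to the identity.\<close>

lemma cygan_dist_one: "cygan_dist (z, w) (0, 0) = sqrt (2 * cmod z + (norm w)\<^sup>2)"
  by (simp add: cygan_dist_def)

lemma cygan_dist_left_invariant: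
  assumes "g \<in> heis"
  shows "cygan_dist (heis_mult g x) (heis_mult g y) = cygan_dist x y"
proof -
  have "heis_inv (heis_mult g y) = heis_mult (heis_inv y) (heis_inv g)"
    by (cases g; cases y) (simp add: algebra_simps)
  then have "heis_mult (heis_inv (heis_mult g y)) (heis_mult g x)
      = heis_mult (heis_inv y) (heis_mult (heis_mult (heis_inv g) g) x)"
    by (simp add: heis_mult_assoc)
  then show ?thesis
    by (simp add: cygan_dist_def heis_mult_inv[OF assms])
qed

lemma Metric_space_cygan_dist: "Metric_space (heis :: 'k::finite heis set) cygan_dist"
proof
  fix x y z :: "'k heis"
  show "0 \<le> cygan_dist x y"
    by (cases x; cases y) (simp add: cygan_dist_def)
  have "heis_inv (heis_mult (heis_inv y) x) = heis_mult (heis_inv x) y"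
    by (cases x; cases y) (simp add: algebra_simps)
  then show "cygan_dist x y = cygan_dist y x"
    by (metis cygan_dist_def cygan_gauge_inv)
  show "cygan_dist x y = 0 \<longleftrightarrow> x = y" if xy: "x \<in> heis" "y \<in> heis"
  proof
    assume "cygan_dist x y = 0"
    moreover have "cygan_gauge u = 0 \<Longrightarrow> u = (0, 0)" for u :: "'k heis"
      by (cases u) (simp add: add_nonneg_eq_0_iff)
    ultimately have "heis_mult (heis_inv y) x = (0, 0)"
      by (simp add: cygan_dist_def)
    then have "heis_mult (heis_mult y (heis_inv y)) x = y"
      by (simp add: heis_mult_assoc)
    then show "x = y"
      by (simp add: heis_mult_inv xy)
  next
    assume "x = y"
    then show "cygan_dist x y = 0"
      by (simp add: cygan_dist_def heis_mult_inv xy)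
  qed
  show "cygan_dist x z \<le> cygan_dist x y + cygan_dist y z"
    if xyz: "x \<in> heis" "y \<in> heis" "z \<in> heis"
  proof -
    have "heis_mult (heis_mult (heis_inv z) y) (heis_mult (heis_inv y) x)
        = heis_mult (heis_inv z) (heis_mult (heis_mult y (heis_inv y)) x)"
      by (simp add: heis_mult_assoc)
    then have "heis_mult (heis_inv z) x
        = heis_mult (heis_mult (heis_inv z) y) (heis_mult (heis_inv y) x)"
      by (simp add: heis_mult_inv xyz)
    then show ?thesis
      using cygan_gauge_mult_le[of "heis_mult (heis_inv z) y" "heis_mult (heis_inv y) x"] xyz
      by (simp add: cygan_dist_def heis_mult_closed heis_inv_closed)
  qed
qed

lemma cygan_dist_unique:
  assumes "\<And>g x y. g \<in> heis \<Longrightarrow> x \<in> heis \<Longrightarrow> y \<in> heis \<Longrightarrow> d (heis_mult g x) (heis_mult g y) = d x y"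
    and "\<And>z w. (z, w) \<in> heis \<Longrightarrow> d (z, w) (0, 0) = sqrt (2 * cmod z + (norm w)\<^sup>2)"
    and x: "x \<in> heis" and y: "y \<in> heis"
  shows "d x y = cygan_dist x y"
proof -
  have "d x y = d (heis_mult (heis_inv y) x) (0, 0)"
    using assms(1)[of "heis_inv y" x y] x y by (simp add: heis_inv_closed heis_mult_inv)
  also have "\<dots> = cygan_gauge (heis_mult (heis_inv y) x)"
    using assms(2) heis_mult_closed[OF heis_inv_closed[OF y] x]
    by (cases "heis_mult (heis_inv y) x") simp
  finally show ?thesis by (simp add: cygan_dist_def)
qed


section \<open>The arithmetic group and the approximating points\<close>

text \<open>Index type for the blocks of \<open>\<complex> \<times> \<complex>\<^sup>n\<^sup>-\<^sup>1 \<times> \<complex>\<close>.\<close>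

datatype 'k blk = Top | Mid 'k | Bot

lemma UNIV_blk: "UNIV = insert Top (insert Bot (range Mid))"
  using blk.exhaust by auto

instance blk :: (finite) finite
  by standard (simp add: UNIV_blk)

lemma card_blk: "CARD('k::finite blk) = CARD('k) + 2"
proof -
  have "card (range (Mid :: 'k \<Rightarrow> 'k blk)) = CARD('k)"
    by (simp add: card_image inj_on_def)
  then show ?thesis
    by (simp add: UNIV_blk card_insert_if image_iff)
qed

definition herm_Q :: "complex ^ 'k::finite blk \<Rightarrow> complex" where
  "herm_Q v = - v $ Top * cnj (v $ Bot) - v $ Bot * cnj (v $ Top)
     + (\<Sum>i\<in>UNIV. v $ Mid i * cnj (v $ Mid i))"

definition SU_Q :: "(complex ^ 'k::finite blk ^ 'k blk) set" where
  "SU_Q = {g. det g = 1 \<and> (\<forall>v. herm_Q (g *v v) = herm_Q v)}"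

definition SL_over :: "complex set \<Rightarrow> (complex ^ 'n ^ 'n::finite) set" where
  "SL_over R = {g. det g = 1 \<and> (\<forall>i j. g $ i $ j \<in> R)}"

text \<open>An entry vanishes in \<open>R / I\<close> iff it lies in \<open>I\<close>.  Entries are written
  \<open>g $ row $ column\<close>.\<close>

definition Gamma' :: "complex set \<Rightarrow> complex set \<Rightarrow> (complex ^ 'k::finite blk ^ 'k blk) set" where
  "Gamma' R I = {g \<in> SU_Q \<inter> SL_over R. \<forall>i. i \<noteq> Top \<longrightarrow> g $ i $ Top \<in> I}"

definition E' :: "complex set \<Rightarrow> complex set \<Rightarrow> (complex \<times> (complex ^ 'k::finite) \<times> complex) set" where
  "E' R I = {(a, \<alpha>, c). a \<in> R \<and> (\<forall>i. \<alpha> $ i \<in> I) \<and> c \<in> I \<and>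
     (\<exists>g\<in>Gamma' R I. g $ Top $ Top = a \<and> (\<forall>i. g $ Mid i $ Top = \<alpha> $ i) \<and> g $ Bot $ Top = c)}"

text \<open>The lower limit along \<open>(a, \<alpha>, c) \<in> E' R I\<close>, \<open>|c| \<rightarrow> \<infinity>\<close>, with values in the extended reals.\<close>

definition approx_const :: "complex set \<Rightarrow> complex set \<Rightarrow> 'k::finite heis \<Rightarrow> ereal" where
  "approx_const R I x =
     Liminf (inf (filtercomap (\<lambda>(a, \<alpha>, c). cmod c) at_top) (principal (E' R I)))
       (\<lambda>(a, \<alpha>, c). ereal (cmod c * cygan_dist x (a / c, \<chi> i. \<alpha> $ i / c)))"

end

(* A point x of the Heisenberg group is the endpoint of a geodesic of complex hyperbolic space that
   starts at infinity, and for v = (a, alpha, c) in the orbit of infinity the number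
   (|c| d(x, (a/c, alpha/c)))^2 is a quantity ht attached to that geodesic and to the cusp v which
   is invariant under the group. So the approximation constant is an asymptotic height.

   Recurrence: by Dirichlet's pigeonhole principle and the discreteness of the order, a geodesic
   whose endpoint is not rational returns infinitely often, modulo the group, to a compact set which
   does not depend on x. This gives finiteness of the constant. If the constants of x_k converge,
   cut out of the geodesic of x_k a long segment that realises its constant and whose two ends are,
   modulo the group, close to one and the same geodesic (X, Y), which exists by compactness. Gluing
   the k-th segment to the next one leaves jumps tending to 0, and there is one geodesic that shadows
   the whole chain. Its asymptotic height is the limit, since near the cusps that matter the
   quantity ht changes by a factor tending to 1. *)

theory Submission
  imports Defs
begin

text \<open>The obstacle in the gluing is that replacing a frame by a nearby one changes the two
  coordinates \<open>hB v P\<close> and \<open>hB v Q\<close> of a cusp by errors proportional to a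
  weighted sum of both. Such an error is relative, hence harmless for \<open>ht\<close>, only if
  neither coordinate dominates, that is, if the segment passes near the cusp. Each cusp is therefore
  compared at one segment only, and the estimates must show that the windows of consecutive segments
  leave no gap. The two ends of the shadowing geodesic are built differently. Carrying a forward
  endpoint backward along the chain is stable, so it arises from a nested intersection of compact
  sets; the backward endpoint stays at \<open>Q 0\<close>, a multiple of an image of infinity, so
  that the result can be moved to start at infinity. Recurrence works in the full lattice
  \<open>L\<close>, not in the orbit of infinity. The only obstruction to a bounded lattice frame is
  a short vector, and integrality of the form forces short vectors at consecutive times onto one
  isotropic line.\<close>

type_synonym 'k cvec = "complex ^ 'k blk"

lemma sum_blk: "(\<Sum>i\<in>UNIV. f i) = f Top + f Bot + (\<Sum>i\<in>UNIV. f (Mid i))"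
  for f :: "'k::finite blk \<Rightarrow> 'a::comm_monoid_add"
proof -
  have "sum f (insert Top (insert Bot (range Mid))) = f Top + (f Bot + sum f (range Mid))"
    by (subst sum.insert, simp, blast, subst sum.insert) auto
  also have "sum f (range Mid) = (\<Sum>i\<in>UNIV. f (Mid i))"
    by (subst sum.reindex) (auto simp: inj_on_def)
  finally show ?thesis
    by (simp add: UNIV_blk add.assoc)
qed

lemma prod_blk: "(\<Prod>i\<in>UNIV. f i) = f Top * f Bot * (\<Prod>i\<in>UNIV. f (Mid i))"
  for f :: "'k::finite blk \<Rightarrow> 'a::comm_monoid_mult"
proof -
  have "prod f (insert Top (insert Bot (range Mid))) = f Top * (f Bot * prod f (range Mid))"
    by (subst prod.insert, simp, blast, subst prod.insert) auto
  also have "prod f (range Mid) = (\<Prod>i\<in>UNIV. f (Mid i))"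
    by (subst prod.reindex) (auto simp: inj_on_def)
  finally show ?thesis
    by (simp add: UNIV_blk mult.assoc)
qed

lemma all_blk: "(\<forall>i. P i) \<longleftrightarrow> P Top \<and> P Bot \<and> (\<forall>i. P (Mid i))"
  by (metis blk.exhaust)

lemma blk_vec_eq_iff: "u = v \<longleftrightarrow> u $ Top = v $ Top \<and> u $ Bot = v $ Bot \<and> (\<forall>i. u $ Mid i = v $ Mid i)"
  unfolding vec_eq_iff by (rule all_blk)

lemma norm_power2_vec: "(norm v)\<^sup>2 = (\<Sum>i\<in>UNIV. (norm (v $ i))\<^sup>2)"
  for v :: "'a::real_normed_vector ^ 'n::finite"
  by (simp add: norm_vec_def L2_set_def sum_nonneg)

lemma norm_scalar_mult: "norm (c *s v) = cmod c * norm v" for v :: "complex ^ 'n::finite"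
proof -
  have "(norm (c *s v))\<^sup>2 = (cmod c * norm v)\<^sup>2"
    by (simp add: norm_power2_vec power_mult_distrib norm_mult sum_distrib_left)
  then show ?thesis
    by (smt (verit) norm_ge_zero power2_eq_imp_eq zero_le_mult_iff)
qed

section \<open>The Hermitian form\<close>

definition hB :: "'k::finite cvec \<Rightarrow> 'k cvec \<Rightarrow> complex" where
  "hB u v = - u $ Top * cnj (v $ Bot) - u $ Bot * cnj (v $ Top)
     + (\<Sum>i\<in>UNIV. u $ Mid i * cnj (v $ Mid i))"

lemma herm_Q_eq: "herm_Q v = hB v v"
  by (simp add: herm_Q_def hB_def)

lemma hB_simps [simp]:
  "hB (u + u') v = hB u v + hB u' v" "hB v (u + u') = hB v u + hB v u'"
  "hB (u - u') v = hB u v - hB u' v" "hB v (u - u') = hB v u - hB v u'"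
  "hB (- u) v = - hB u v" "hB v (- u) = - hB v u"
  "hB (c *s u) v = c * hB u v" "hB v (c *s u) = cnj c * hB v u"
  "hB 0 v = 0" "hB v 0 = 0"
  by (simp_all add: hB_def algebra_simps sum.distrib sum_negf sum_distrib_left sum_subtractf)

lemma cnj_hB [simp]: "cnj (hB u v) = hB v u"
  by (simp add: hB_def algebra_simps)

lemma cmod_hB_commute: "cmod (hB u v) = cmod (hB v u)"
  by (metis cnj_hB complex_mod_cnj)

text \<open>Up to the signed swap of \<open>Top\<close> and \<open>Bot\<close>, a Euclidean
  isometry, \<open>hB\<close> is the standard Hermitian product; this is its Cauchy-Schwarz
  inequality.\<close>

lemma cmod_hB_le: "cmod (hB u v) \<le> norm u * norm v" for u v :: "'k::finite cvec"
proof -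
  define J :: "'k cvec" where
    "J = (\<chi> i. case i of Top \<Rightarrow> - v $ Bot | Bot \<Rightarrow> - v $ Top | Mid j \<Rightarrow> v $ Mid j)"
  have "hB u v = (\<Sum>i\<in>UNIV. u $ i * cnj (J $ i))"
    by (simp add: hB_def J_def sum_blk)
  moreover have "(norm J)\<^sup>2 = (norm v)\<^sup>2"
    by (simp add: norm_power2_vec sum_blk J_def)
  then have "norm J = norm v" by simp
  moreover have "cmod (\<Sum>i\<in>UNIV. u $ i * cnj (J $ i)) \<le> (\<Sum>i\<in>UNIV. \<bar>cmod (u $ i)\<bar> * \<bar>cmod (J $ i)\<bar>)"
    by (rule order_trans[OF norm_sum]) (simp add: norm_mult)
  moreover have "\<dots> \<le> norm u * norm J"
    unfolding norm_vec_def by (rule L2_set_mult_ineq)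
  ultimately show ?thesis by simp
qed

lemma hB_polarization:
  "4 * hB u v = hB (u + v) (u + v) - hB (u - v) (u - v)
     + \<i> * hB (u + \<i> *s v) (u + \<i> *s v) - \<i> * hB (u - \<i> *s v) (u - \<i> *s v)"
  by (simp add: algebra_simps)

lemma hB_invariant:
  assumes "\<And>v. herm_Q (g *v v) = herm_Q v"
  shows "hB (g *v u) (g *v v) = hB u v"
proof -
  have "4 * hB (g *v u) (g *v v) = 4 * hB u v"
    unfolding hB_polarization
    by (simp only: vector_scalar_commute[symmetric] matrix_vector_right_distrib[symmetric]
       matrix_vector_mult_diff_distrib[symmetric] assms[unfolded herm_Q_eq])
  then show ?thesis by simp
qed

text \<open>The form has a single negative direction, so it is positive definite on the orthogonal
  complement of the negative vector \<open>p\<close>; the bound makes this quantitative, by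
  Cauchy-Schwarz on the positive part.\<close>

lemma norm_le_of_orthogonal_to_negative:
  fixes u p :: "'k::finite cvec"
  assumes pp: "hB p p = -2" and up: "hB u p = 0"
  shows "(norm u)\<^sup>2 \<le> (norm p)\<^sup>2 * Re (hB u u)"
proof -
  \<comment> \<open>\<open>tl\<close> projects to the positive subspace, where \<open>Bot\<close> is
    minus \<open>Top\<close> and \<open>hB\<close> is the Euclidean product; \<open>pl\<close> is
    the squared length of the component on the negative line.\<close>
  define tl :: "'k cvec \<Rightarrow> 'k cvec" where
    "tl u = (\<chi> i. case i of Top \<Rightarrow> (u $ Top - u $ Bot) / 2 | Bot \<Rightarrow> (u $ Bot - u $ Top) / 2
               | Mid j \<Rightarrow> u $ Mid j)" for u
  define pl where "pl u = (cmod (u $ Top + u $ Bot))\<^sup>2 / 2" for u :: "'k cvec"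
  define rs where "rs u = (norm (tl u))\<^sup>2" for u
  have nu: "(norm u)\<^sup>2 = pl u + rs u" for u
    unfolding rs_def pl_def norm_power2_vec sum_blk tl_def
    by (simp add: cmod_power2 power_divide) (simp add: power2_eq_square field_simps)
  have qu: "Re (hB u u) = rs u - pl u" for u
    unfolding rs_def pl_def norm_power2_vec sum_blk tl_def hB_def
    by (simp add: cmod_power2 power_divide) (simp add: power2_eq_square field_simps sum.distrib)
  have "hB u p = hB (tl u) (tl p) - (u $ Top + u $ Bot) * cnj (p $ Top + p $ Bot) / 2"
    unfolding hB_def tl_def by (simp add: field_simps)
  then have "hB (tl u) (tl p) = (u $ Top + u $ Bot) * cnj (p $ Top + p $ Bot) / 2"
    using up by simp
  then have "cmod (u $ Top + u $ Bot) * cmod (p $ Top + p $ Bot) / 2 \<le> norm (tl u) * norm (tl p)"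
    using cmod_hB_le[of "tl u" "tl p"]
    by (metis complex_mod_cnj norm_divide norm_mult norm_numeral)
  then have "(cmod (u $ Top + u $ Bot) * cmod (p $ Top + p $ Bot) / 2)\<^sup>2 \<le> (norm (tl u) * norm (tl p))\<^sup>2"
    by (intro power_mono) auto
  then have cs: "pl u * pl p \<le> rs u * rs p"
    by (simp add: pl_def rs_def power_mult_distrib power_divide)
  have rp: "rs p = pl p - 2"
    using qu[of p] pp by simp
  have r0: "0 \<le> rs u" "0 \<le> rs p" "0 \<le> pl u" by (auto simp: rs_def pl_def)
  with rp have p2: "2 \<le> pl p" by simp
  have *: "2 * rs u \<le> pl p * (rs u - pl u)"
    using cs rp by (simp add: algebra_simps)
  with r0 p2 have pos: "0 \<le> rs u - pl u"
    by (smt (verit) mult_pos_neg)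
  have "pl u + rs u \<le> 2 * rs u" using pos by simp
  also note *
  \<comment> \<open>The factor \<open>2 * pl p - 2\<close> is exactly the squared norm of
    \<open>p\<close>, since \<open>rs p = pl p - 2\<close>.\<close>
  also have "pl p * (rs u - pl u) \<le> (2 * pl p - 2) * (rs u - pl u)"
    using p2 pos by (intro mult_right_mono) auto
  finally show ?thesis
    unfolding nu qu rp by (simp add: algebra_simps)
qed

lemma isotropic_Bot_zero:
  assumes "w $ Bot = 0" "hB w w = 0"
  shows "w $ Mid i = 0"
proof -
  have "hB w w = of_real (\<Sum>i\<in>UNIV. (cmod (w $ Mid i))\<^sup>2)"
    using assms(1) by (simp add: hB_def complex_norm_square del: of_real_power)
  with assms(2) have "(\<Sum>i\<in>UNIV. (cmod (w $ Mid i))\<^sup>2) = 0"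
    by (metis of_real_eq_0_iff)
  then show "w $ Mid i = 0"
    by (simp add: sum_nonneg_eq_0_iff)
qed

text \<open>With one negative direction, totally isotropic subspaces are lines. If
  \<open>v $ Bot\<close> is nonzero, eliminating the \<open>Bot\<close> coordinate leaves an
  isotropic vector orthogonal to \<open>v\<close> with \<open>Bot\<close> zero, and such a vector
  vanishes.\<close>

lemma isotropic_collinear:
  fixes u v :: "'k::finite cvec"
  assumes uu: "hB u u = 0" and vv: "hB v v = 0" and uv: "hB u v = 0" and "v \<noteq> 0"
  shows "\<exists>c. u = c *s v"
proof (cases "v $ Bot = 0")
  case True
  note m = isotropic_Bot_zero[OF True vv]
  then have vT: "v $ Top \<noteq> 0" using True \<open>v \<noteq> 0\<close> by (auto simp: blk_vec_eq_iff)
  then have uB: "u $ Bot = 0" using uv True m by (simp add: hB_def)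
  then show ?thesis using isotropic_Bot_zero[OF uB uu] m vT True
    by (intro exI[of _ "u $ Top / v $ Top"]) (simp add: blk_vec_eq_iff)
next
  case False
  define w where "w = v $ Bot *s u - u $ Bot *s v"
  have vu: "hB v u = 0" using uv by (metis cnj_hB complex_cnj_zero)
  have w0: "w $ Bot = 0" by (simp add: w_def)
  have ww: "hB w w = 0" "hB w v = 0" using assms vu by (simp_all add: w_def)
  note m = isotropic_Bot_zero[OF w0 ww(1)]
  have "w $ Top = 0" using ww(2) m w0 False by (simp add: hB_def)
  then have "v $ Bot *s u = u $ Bot *s v" using m w0 by (simp add: blk_vec_eq_iff w_def)
  then have "\<forall>i. v $ Bot * u $ i = u $ Bot * v $ i" by (simp add: vec_eq_iff)
  then show ?thesis using False
    by (intro exI[of _ "u $ Bot / v $ Bot"]) (simp add: vec_eq_iff field_simps)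
qed

text \<open>A geodesic with a marked point: the isotropic lines of \<open>P\<close> and
  \<open>Q\<close> are its endpoints, the line of \<open>P + Q\<close> is the point. Replacing the
  pair by \<open>T P\<close> and \<open>Q / T\<close> with T > 0 moves the point, towards
  \<open>P\<close> when T > 1.\<close>

definition frame :: "'k::finite cvec \<Rightarrow> 'k cvec \<Rightarrow> bool" where
  "frame P Q \<longleftrightarrow> hB P P = 0 \<and> hB Q Q = 0 \<and> hB P Q = -1"

lemma frameD:
  assumes "frame P Q"
  shows "hB P P = 0" "hB Q Q = 0" "hB P Q = -1" "hB Q P = -1"
proof -
  show h: "hB P P = 0" "hB Q Q = 0" "hB P Q = -1"
    using assms unfolding frame_def by auto
  show "hB Q P = -1"
    by (subst cnj_hB[symmetric], subst h(3)) simp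
qed

lemma frame_commute: "frame P Q \<Longrightarrow> frame Q P"
  using frameD[of P Q] unfolding frame_def by blast

text \<open>\<open>w\<close> is the component of \<open>v\<close> orthogonal to \<open>P\<close> and
  \<open>Q\<close>, hence to the negative vector \<open>P + Q\<close>. For isotropic
  \<open>v\<close> its square is twice the real part of the product of the two coordinates, which is
  therefore nonnegative.\<close>

lemma frame_perp:
  assumes "frame P Q" "hB v v = 0"
  defines "w \<equiv> v + hB v Q *s P + hB v P *s Q"
  shows "(norm w)\<^sup>2 \<le> (norm (P + Q))\<^sup>2 * (2 * Re (hB v Q * hB P v))"
    and "0 \<le> Re (hB v Q * hB P v)"
proof -
  note f = frameD[OF assms(1)]
  have pp: "hB (P + Q) (P + Q) = -2" using f by simp
  have wp: "hB w (P + Q) = 0" using f by (simp add: w_def)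
  have "hB w w = hB v Q * hB P v + cnj (hB v Q * hB P v)"
    using f assms(2) unfolding w_def by (simp add: distrib_left)
  then have "Re (hB w w) = Re (hB v Q * hB P v + cnj (hB v Q * hB P v))"
    by (rule arg_cong)
  also have "Re (z + cnj z) = 2 * Re z" for z
    by simp
  finally have ww: "Re (hB w w) = 2 * Re (hB v Q * hB P v)" .
  show "(norm w)\<^sup>2 \<le> (norm (P + Q))\<^sup>2 * (2 * Re (hB v Q * hB P v))"
    using norm_le_of_orthogonal_to_negative[OF pp wp] ww by simp
  moreover have "P + Q \<noteq> 0" using pp hB_simps(9) by (metis neg_equal_0_iff_equal zero_neq_numeral)
  ultimately show "0 \<le> Re (hB v Q * hB P v)"
    by (smt (verit, best) mult_pos_neg zero_le_power2 zero_less_norm_iff zero_less_power)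
qed

text \<open>An isotropic vector is controlled by its two frame coordinates alone. The second bound
  says that it is nearly a multiple of \<open>P\<close> when its product with \<open>P\<close> is
  small; the square root comes from the orthogonal component.\<close>

lemma frame_norm_le:
  assumes "frame P Q" "hB v v = 0" and k: "norm P \<le> k" "norm Q \<le> k"
  shows "norm v \<le> 3 * k * (cmod (hB v P) + cmod (hB v Q))"
    and "norm (v + hB v Q *s P) \<le> k * cmod (hB v P) + 2 * k * sqrt (2 * cmod (hB v P) * cmod (hB v Q))"
proof -
  define A D where "A = cmod (hB v P)" "D = cmod (hB v Q)"
  have k0: "0 \<le> k" using k norm_ge_zero order_trans by blast
  define w where "w = v + hB v Q *s P + hB v P *s Q"
  have "Re (hB v Q * hB P v) \<le> D * A"
    using complex_Re_le_cmod[of "hB v Q * hB P v"] by (simp add: A_D_def norm_mult cmod_hB_commute)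
  moreover have "norm (P + Q) \<le> 2 * k" using k norm_triangle_ineq[of P Q] by simp
  then have "(norm (P + Q))\<^sup>2 \<le> (2 * k)\<^sup>2" by (intro power_mono) auto
  ultimately have "(norm w)\<^sup>2 \<le> (2 * k)\<^sup>2 * (2 * (D * A))"
    using frame_perp[OF assms(1,2), folded w_def]
    by (intro order_trans[OF frame_perp(1)[OF assms(1,2), folded w_def]] mult_mono) auto
  then have "norm w \<le> sqrt ((2 * k)\<^sup>2 * (2 * (D * A)))"
    by (rule real_le_rsqrt)
  also have "\<dots> = 2 * k * sqrt (2 * A * D)"
    using k0 by (simp only: real_sqrt_mult[of "(2 * k)\<^sup>2"] real_sqrt_abs) (simp add: mult_ac)
  finally have nw: "norm w \<le> 2 * k * sqrt (2 * A * D)" .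
  have v1: "v + hB v Q *s P = w - hB v P *s Q" by (simp add: w_def)
  have "norm (v + hB v Q *s P) \<le> norm w + A * norm Q"
    unfolding v1 using norm_triangle_ineq4[of w "hB v P *s Q"] by (simp add: norm_scalar_mult A_D_def)
  also have "\<dots> \<le> 2 * k * sqrt (2 * A * D) + A * k"
    using nw k by (intro add_mono mult_left_mono) (auto simp: A_D_def)
  finally have 1: "norm (v + hB v Q *s P) \<le> k * A + 2 * k * sqrt (2 * A * D)" by (simp add: mult_ac)
  then show "norm (v + hB v Q *s P) \<le> k * cmod (hB v P) + 2 * k * sqrt (2 * cmod (hB v P) * cmod (hB v Q))"
    by (simp add: A_D_def)
  have "sqrt (2 * A * D) \<le> A + D"
    by (intro real_le_lsqrt) (auto simp: A_D_def power2_eq_square algebra_simps)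
  then have "2 * k * sqrt (2 * A * D) \<le> 2 * k * (A + D)"
    using k0 by (intro mult_left_mono) auto
  moreover have "norm v \<le> norm (v + hB v Q *s P) + D * norm P"
    using norm_triangle_ineq4[of "v + hB v Q *s P" "hB v Q *s P"] by (simp add: norm_scalar_mult A_D_def)
  moreover have "D * norm P \<le> D * k" using k by (intro mult_left_mono) (auto simp: A_D_def)
  ultimately show "norm v \<le> 3 * k * (cmod (hB v P) + cmod (hB v Q))"
    using 1 by (simp add: A_D_def algebra_simps)
qed

lemma frame_norm_diff_le:
  assumes "frame P Q" "hB v v = 0" "norm P \<le> k" "norm Q \<le> k"
    and "hB v Q = -1" "cmod (hB v P) \<le> t\<^sup>2" "0 \<le> t" "t \<le> 1"
  shows "norm (v - P) \<le> 4 * k * t"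
proof -
  have k0: "0 \<le> k" using assms(3) norm_ge_zero order_trans by blast
  have "norm (v - P) \<le> k * cmod (hB v P) + 2 * k * sqrt (2 * cmod (hB v P))"
    using frame_norm_le(2)[OF assms(1-4)] assms(5) by simp
  also have "sqrt (2 * cmod (hB v P)) \<le> sqrt (2 * t\<^sup>2)" using assms(6) by simp
  also have "sqrt (2 * t\<^sup>2) = sqrt 2 * t" using assms(7) by (simp add: real_sqrt_mult)
  \<comment> \<open>With 3 / 2 in place of the root of 2 the total becomes k t + 2 k (3 / 2) t = 4 k
    t.\<close>
  also have "sqrt 2 * t \<le> 3 / 2 * t"
    using assms(7) by (intro mult_right_mono real_le_lsqrt) (auto simp: power2_eq_square)
  also have "k * cmod (hB v P) \<le> k * t"
    using assms k0 by (intro mult_left_mono) (auto intro: order_trans simp: power2_eq_square mult_left_le)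
  finally show ?thesis using k0 by (simp add: mult_left_mono)
qed

text \<open>The height of the geodesic from \<open>y\<close> to \<open>u\<close> relative to the cusp \<open>v\<close>: it does not depend on
  the representatives of the isotropic lines of \<open>u\<close> and \<open>y\<close>.\<close>

definition ht :: "'k::finite cvec \<Rightarrow> 'k cvec \<Rightarrow> 'k cvec \<Rightarrow> real" where
  "ht u y v = (let q = - hB u v * hB v y / hB u y in 2 * (cmod q + Re q))"

lemma ht_scale:
  assumes "a \<noteq> 0" "b \<noteq> 0"
  shows "ht (a *s u) (b *s y) v = ht u y v"
  using assms by (simp add: ht_def)

lemma ht_nonneg: "0 \<le> ht u y v"
proof -
  have "0 \<le> cmod q + Re q" for q
    using abs_Re_le_cmod[of q] by linarith
  then have "0 \<le> 2 * (cmod q + Re q)" for q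
    by (rule mult_nonneg_nonneg[rotated]) simp
  then show ?thesis unfolding ht_def Let_def .
qed

text \<open>The relevant complex number has nonnegative real part by \<open>frame_perp\<close>, so
  adding the real part to the modulus at most doubles it. Heights are thus comparable to the product
  of the frame coordinates.\<close>

lemma ht_frame:
  assumes "frame P Q" "hB v v = 0"
  shows "2 * (cmod (hB v P) * cmod (hB v Q)) \<le> ht P Q v"
    and "ht P Q v \<le> 4 * (cmod (hB v P) * cmod (hB v Q))"
proof -
  have h: "ht P Q v = 2 * (cmod (hB P v * hB v Q) + Re (hB P v * hB v Q))"
    using frameD[OF assms(1)] by (simp add: ht_def Let_def)
  have "cmod (hB P v * hB v Q) = cmod (hB v P) * cmod (hB v Q)"
    by (simp add: norm_mult cmod_hB_commute)
  moreover have "0 \<le> Re (hB P v * hB v Q)" using frame_perp(2)[OF assms] by (simp add: mult.commute)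
  moreover have "Re (hB P v * hB v Q) \<le> cmod (hB P v * hB v Q)" by (rule complex_Re_le_cmod)
  ultimately show "2 * (cmod (hB v P) * cmod (hB v Q)) \<le> ht P Q v"
    and "ht P Q v \<le> 4 * (cmod (hB v P) * cmod (hB v Q))" unfolding h by simp_all
qed

section \<open>Orders as discrete rings\<close>

lemma Rats_Im: "(x::complex) \<in> \<rat> \<Longrightarrow> Im x = 0"
proof (induction x rule: Rats_induct)
  case (of_rat r)
  obtain a b where "quotient_of r = (a, b)" by fastforce
  then have "r = of_int a / of_int b" using quotient_of_div by blast
  then have "of_rat r = (complex_of_real (of_int a / of_int b))" by (simp add: of_rat_divide)
  then show ?case by (simp only: Im_complex_of_real)
qed

locale quad_order =
  fixes m :: nat and R :: "complex set"
  assumes m_pos: "m > 0" and order: "is_order m R"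
begin

lemma R_one: "1 \<in> R" and R_diff: "x \<in> R \<Longrightarrow> y \<in> R \<Longrightarrow> x - y \<in> R"
  and R_mult: "x \<in> R \<Longrightarrow> y \<in> R \<Longrightarrow> x * y \<in> R"
  using order unfolding is_order_def is_subring_def by auto

lemma R_zero: "0 \<in> R" using R_diff[OF R_one R_one] by simp
lemma R_uminus: "x \<in> R \<Longrightarrow> - x \<in> R" using R_diff[OF R_zero] by simp
lemma R_add: "x \<in> R \<Longrightarrow> y \<in> R \<Longrightarrow> x + y \<in> R" using R_diff[OF _ R_uminus] by force
lemma R_sum: "(\<And>i. i \<in> A \<Longrightarrow> f i \<in> R) \<Longrightarrow> sum f A \<in> R"
  by (induction A rule: infinite_finite_induct) (auto simp: R_zero R_add)
lemma R_prod: "(\<And>i. i \<in> A \<Longrightarrow> f i \<in> R) \<Longrightarrow> prod f A \<in> R"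
  by (induction A rule: infinite_finite_induct) (auto simp: R_one R_mult)

lemma R_of_nat: "of_nat n \<in> R"
  by (induction n) (auto simp: R_zero R_one R_add)
lemma R_of_int: "of_int n \<in> R"
  by (cases n rule: int_cases2) (simp_all only: of_int_of_nat_eq of_int_minus R_of_nat R_uminus)

lemma R_subset: "x \<in> R \<Longrightarrow> \<exists>a b. a \<in> \<rat> \<and> b \<in> \<rat> \<and> x = a + b * (\<i> * of_real (sqrt (real m)))"
proof -
  assume "x \<in> R"
  then have "x \<in> quad_field m" using order by (auto simp: is_order_def quad_integers_def)
  then show ?thesis unfolding quad_field_def by auto
qed

lemma R_real_int: assumes "x \<in> R" "Im x = 0" shows "x \<in> \<int>"
proof -
  obtain a b where ab: "a \<in> \<rat>" "b \<in> \<rat>" "x = a + b * (\<i> * of_real (sqrt (real m)))"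
    using R_subset assms by blast
  have a'': "Im a = 0" "Im b = 0" using ab Rats_Im by auto
  then have "Re b * sqrt m = 0" using assms(2) ab(3) by simp
  then have "b = 0" using m_pos a'' by (simp add: complex_eq_iff)
  then have "x \<in> \<rat>" using ab by simp
  moreover have "algebraic_int x"
    using assms(1) order unfolding is_order_def quad_integers_def by blast
  ultimately show ?thesis by (rule rational_algebraic_int_is_int[rotated])
qed

text \<open>Multiplication by \<open>x\<close> has an integer matrix in a basis of the order, so
  \<open>x\<close> and \<open>cnj x\<close> are roots of its characteristic polynomial. For nonreal
  \<open>x\<close> these are two distinct roots, so trace and determinant are their sum and product;
  real elements are integers already.\<close>

lemma R_trace_norm:
  assumes "x \<in> R"
  shows "x + cnj x \<in> \<int>" and "x * cnj x \<in> \<int>"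
proof -
  have "x + cnj x \<in> \<int> \<and> x * cnj x \<in> \<int>"
  proof (cases "Im x = 0")
    case True
    then have "x \<in> \<int>" "cnj x = x" using R_real_int assms by (auto simp: complex_eq_iff)
    then show ?thesis by simp
  next
    case False
    obtain u v where uv: "\<And>p q :: int. of_int p * u + of_int q * v = 0 \<Longrightarrow> p = 0 \<and> q = 0"
        "R = {of_int p * u + of_int q * v | p q :: int. True}"
      using order unfolding is_order_def by blast
    have "u \<in> R" "v \<in> R"
      unfolding uv(2) mem_Collect_eq
      by (intro exI[of _ 1] exI[of _ 0], simp) (intro exI[of _ 0] exI[of _ 1], simp)
    then have "x * u \<in> R" "x * v \<in> R" using assms R_mult by auto
    then obtain p q r s :: int where pq: "x * u = of_int p * u + of_int q * v"
        "x * v = of_int r * u + of_int s * v"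
      unfolding uv(2) by blast
    have "(x * x - of_int (p + s) * x + of_int (p * s - q * r)) * u =
       (x - of_int s) * (x * u - of_int p * u - of_int q * v) + of_int q * (x * v - of_int r * u - of_int s * v)"
      by (simp add: algebra_simps)
    also have "\<dots> = 0" using pq by simp
    finally have 1: "(x * x - of_int (p + s) * x + of_int (p * s - q * r)) * u = 0" .
    have "u \<noteq> 0" using uv(1)[of 1 0] by auto
    with 1 have e: "x * x - of_int (p + s) * x + of_int (p * s - q * r) = 0" by simp
    then have "cnj (x * x - of_int (p + s) * x + of_int (p * s - q * r)) = 0" by (simp del: complex_cnj_mult)
    then have e': "cnj x * cnj x - of_int (p + s) * cnj x + of_int (p * s - q * r) = 0" by simp
    have "(x - cnj x) * (x + cnj x - of_int (p + s)) = 0"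
    proof -
      have "(x - cnj x) * (x + cnj x - of_int (p + s)) =
         (x * x - of_int (p + s) * x + of_int (p * s - q * r))
         - (cnj x * cnj x - of_int (p + s) * cnj x + of_int (p * s - q * r))"
        by (simp add: algebra_simps)
      then show ?thesis unfolding e e' by simp
    qed
    moreover have "x - cnj x \<noteq> 0" using False by (simp add: complex_eq_iff)
    ultimately have t: "x + cnj x = of_int (p + s)" by simp
    have "cnj x = of_int (p + s) - x" using t by (simp add: algebra_simps)
    then have "x * cnj x = x * (of_int (p + s) - x)" by (rule arg_cong)
    also have "\<dots> = of_int (p * s - q * r) - (x * x - of_int (p + s) * x + of_int (p * s - q * r))"
      by (simp add: algebra_simps)
    finally have "x * cnj x = of_int (p * s - q * r)" unfolding e by simp
    with t show ?thesis by (metis Ints_of_int)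
  qed
  then show "x + cnj x \<in> \<int>" "x * cnj x \<in> \<int>" by auto
qed

lemma R_cnj: assumes "x \<in> R" shows "cnj x \<in> R"
proof -
  obtain k where "x + cnj x = of_int k" using R_trace_norm[OF assms] by (auto elim: Ints_cases)
  then have "cnj x = of_int k - x" by (simp add: algebra_simps)
  then show ?thesis using R_diff R_of_int assms by simp
qed

lemma R_norm_nat: assumes "x \<in> R" shows "\<exists>k::nat. x * cnj x = of_nat k \<and> (cmod x)\<^sup>2 = real k"
proof -
  obtain k where k: "x * cnj x = of_int k" using R_trace_norm[OF assms] by (auto elim: Ints_cases)
  have "complex_of_real ((cmod x)\<^sup>2) = of_real (of_int k)"
    using k by (simp add: complex_norm_square del: of_real_power)
  then have c: "(cmod x)\<^sup>2 = of_int k" by (simp only: of_real_eq_iff)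
  have "0 \<le> (of_int k::real)" unfolding c[symmetric] by simp
  then have "0 \<le> k" by simp
  then show ?thesis using k c by (intro exI[of _ "nat k"]) simp
qed

lemma R_cmod_ge_1: assumes "x \<in> R" "x \<noteq> 0" shows "1 \<le> cmod x"
proof -
  obtain k :: nat where k: "(cmod x)\<^sup>2 = real k" using R_norm_nat[OF assms(1)] by auto
  have "k \<noteq> 0" using k assms(2) by (cases "k = 0") auto
  then have "1 \<le> (cmod x)\<^sup>2" using k by simp
  then show ?thesis using power2_le_imp_le[of 1 "cmod x"] by simp
qed

text \<open>Distinct elements are at distance at least 1 because norms are integers, so a bounded
  part has no limit point.\<close>

lemma R_finite_ball: "finite {x \<in> R. cmod x \<le> r}"
proof (rule ccontr)
  assume "infinite {x \<in> R. cmod x \<le> r}"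
  moreover have "bounded {x \<in> R. cmod x \<le> r}" by (auto intro: boundedI)
  ultimately obtain l where "l islimpt {x \<in> R. cmod x \<le> r}"
    using bounded_infinite_imp_islimpt by blast
  then have l: "\<exists>x\<in>R. x \<noteq> l \<and> dist x l < e" if "e > 0" for e
    using that unfolding islimpt_approachable by blast
  obtain x where x: "x \<in> R" "x \<noteq> l" "dist x l < 1/2"
    using l[of "1/2"] by auto
  obtain y where y: "y \<in> R" "y \<noteq> l" "dist y l < dist x l"
    using l[of "dist x l"] x(2) by auto
  have "x \<noteq> y" using y by auto
  then have "1 \<le> cmod (x - y)" using x y R_diff R_cmod_ge_1 by simp
  moreover have "dist x y < 1" using x y dist_triangle2[of x y l] by simp
  ultimately show False by (simp add: dist_norm)
qed

lemma R_nonreal: "\<exists>\<tau>\<in>R. Im \<tau> \<noteq> 0"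
proof (rule ccontr)
  assume "\<not> ?thesis"
  then have int: "x \<in> R \<Longrightarrow> x \<in> \<int>" for x using R_real_int by blast
  obtain u v where uv: "\<And>p q :: int. of_int p * u + of_int q * v = 0 \<Longrightarrow> p = 0 \<and> q = 0"
      "R = {of_int p * u + of_int q * v | p q :: int. True}"
    using order unfolding is_order_def by blast
  have "u \<in> R" "v \<in> R"
    unfolding uv(2) mem_Collect_eq
    by (intro exI[of _ 1] exI[of _ 0], simp) (intro exI[of _ 0] exI[of _ 1], simp)
  then obtain p q where pq: "u = of_int p" "v = of_int q" using int by (meson Ints_cases)
  have "of_int q * u + of_int (- p) * v = 0" by (simp add: pq)
  from uv(1)[OF this] have "u = 0" by (simp add: pq)
  then show False using uv(1)[of 1 0] by simp
qed

definition \<tau> where "\<tau> = (SOME t. t \<in> R \<and> Im t \<noteq> 0)"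

lemma \<tau>: "\<tau> \<in> R" "Im \<tau> \<noteq> 0"
  using someI_ex[of "\<lambda>t. t \<in> R \<and> Im t \<noteq> 0"] R_nonreal unfolding \<tau>_def by auto

text \<open>Bounds the fundamental parallelogram of the lattice spanned by 1 and
  \<open>\<tau>\<close>, which may be a proper sublattice of \<open>R\<close>; rounding to it is
  enough.\<close>

definition \<rho> where "\<rho> = 1 + cmod \<tau>"

lemma \<rho>_ge: "1 \<le> \<rho>" by (simp add: \<rho>_def)

lemma R_round: "\<exists>r\<in>R. cmod (y - r) \<le> \<rho>"
proof -
  define t where "t = Im y / Im \<tau>"
  define s where "s = Re y - t * Re \<tau>"
  have y: "y = of_real s + of_real t * \<tau>" using \<tau> by (simp add: complex_eq_iff s_def t_def)
  define r where "r = of_int \<lfloor>s\<rfloor> + of_int \<lfloor>t\<rfloor> * \<tau>"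
  have "r \<in> R" unfolding r_def by (intro R_add R_mult R_of_int \<tau>)
  have "y - r = of_real (frac s) + of_real (frac t) * \<tau>" by (simp add: y r_def frac_def algebra_simps)
  then have "cmod (y - r) \<le> cmod (of_real (frac s)) + cmod (of_real (frac t) * \<tau>)"
    by (metis norm_triangle_ineq)
  also have "\<dots> = frac s + frac t * cmod \<tau>" by (simp add: norm_mult)
  also have "\<dots> \<le> 1 + 1 * cmod \<tau>"
    by (intro add_mono mult_right_mono) (auto simp: less_imp_le frac_lt_1)
  finally show ?thesis using \<open>r \<in> R\<close> by (auto simp: \<rho>_def)
qed

definition rd where "rd y = (SOME r. r \<in> R \<and> cmod (y - r) \<le> \<rho>)"

lemma rd: "rd y \<in> R" "cmod (y - rd y) \<le> \<rho>"
  using someI_ex[of "\<lambda>r. r \<in> R \<and> cmod (y - r) \<le> \<rho>"] R_round[of y] unfolding rd_def by auto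

lemma quad_field_multiple_in_R:
  assumes "x \<in> quad_field m"
  shows "\<exists>D::nat. D > 0 \<and> of_nat D * x \<in> R"
proof -
  obtain p q where pq: "p \<in> \<rat>" "q \<in> \<rat>" "\<tau> = p + q * (\<i> * of_real (sqrt (real m)))"
    using R_subset \<tau>(1) by blast
  have "Im p = 0" using pq(1) by (rule Rats_Im)
  then have q0: "q \<noteq> 0" using \<tau>(2) pq(3) by auto
  obtain a b where ab: "a \<in> \<rat>" "b \<in> \<rat>" "x = a + b * (\<i> * of_real (sqrt (real m)))"
    using assms unfolding quad_field_def by blast
  have x: "x = (a - b * p / q) + b / q * \<tau>"
    using q0 by (simp add: ab(3) pq(3) field_simps)
  have rat: "a - b * p / q \<in> \<rat>" "b / q \<in> \<rat>" using ab pq by auto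
  have den: "\<exists>(D::nat) (k::int). D > 0 \<and> of_nat D * r = (of_int k :: complex)" if "r \<in> \<rat>" for r
  proof -
    from that obtain r' where r: "r = of_rat r'" by (auto elim: Rats_cases)
    obtain k d where kd: "quotient_of r' = (k, d)" by fastforce
    have "r' = of_int k / of_int d" "d > 0" using kd quotient_of_div quotient_of_denom_pos by auto
    then have "of_nat (nat d) * r = (of_int k :: complex)"
      by (simp add: r of_rat_divide)
    then show ?thesis using \<open>d > 0\<close> by (intro exI[of _ "nat d"] exI[of _ k]) simp
  qed
  obtain D1 k1 where 1: "D1 > 0" "of_nat D1 * (a - b * p / q) = (of_int k1 :: complex)"
    using den[OF rat(1)] by blast
  obtain D2 k2 where 2: "D2 > 0" "of_nat D2 * (b / q) = (of_int k2 :: complex)"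
    using den[OF rat(2)] by blast
  have "of_nat (D1 * D2) * x = of_nat D2 * (of_nat D1 * (a - b * p / q)) + of_nat D1 * (of_nat D2 * (b / q)) * \<tau>"
    by (subst x) (simp add: algebra_simps)
  also have "\<dots> = of_nat D2 * of_int k1 + of_nat D1 * of_int k2 * \<tau>" unfolding 1 2 ..
  also have "\<dots> \<in> R" by (intro R_add R_mult R_of_int R_of_nat \<tau>)
  finally show ?thesis using 1 2 by (intro exI[of _ "D1 * D2"]) auto
qed

definition L :: "('k::finite cvec) set" where "L = {v. \<forall>i. v $ i \<in> R}"

lemma L_norm_ge_1: "v \<in> L \<Longrightarrow> v \<noteq> 0 \<Longrightarrow> 1 \<le> norm v"
  using R_cmod_ge_1 component_le_norm_cart order_trans unfolding L_def
  by (metis (mono_tags, lifting) mem_Collect_eq vec_eq_iff zero_index Finite_Cartesian_Product.norm_nth_le)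

lemma L_diff: "u \<in> L \<Longrightarrow> v \<in> L \<Longrightarrow> u - v \<in> L" by (simp add: L_def R_diff)

lemma hB_in_R: "u \<in> L \<Longrightarrow> v \<in> L \<Longrightarrow> hB u v \<in> R"
  unfolding hB_def L_def by (auto intro!: R_add R_diff R_uminus R_mult R_sum R_cnj simp del: minus_mult_left[symmetric])

lemma L_finite_ball: "finite {v \<in> L. norm v \<le> r}"
proof -
  have "finite (Pi\<^sub>E (UNIV :: 'a::finite blk set) (\<lambda>_. {x \<in> R. cmod x \<le> r}))"
    by (intro finite_PiE R_finite_ball) auto
  moreover have "vec_nth ` {v \<in> L. norm v \<le> r} \<subseteq> Pi\<^sub>E (UNIV :: 'a blk set) (\<lambda>_. {x \<in> R. cmod x \<le> r})"
    using Finite_Cartesian_Product.norm_nth_le order_trans by (fastforce simp: L_def)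
  ultimately have "finite (vec_nth ` {v \<in> L. norm v \<le> r} :: ('a blk \<Rightarrow> complex) set)"
    by (rule finite_subset[rotated])
  then show ?thesis
    by (rule finite_imageD) (simp add: inj_on_def vec_eq_iff)
qed

end

section \<open>Lattice points along the geodesic ending at a boundary point\<close>

definition e_inf :: "'k::finite cvec" where "e_inf = axis Top 1"

definition lift :: "'k::finite heis \<Rightarrow> 'k cvec" where
  "lift x = (\<chi> i. case i of Top \<Rightarrow> fst x | Bot \<Rightarrow> 1 | Mid j \<Rightarrow> snd x $ j)"

lemma lift_nth [simp]: "lift x $ Top = fst x" "lift x $ Bot = 1" "lift x $ Mid j = snd x $ j"
  by (simp_all add: lift_def)

lemma e_inf_nth [simp]: "e_inf $ Top = 1" "e_inf $ Bot = 0" "e_inf $ Mid j = 0"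
  by (simp_all add: e_inf_def axis_def)

lemma hB_e_inf [simp]: "hB v e_inf = - v $ Bot"
  by (simp add: hB_def)

lemma frame_lift: "x \<in> heis \<Longrightarrow> frame (lift x) e_inf"
  by (cases x) (simp add: frame_def hB_def heis_iff herm_dot_def)

text \<open>The Heisenberg translation taking \<open>x\<close> to the origin, followed by the
  geodesic flow for the time log N. It preserves the form and takes N \<open>lift x\<close> and
  \<open>e_inf\<close> / N to the two isotropic coordinate vectors.\<close>

definition cusp_coords :: "real \<Rightarrow> 'k::finite heis \<Rightarrow> 'k cvec \<Rightarrow> 'k cvec" where
  "cusp_coords N x v = (\<chi> i. case i of Top \<Rightarrow> - of_real N * hB v (lift x)
      | Bot \<Rightarrow> v $ Bot / of_real N | Mid j \<Rightarrow> v $ Mid j - v $ Bot * snd x $ j)"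

lemma cusp_coords_nth [simp]:
  "cusp_coords N x v $ Top = - of_real N * hB v (lift x)"
  "cusp_coords N x v $ Bot = v $ Bot / of_real N"
  "cusp_coords N x v $ Mid j = v $ Mid j - v $ Bot * snd x $ j"
  by (simp_all add: cusp_coords_def)

lemma cusp_coords_simps:
  "cusp_coords N x (u + v) = cusp_coords N x u + cusp_coords N x v"
  "cusp_coords N x (u - v) = cusp_coords N x u - cusp_coords N x v"
  "cusp_coords N x (- v) = - cusp_coords N x v"
  "cusp_coords N x (c *s v) = c *s cusp_coords N x v"
  "cusp_coords N x 0 = 0"
  by (simp_all add: blk_vec_eq_iff algebra_simps diff_divide_distrib add_divide_distrib)

lemma cusp_coords_sum: "cusp_coords N x (sum f A) = (\<Sum>i\<in>A. cusp_coords N x (f i))"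
  by (induction A rule: infinite_finite_induct) (auto simp: cusp_coords_simps)

lemma hB_cusp_coords:
  fixes x :: "'k::finite heis"
  assumes "x \<in> heis" "N \<noteq> 0"
  shows "hB (cusp_coords N x u) (cusp_coords N x v) = hB u v"
proof -
  obtain z w where x: "x = (z, w)" by fastforce
  have ww: "(\<Sum>i\<in>UNIV. w $ i * cnj (w $ i)) = z + cnj z"
    using assms(1) by (simp add: x heis_iff herm_dot_def)
  have hl: "hB v (lift x) = - v $ Top - v $ Bot * cnj z + (\<Sum>i\<in>UNIV. v $ Mid i * cnj (w $ i))" for v :: "'k cvec"
    by (simp add: hB_def x)
  have "hB (cusp_coords N x u) (cusp_coords N x v) =
     hB u (lift x) * cnj (v $ Bot) + u $ Bot * cnj (hB v (lift x))
     + (\<Sum>i\<in>UNIV. (u $ Mid i - u $ Bot * w $ i) * cnj (v $ Mid i - v $ Bot * w $ i))"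
    using assms(2) by (simp add: hB_def[of "cusp_coords N (z, w) u"] x del: cnj_hB)
  also have "(\<Sum>i\<in>UNIV. (u $ Mid i - u $ Bot * w $ i) * cnj (v $ Mid i - v $ Bot * w $ i)) =
     (\<Sum>i\<in>UNIV. u $ Mid i * cnj (v $ Mid i)) - cnj (v $ Bot) * (\<Sum>i\<in>UNIV. u $ Mid i * cnj (w $ i))
     - u $ Bot * cnj (\<Sum>i\<in>UNIV. v $ Mid i * cnj (w $ i))
     + u $ Bot * cnj (v $ Bot) * (\<Sum>i\<in>UNIV. w $ i * cnj (w $ i))"
    by (simp add: algebra_simps sum_subtractf sum.distrib sum_distrib_left)
  also have "hB u (lift x) * cnj (v $ Bot) + u $ Bot * cnj (hB v (lift x)) + \<dots> = hB u v"
    unfolding hl ww by (simp add: hB_def algebra_simps)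
  finally show ?thesis .
qed

lemma cusp_coords_lift:
  assumes "x \<in> heis" "N \<noteq> 0"
  shows "cusp_coords N x (of_real N *s lift x) = axis Bot 1"
    and "cusp_coords N x (of_real (1 / N) *s e_inf) = axis Top 1"
proof -
  have "hB e_inf (lift x) = -1" using frameD(4)[OF frame_lift[OF assms(1)]] .
  then show "cusp_coords N x (of_real (1 / N) *s e_inf) = axis Top 1"
    using assms(2) by (simp add: blk_vec_eq_iff axis_def)
  show "cusp_coords N x (of_real N *s lift x) = axis Bot 1"
    using assms frameD(1)[OF frame_lift[OF assms(1)]] by (simp add: blk_vec_eq_iff axis_def)
qed

lemma cmod_le_of_floor_eq:
  assumes "e > 0" "\<lfloor>Re a / e\<rfloor> = \<lfloor>Re b / e\<rfloor>" "\<lfloor>Im a / e\<rfloor> = \<lfloor>Im b / e\<rfloor>"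
  shows "cmod (a - b) \<le> 2 * e"
proof -
  have "\<bar>Re a / e - Re b / e\<bar> < 1" "\<bar>Im a / e - Im b / e\<bar> < 1" using assms(2,3) by linarith+
  then have "\<bar>Re (a - b)\<bar> < e" "\<bar>Im (a - b)\<bar> < e"
    using assms(1) by (simp_all add: diff_divide_distrib[symmetric] divide_less_eq)
  then show ?thesis using cmod_le[of "a - b"] by simp
qed

section \<open>Boxes of lattice points and Dirichlet's principle\<close>

context quad_order
begin

definition grid :: "nat \<times> nat \<Rightarrow> complex" where
  "grid p = of_nat (fst p) + of_nat (snd p) * \<tau>"

lemma grid_in_R: "grid p \<in> R"
  unfolding grid_def by (intro R_add R_mult R_of_nat \<tau>)

lemma grid_inj: assumes "grid p = grid q" shows "p = q"
proof -
  have "Im (grid p) = Im (grid q)" using assms by simp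
  then have s: "snd p = snd q" using \<tau>(2) by (simp add: grid_def)
  then have "fst p = fst q" using assms by (simp add: grid_def)
  with s show ?thesis by (simp add: prod_eq_iff)
qed

lemma grid_bound:
  assumes "p \<in> {..<K} \<times> {..<K}"
  shows "cmod (grid p) \<le> real K * \<rho>"
proof -
  have "cmod (grid p) \<le> real (fst p) + real (snd p) * cmod \<tau>"
    unfolding grid_def by (rule order_trans[OF norm_triangle_ineq]) (simp add: norm_mult)
  also have "\<dots> \<le> real K + real K * cmod \<tau>"
    using assms by (intro add_mono mult_right_mono) auto
  finally show ?thesis by (simp add: \<rho>_def algebra_simps)
qed

text \<open>Solves the triangular system of rounding conditions from the bottom coordinate upwards.\<close>

definition lattice_pt :: "'k::finite heis \<Rightarrow> ('k blk \<Rightarrow> nat \<times> nat) \<Rightarrow> 'k cvec" where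
  "lattice_pt x f = (let c = grid (f Bot); al = (\<lambda>j. rd (c * snd x $ j) + grid (f (Mid j)))
     in \<chi> i. case i of Bot \<Rightarrow> c | Mid j \<Rightarrow> al j
        | Top \<Rightarrow> rd (- c * cnj (fst x) + (\<Sum>j\<in>UNIV. al j * cnj (snd x $ j))) + grid (f Top))"

lemma lattice_pt_nth:
  "lattice_pt x f $ Bot = grid (f Bot)"
  "lattice_pt x f $ Mid j = rd (lattice_pt x f $ Bot * snd x $ j) + grid (f (Mid j))"
  "lattice_pt x f $ Top = rd (- lattice_pt x f $ Bot * cnj (fst x)
      + (\<Sum>j\<in>UNIV. lattice_pt x f $ Mid j * cnj (snd x $ j))) + grid (f Top)"
  by (simp_all add: lattice_pt_def Let_def)

lemma lattice_pt_in_L: "lattice_pt x f \<in> L"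
  unfolding L_def mem_Collect_eq all_blk
  by (simp add: lattice_pt_nth(1) grid_in_R) (simp add: lattice_pt_nth(2,3) R_add rd grid_in_R)

lemma lattice_pt_inj:
  assumes "lattice_pt x f = lattice_pt x g"
  shows "f = g"
proof -
  have "grid (f Bot) = grid (g Bot)" using assms lattice_pt_nth(1) by metis
  moreover have "grid (f (Mid j)) = grid (g (Mid j))" for j
    using lattice_pt_nth(2)[of x f j] lattice_pt_nth(2)[of x g j] unfolding assms by simp
  moreover have "grid (f Top) = grid (g Top)"
    using lattice_pt_nth(3)[of x f] lattice_pt_nth(3)[of x g] unfolding assms by simp
  ultimately have "\<forall>i. f i = g i" unfolding all_blk using grid_inj by blast
  then show ?thesis by blast
qed

text \<open>The side lengths compensate the weights N, 1 and 1 / N of \<open>cusp_coords\<close>, so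
  that all coordinates of the transformed points have size about N M, while the number of points is
  the same as for a cube of that side.\<close>

definition grid_size :: "nat \<Rightarrow> nat \<Rightarrow> 'k blk \<Rightarrow> nat" where
  "grid_size N M i = (case i of Bot \<Rightarrow> N * N * M | Mid _ \<Rightarrow> N * M | Top \<Rightarrow> M)"

lemma lattice_pt_bound:
  fixes x :: "'k::finite heis"
  assumes f: "\<And>i. f i \<in> {..<grid_size N M i} \<times> {..<grid_size N M i}" and "N > 0" "M > 0"
  shows "cmod (cusp_coords (real N) x (lattice_pt x f) $ i) \<le> 2 * real (N * M) * \<rho>"
proof -
  let ?v = "lattice_pt x f"
  have NM: "1 \<le> real N" "1 \<le> real M" using assms by auto
  then have NM1: "1 \<le> real N * real M" using mult_mono[of 1 "real N" 1 "real M"] by simp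
  have r: "0 < \<rho>" using \<rho>_ge by linarith
  have T: "cmod (cusp_coords (real N) x ?v $ Top) \<le> 2 * real (N * M) * \<rho>"
  proof -
    let ?y = "- ?v $ Bot * cnj (fst x) + (\<Sum>j\<in>UNIV. ?v $ Mid j * cnj (snd x $ j))"
    have hv: "hB ?v (lift x) = (?y - rd ?y) - grid (f Top)"
      using lattice_pt_nth(3)[of x f] by (simp add: hB_def)
    have "cmod (hB ?v (lift x)) \<le> cmod (?y - rd ?y) + cmod (grid (f Top))"
      unfolding hv by (rule norm_triangle_ineq4)
    also have "\<dots> \<le> \<rho> + real M * \<rho>"
      using rd(2) grid_bound[OF f[of Top]] by (intro add_mono) (auto simp: grid_size_def)
    also have "\<dots> \<le> 2 * real M * \<rho>" using NM r by (simp add: algebra_simps)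
    finally have "real N * cmod (hB ?v (lift x)) \<le> real N * (2 * real M * \<rho>)"
      by (intro mult_left_mono) auto
    then show ?thesis by (simp add: norm_mult mult_ac)
  qed
  have B: "cmod (cusp_coords (real N) x ?v $ Bot) \<le> 2 * real (N * M) * \<rho>"
  proof -
    have "cmod (grid (f Bot)) \<le> real (N * N * M) * \<rho>"
      using grid_bound[OF f[of Bot]] by (simp add: grid_size_def)
    then have "cmod (grid (f Bot)) / real N \<le> real (N * M) * \<rho>"
      using NM by (simp add: divide_le_eq mult_ac)
    also have "\<dots> \<le> 2 * real (N * M) * \<rho>" using r by simp
    finally show ?thesis by (simp add: lattice_pt_nth(1) norm_divide)
  qed
  have M: "cmod (cusp_coords (real N) x ?v $ Mid j) \<le> 2 * real (N * M) * \<rho>" for j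
  proof -
    let ?y = "?v $ Bot * snd x $ j"
    have hv: "cusp_coords (real N) x ?v $ Mid j = grid (f (Mid j)) - (?y - rd ?y)"
      using lattice_pt_nth(2)[of x f j] by simp
    have "cmod (cusp_coords (real N) x ?v $ Mid j) \<le> cmod (grid (f (Mid j))) + cmod (?y - rd ?y)"
      unfolding hv by (rule norm_triangle_ineq4)
    also have "\<dots> \<le> real (N * M) * \<rho> + 1 * \<rho>"
      using rd(2)[of ?y] grid_bound[OF f[of "Mid j"]] by (intro add_mono) (auto simp: grid_size_def)
    also have "\<dots> \<le> real (N * M) * \<rho> + real (N * M) * \<rho>"
      using NM1 r by (intro add_left_mono mult_right_mono) auto
    finally show ?thesis by (simp only: mult_2 distrib_right)
  qed
  show ?thesis using T B M by (cases i) auto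
qed

text \<open>Pigeonhole on box points shifted by a multiple s of the j-th coordinate vector, with s
  up to \<open>J\<close>. A collision of equal shifts yields a short nonzero lattice vector, a
  collision of different shifts a lattice vector close to a multiple of the coordinate vector. The
  bound \<open>J\<close> depends on neither N nor \<open>x\<close>.\<close>

lemma dirichlet:
  fixes \<eta> :: real
  assumes \<eta>: "\<eta> > 0"
  shows "\<exists>J::nat. \<forall>N>0. \<forall>x :: 'k::finite heis. \<forall>j.
     (\<exists>v\<in>L. v \<noteq> 0 \<and> (\<forall>i. cmod (cusp_coords (real N) x v $ i) \<le> \<eta>)) \<or>
     (\<exists>v\<in>L. \<exists>s::nat. 1 \<le> s \<and> s \<le> J \<and>
        (\<forall>i. cmod (cusp_coords (real N) x v $ i - (if i = j then of_nat s else 0)) \<le> \<eta>))"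
proof -
  define e where "e = \<eta> / 2"
  have e0: "e > 0" using \<eta> by (simp add: e_def)
  define d where "d = 2 * CARD('k blk)"
  define E where "E = nat \<lceil>2 * (2 * \<rho> + 1) / e + 4\<rceil>"
  \<comment> \<open>There are at most (E N J)^d = J (N J)^d cells and (J + 1) (N J)^d shifted
    points. The width \<open>E\<close> does not involve \<open>J\<close>, so this choice is not
    circular.\<close>
  define J where "J = E ^ d"
  have r1: "1 \<le> \<rho>" by (rule \<rho>_ge)
  have E0: "2 * (2 * \<rho> + 1) / e + 4 \<le> real E" unfolding E_def by linarith
  have "0 \<le> 2 * (2 * \<rho> + 1) / e" using r1 e0 by simp
  then have "E > 0" using E0 by linarith
  then have J0: "J > 0" by (simp add: J_def)
  show ?thesis
  proof (intro exI[of _ J] allI impI)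
    fix N :: nat and x :: "'k heis" and j :: "'k blk"
    assume N: "N > 0"
    define F where "F = Pi\<^sub>E (UNIV :: 'k blk set) (\<lambda>i. {..<grid_size N J i} \<times> {..<grid_size N J i})"
    define b where "b = (2 * real (N * J) * \<rho> + real J) / e"
    define B where "B = \<lceil>b\<rceil> + 1"
    define Z where "Z = Pi\<^sub>E (UNIV :: 'k blk set) (\<lambda>i. {-B..<B} \<times> {-B..<B})"
    define T where "T s f = cusp_coords (real N) x (lattice_pt x f) + (\<chi> i. if i = j then of_nat s else 0)"
      for s :: nat and f
    define \<Phi> where "\<Phi> = (\<lambda>(s, f). \<lambda>i. (\<lfloor>Re (T s f $ i) / e\<rfloor>, \<lfloor>Im (T s f $ i) / e\<rfloor>))"
    have NJ: "1 \<le> real N * real J" using N J0 by (metis One_nat_def Suc_leI of_nat_1 of_nat_le_iff of_nat_mult nat_0_less_mult_iff)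
    have Jle: "real J \<le> real (N * J)" by (subst of_nat_le_iff) (use N in simp)
    have b0: "0 \<le> b" using r1 e0 by (simp add: b_def)
    have B0: "0 \<le> B" using b0 by (simp add: B_def)
    have cardF: "card F = (N * J) ^ d"
    proof -
      have "card F = (\<Prod>i\<in>UNIV. grid_size N J (i :: 'k blk) ^ 2)"
        by (simp add: F_def card_PiE card_cartesian_product power2_eq_square)
      also have "\<dots> = ((N * J) ^ 2) ^ 2 * ((N * J) ^ 2) ^ CARD('k)"
        by (simp add: prod_blk grid_size_def power2_eq_square)
      also have "\<dots> = (N * J) ^ (2 * 2 + 2 * CARD('k))"
        by (simp only: power_mult power_add)
      also have "2 * 2 + 2 * CARD('k) = d" by (simp add: d_def card_blk)
      finally show ?thesis .
    qed
    have cardZ: "card Z = (nat (2 * B)) ^ d"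
    proof -
      have "card Z = (nat (2 * B) ^ 2) ^ CARD('k blk)"
        by (simp add: Z_def card_PiE card_cartesian_product power2_eq_square)
      then show ?thesis by (simp add: d_def power_mult)
    qed
    have "real (nat (2 * B)) \<le> 2 * b + 4" using B0 by (simp add: B_def) linarith
    also have "2 * b \<le> 2 * (2 * real (N * J) * \<rho> + real (N * J)) / e"
      using Jle e0 by (simp add: b_def divide_right_mono)
    also have "2 * (2 * real (N * J) * \<rho> + real (N * J)) / e = (2 * (2 * \<rho> + 1) / e) * real (N * J)"
      by (simp add: algebra_simps add_divide_distrib)
    also have "(2 * (2 * \<rho> + 1) / e) * real (N * J) + 4 \<le> (2 * (2 * \<rho> + 1) / e + 4) * real (N * J)"
      using NJ by (simp add: algebra_simps)
    also have "\<dots> \<le> real E * real (N * J)" using E0 by (intro mult_right_mono) auto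
    finally have "nat (2 * B) \<le> E * (N * J)"
      by (simp flip: of_nat_mult)
    then have "card Z \<le> (E * (N * J)) ^ d" unfolding cardZ by (intro power_mono) auto
    also have "\<dots> = J * (N * J) ^ d" by (simp add: J_def power_mult_distrib)
    also have "\<dots> < (J + 1) * (N * J) ^ d" using N J0 by simp
    also have "\<dots> = card ({..J} \<times> F)" by (simp add: card_cartesian_product cardF)
    finally have card_less: "card Z < card ({..J} \<times> F)" .
    have "\<Phi> ` ({..J} \<times> F) \<subseteq> Z"
    proof
      fix p assume "p \<in> \<Phi> ` ({..J} \<times> F)"
      then obtain s f where sf: "s \<le> J" "f \<in> F" "p = \<Phi> (s, f)" by auto
      have "p i \<in> {-B..<B} \<times> {-B..<B}" for i
      proof -
        have "cmod (T s f $ i) \<le> cmod (cusp_coords (real N) x (lattice_pt x f) $ i) + real s"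
          unfolding T_def by (auto intro: norm_triangle_mono)
        also have "\<dots> \<le> 2 * real (N * J) * \<rho> + real J"
          using sf N J0 by (intro add_mono lattice_pt_bound) (auto simp: F_def PiE_iff)
        finally have "cmod (T s f $ i) / e \<le> b" using e0 by (simp add: b_def divide_right_mono)
        moreover have "\<bar>Re (T s f $ i) / e\<bar> \<le> cmod (T s f $ i) / e" "\<bar>Im (T s f $ i) / e\<bar> \<le> cmod (T s f $ i) / e"
          using e0 abs_Re_le_cmod abs_Im_le_cmod by (simp_all add: divide_right_mono)
        ultimately have "\<bar>Re (T s f $ i) / e\<bar> \<le> b" "\<bar>Im (T s f $ i) / e\<bar> \<le> b" by linarith+
        moreover have "-B \<le> \<lfloor>r\<rfloor> \<and> \<lfloor>r\<rfloor> < B" if "\<bar>r\<bar> \<le> b" for r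
          using that unfolding B_def by linarith
        ultimately show ?thesis unfolding sf(3) \<Phi>_def by (auto simp del: floor_less_iff floor_le_iff le_floor_iff less_floor_iff)
      qed
      then show "p \<in> Z" by (simp add: Z_def PiE_iff)
    qed
    moreover have "finite Z" unfolding Z_def by (intro finite_PiE) auto
    ultimately have "\<not> inj_on \<Phi> ({..J} \<times> F)"
      using card_less card_inj_on_le by (metis leD)
    then obtain p p' where p: "p \<in> {..J} \<times> F" "p' \<in> {..J} \<times> F" "\<Phi> p = \<Phi> p'" "p \<noteq> p'"
      unfolding inj_on_def by blast
    obtain s f s' f' where "p = (s, f)" "p' = (s', f')" by (metis surj_pair)
    with p have ne: "(s, f) \<noteq> (s', f')" and J: "s \<le> J" "s' \<le> J" and eq: "\<Phi> (s, f) = \<Phi> (s', f')"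
      by auto
    have close: "cmod (T s f $ i - T s' f' $ i) \<le> \<eta>" for i
      using cmod_le_of_floor_eq[OF e0, of "T s f $ i" "T s' f' $ i"] fun_cong[OF eq, of i]
      by (simp add: \<Phi>_def e_def)
    let ?G = "\<exists>v\<in>L. \<exists>s::nat. 1 \<le> s \<and> s \<le> J \<and>
        (\<forall>i. cmod (cusp_coords (real N) x v $ i - (if i = j then of_nat s else 0)) \<le> \<eta>)"
    have main: ?G if "s \<le> J" "s' \<le> J" "s' < s" and c: "\<And>i. cmod (T s f $ i - T s' f' $ i) \<le> \<eta>"
      for s s' f f'
    proof -
      define v where "v = lattice_pt x f' - lattice_pt x f"
      have "v \<in> L" unfolding v_def by (intro L_diff lattice_pt_in_L)
      moreover have "cmod (cusp_coords (real N) x v $ i - (if i = j then of_nat (s - s') else 0)) \<le> \<eta>" for i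
      proof -
        have "cusp_coords (real N) x v $ i - (if i = j then of_nat (s - s') else 0) = - (T s f $ i - T s' f' $ i)"
          using that by (simp add: v_def T_def cusp_coords_simps of_nat_diff)
        then show ?thesis using c[of i] by (simp only: norm_minus_cancel)
      qed
      ultimately show ?G using that
        by (intro bexI[of _ v] exI[of _ "s - s'"]) auto
    qed
    consider "s = s'" | "s' < s" | "s < s'" by linarith
    then show "(\<exists>v\<in>L. v \<noteq> 0 \<and> (\<forall>i. cmod (cusp_coords (real N) x v $ i) \<le> \<eta>)) \<or> ?G"
    proof cases
      case 1
      define v where "v = lattice_pt x f - lattice_pt x f'"
      have "v \<in> L" unfolding v_def by (intro L_diff lattice_pt_in_L)
      moreover have "v \<noteq> 0" using ne 1 lattice_pt_inj[of x f f'] by (auto simp: v_def)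
      moreover have "cusp_coords (real N) x v $ i = T s f $ i - T s' f' $ i" for i
        by (simp add: v_def T_def 1 cusp_coords_simps)
      ultimately show ?thesis using close by metis
    next
      case 2
      then show ?thesis using main J close by blast
    next
      case 3
      have "cmod (T s' f' $ i - T s f $ i) \<le> \<eta>" for i using close[of i] by (simp add: norm_minus_commute)
      then show ?thesis using main[of s' s f' f] 3 J by blast
    qed
  qed
qed

end

section \<open>Recurrence of geodesics with irrational endpoint\<close>

text \<open>Diagonal dominance: look at the coordinate of \<open>y\<close> of largest modulus. There
  the off-diagonal errors take away at most half of that modulus.\<close>

lemma diag_dominant_bound:
  fixes t :: "'n::finite \<Rightarrow> complex ^ 'n"
  assumes t: "\<And>i j. cmod (t j $ i - (if i = j then of_nat (s j) else 0)) \<le> \<eta>"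
    and s: "\<And>j. 1 \<le> s j" and \<eta>: "real CARD('n) * \<eta> \<le> 1 / 2"
    and r: "\<And>i. cmod ((\<Sum>j\<in>UNIV. y $ j *s t j) $ i) \<le> B"
  shows "cmod (y $ i) \<le> 2 * B"
proof -
  have "Max (range (\<lambda>i. cmod (y $ i))) \<in> range (\<lambda>i. cmod (y $ i))" by (rule Max_in) auto
  then obtain k where "Max (range (\<lambda>i. cmod (y $ i))) = cmod (y $ k)" by blast
  moreover have "cmod (y $ i) \<le> Max (range (\<lambda>i. cmod (y $ i)))" for i by (rule Max_ge) auto
  ultimately have k: "\<And>i. cmod (y $ i) \<le> cmod (y $ k)" by simp
  define M where "M = cmod (y $ k)"
  define D where "D j = t j $ k - (if k = j then of_nat (s j) else 0)" for j
  have \<eta>0: "0 \<le> \<eta>" using t[of undefined undefined] norm_ge_zero order_trans by blast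
  have "(\<Sum>j\<in>UNIV. y $ j *s t j) $ k = (\<Sum>j\<in>UNIV. y $ j * D j + (if k = j then y $ j * of_nat (s j) else 0))"
    by (simp add: D_def algebra_simps) (rule sum.cong, auto simp: algebra_simps)
  also have "\<dots> = (\<Sum>j\<in>UNIV. y $ j * D j) + y $ k * of_nat (s k)"
    by (simp add: sum.distrib)
  finally have "y $ k * of_nat (s k) = (\<Sum>j\<in>UNIV. y $ j *s t j) $ k - (\<Sum>j\<in>UNIV. y $ j * D j)" by simp
  then have "cmod (y $ k * of_nat (s k)) \<le> cmod ((\<Sum>j\<in>UNIV. y $ j *s t j) $ k) + cmod (\<Sum>j\<in>UNIV. y $ j * D j)"
    using norm_triangle_ineq4 by metis
  also have "cmod ((\<Sum>j\<in>UNIV. y $ j *s t j) $ k) \<le> B" by (rule r)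
  also have "cmod (\<Sum>j\<in>UNIV. y $ j * D j) \<le> (\<Sum>j\<in>(UNIV::'n set). M * \<eta>)"
  proof (rule sum_norm_le)
    fix j
    have "cmod (D j) \<le> \<eta>" unfolding D_def by (rule t)
    then show "cmod (y $ j * D j) \<le> M * \<eta>"
      unfolding norm_mult M_def by (intro mult_mono k) auto
  qed
  also have "\<dots> = M * (real CARD('n) * \<eta>)" by simp
  also have "\<dots> \<le> M * (1 / 2)" using \<eta> by (intro mult_left_mono) (auto simp: M_def)
  finally have "cmod (y $ k * of_nat (s k)) \<le> B + M / 2" by simp
  moreover have "M * 1 \<le> M * real (s k)" using s[of k] by (intro mult_left_mono) (auto simp: M_def)
  then have "M \<le> cmod (y $ k * of_nat (s k))" by (simp add: norm_mult M_def)
  ultimately have "M \<le> 2 * B" by simp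
  then show ?thesis using k[of i] by (simp add: M_def)
qed

lemma norm_le_card_mult:
  fixes v :: "complex ^ 'n::finite"
  assumes "\<And>i. cmod (v $ i) \<le> B"
  shows "norm v \<le> real CARD('n) * B"
proof -
  have "norm v \<le> (\<Sum>i\<in>UNIV. cmod (v $ i))" unfolding norm_vec_def by (rule L2_set_le_sum) auto
  also have "\<dots> \<le> (\<Sum>i\<in>(UNIV::'n set). B)" by (intro sum_mono assms)
  finally show ?thesis by simp
qed

lemma finite_matrices:
  assumes "finite F"
  shows "finite {A :: 'a ^ 'n::finite ^ 'm::finite. \<forall>i j. A $ i $ j \<in> F}"
proof -
  have fin: "finite {v :: 'b ^ 'p::finite. \<forall>i. v $ i \<in> G}" if "finite G" for G
  proof -
    have "finite (Pi\<^sub>E (UNIV :: 'p set) (\<lambda>_. G))" using that by (intro finite_PiE) auto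
    then have "finite (vec_nth ` {v :: 'b ^ 'p. \<forall>i. v $ i \<in> G})"
      by (rule finite_subset[rotated]) auto
    then show ?thesis by (rule finite_imageD) (simp add: inj_on_def vec_eq_iff)
  qed
  have "{A :: 'a ^ 'n ^ 'm. \<forall>i j. A $ i $ j \<in> F} = {A. \<forall>i. A $ i \<in> {v. \<forall>j. v $ j \<in> F}}" by auto
  then show ?thesis using fin[OF fin[OF assms]] by simp
qed

lemma finite_image_bounded_rep:
  fixes g :: "'a \<Rightarrow> real"
  assumes "finite (f ` A)"
  shows "\<exists>C. \<forall>a\<in>A. \<exists>b\<in>A. f b = f a \<and> g b \<le> C"
proof -
  define h where "h = inv_into A f"
  have fin: "finite ((\<lambda>c. g (h c)) ` f ` A)" using assms by simp
  show ?thesis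
  proof (intro exI ballI)
    fix a assume "a \<in> A"
    then have "h (f a) \<in> A" "f (h (f a)) = f a" unfolding h_def by (auto intro: inv_into_into f_inv_into_f)
    moreover have "g (h (f a)) \<le> Max ((\<lambda>c. g (h c)) ` f ` A)"
      using fin \<open>a \<in> A\<close> by (intro Max_ge) auto
    ultimately show "\<exists>b\<in>A. f b = f a \<and> g b \<le> Max ((\<lambda>c. g (h c)) ` f ` A)" by blast
  qed
qed

section \<open>Gram matrices and irrational points\<close>

lemma hB_matrix_mult:
  "hB (b *v c) (b *v d) = (\<Sum>i\<in>UNIV. \<Sum>j\<in>UNIV. c $ i * cnj (d $ j) * hB (column i b) (column j b))"
proof -
  have l: "hB (sum f A) v = (\<Sum>i\<in>A. hB (f i) v)" for f v and A :: "'b set"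
    by (induction A rule: infinite_finite_induct) auto
  have r: "hB v (sum f A) = (\<Sum>i\<in>A. hB v (f i))" for f v and A :: "'b set"
    by (induction A rule: infinite_finite_induct) auto
  show ?thesis
    unfolding matrix_mult_sum l r by (subst sum.swap) (simp add: sum_distrib_left mult_ac)
qed

lemma det_cnj: "det (\<chi> i j. cnj (b $ i $ j)) = cnj (det b)"
  by (simp add: det_def)

definition gram :: "complex ^ 'k::finite blk ^ 'k blk \<Rightarrow> complex ^ 'k blk ^ 'k blk" where
  "gram b = (\<chi> i j. hB (column i b) (column j b))"

text \<open>The matrix of the form \<open>hB\<close> in the standard basis.\<close>

definition swapJ :: "complex ^ 'k::finite blk ^ 'k blk" where
  "swapJ = (\<chi> i j. case i of Top \<Rightarrow> if j = Bot then -1 else 0 | Bot \<Rightarrow> if j = Top then -1 else 0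
      | Mid l \<Rightarrow> if j = Mid l then 1 else 0)"

lemma det_swapJ: "det (swapJ :: complex ^ 'k::finite blk ^ 'k blk) \<noteq> 0"
proof -
  have J: "(swapJ *v v) $ Top = - v $ Bot" "(swapJ *v v) $ Bot = - v $ Top" "(swapJ *v v) $ Mid j = v $ Mid j"
    for v :: "'k cvec" and j
    by (simp_all add: matrix_vector_mult_def sum_blk swapJ_def mult_delta_left)
  have "swapJ ** swapJ = (mat 1 :: complex ^ 'k blk ^ 'k blk)"
    unfolding matrix_eq
    by (simp add: matrix_vector_mul_assoc[symmetric] blk_vec_eq_iff J)
  then have "det (swapJ :: complex ^ 'k blk ^ 'k blk) * det (swapJ :: complex ^ 'k blk ^ 'k blk) = 1"
    by (metis det_I det_mul)
  then show ?thesis by auto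
qed

text \<open>The Gram matrix is the transpose of \<open>b\<close> times \<open>swapJ\<close> times
  the conjugate of \<open>b\<close>. Consequently bounded Gram matrices bound the determinants of
  frames.\<close>

lemma det_gram: "det (gram b) = det b * det (swapJ :: complex ^ 'k blk ^ 'k blk) * cnj (det b)"
  for b :: "complex ^ 'k::finite blk ^ 'k blk"
proof -
  have "gram b = transpose b ** (swapJ ** (\<chi> i j. cnj (b $ i $ j)))"
    by (simp add: vec_eq_iff gram_def matrix_matrix_mult_def hB_def sum_blk swapJ_def column_def transpose_def
        mult_delta_left)
  then show ?thesis by (simp add: det_mul det_cnj det_transpose)
qed

context quad_order
begin

lemma R_det: assumes "\<And>i j. b $ i $ j \<in> R" shows "det b \<in> R"
  unfolding det_def by (intro R_sum R_mult R_of_int R_prod assms)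

text \<open>Irrationality in a form that refers only to \<open>L\<close> and \<open>hB\<close>, so
  that it can be transported by the group.\<close>

definition irrat :: "'k::finite heis \<Rightarrow> bool" where
  "irrat x \<longleftrightarrow> x \<in> heis \<and> (\<forall>v\<in>L. v \<noteq> 0 \<longrightarrow> hB v v = 0 \<longrightarrow> hB v (lift x) \<noteq> 0)"

lemma R_quotient: assumes "x \<in> R" "y \<in> R" shows "x / y \<in> quad_field m"
proof -
  obtain k where k: "y * cnj y = of_nat k" using R_norm_nat[OF assms(2)] by auto
  have "x * cnj y \<in> R" using assms R_mult R_cnj by blast
  then obtain a b where ab: "a \<in> \<rat>" "b \<in> \<rat>" "x * cnj y = a + b * (\<i> * of_real (sqrt (real m)))"
    using R_subset by blast
  have "x / y = x * cnj y / (y * cnj y)" by simp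
  also have "\<dots> = a / of_nat k + b / of_nat k * (\<i> * of_real (sqrt (real m)))"
    unfolding ab(3) k by (simp add: add_divide_distrib)
  finally show ?thesis using ab unfolding quad_field_def by (blast intro: Rats_divide Rats_of_nat)
qed

text \<open>A lattice vector violating \<open>irrat\<close> is collinear with \<open>lift x\<close>
  by \<open>isotropic_collinear\<close>, and dividing by its \<open>Bot\<close> coordinate exhibits
  \<open>x\<close> over the field. Conversely, clearing denominators of \<open>lift x\<close> gives
  such a vector.\<close>

lemma irrat_iff:
  fixes x :: "'k::finite heis"
  assumes x: "x \<in> heis"
  shows "irrat x \<longleftrightarrow> x \<notin> heis_rat m"
proof
  assume ir: "irrat x"
  show "x \<notin> heis_rat m"
  proof
    assume rat: "x \<in> heis_rat m"
    have "lift x $ i \<in> quad_field m" for i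
    proof (cases i)
      case Bot
      have "1 / 1 \<in> quad_field m" using R_quotient[OF R_one R_one] .
      then show ?thesis using Bot by simp
    qed (use rat in \<open>auto simp: heis_rat_def\<close>)
    then have "\<exists>D::nat. D > 0 \<and> of_nat D * lift x $ i \<in> R" for i
      using quad_field_multiple_in_R by blast
    then obtain D :: "'k blk \<Rightarrow> nat" where D: "\<And>i. D i > 0" "\<And>i. of_nat (D i) * lift x $ i \<in> R"
      by metis
    define P where "P = (\<Prod>i\<in>UNIV. D i)"
    have P0: "P > 0" using D(1) by (simp add: P_def)
    have PR: "of_nat P * lift x $ i \<in> R" for i
    proof -
      have "P = D i * (\<Prod>j\<in>UNIV - {i}. D j)" unfolding P_def by (rule prod.remove) auto
      then have "of_nat P = of_nat (\<Prod>j\<in>UNIV - {i}. D j) * (of_nat (D i) :: complex)"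
        by (metis of_nat_mult mult.commute)
      then have "of_nat P * lift x $ i = of_nat (\<Prod>j\<in>UNIV - {i}. D j) * (of_nat (D i) * lift x $ i)"
        by (simp only: mult.assoc)
      then show ?thesis by (simp only: R_mult R_of_nat D(2))
    qed
    define v where "v = of_nat P *s lift x"
    have "v \<in> L" using PR by (simp add: v_def L_def)
    moreover have "hB v v = 0" "hB v (lift x) = 0"
      using frameD(1)[OF frame_lift[OF x]] by (simp_all add: v_def)
    moreover have "v $ Bot \<noteq> 0" using P0 by (simp add: v_def)
    then have "v \<noteq> 0" by auto
    ultimately show False using ir unfolding irrat_def by blast
  qed
next
  assume nr: "x \<notin> heis_rat m"
  show "irrat x" unfolding irrat_def
  proof (intro conjI ballI impI x notI)
    fix v assume v: "v \<in> L" "v \<noteq> 0" "hB v v = 0" "hB v (lift x) = 0"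
    have "lift x \<noteq> 0" by (metis lift_nth(2) zero_index zero_neq_one)
    then obtain c where c: "v = c *s lift x"
      using isotropic_collinear[OF v(3) frameD(1)[OF frame_lift[OF x]] v(4)] by blast
    have c0: "c \<noteq> 0" using c v(2) by auto
    have cB: "v $ Bot = c" using c by simp
    have "lift x $ i = v $ i / v $ Bot" for i using c c0 by simp
    moreover have "v $ i / v $ Bot \<in> quad_field m" for i using v(1) R_quotient by (simp add: L_def)
    ultimately have q: "lift x $ i \<in> quad_field m" for i by simp
    have "x \<in> heis_rat m" using x q[of Top] q[of "Mid i" for i] by (cases x) (auto simp: heis_rat_def)
    with nr show False by simp
  qed
qed

text \<open>Half the inverse dimension: it makes short vectors have norm at most 1 / 2 and the
  near-diagonal matrices of \<open>dirichlet\<close> diagonally dominant.\<close>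

definition \<eta>0 :: "'k::finite itself \<Rightarrow> real" where "\<eta>0 _ = 1 / (2 * real CARD('k blk))"

text \<open>The form takes values in \<open>R\<close>, where nonzero elements have modulus at least
  1, but here it is at most 3 / 8. The slack 3 / 2 for \<open>v\<close> allows a vector that is
  short at time N + 1 to be used at time N.\<close>

lemma hB_zero_if_short:
  fixes x :: "'k::finite heis"
  assumes x: "x \<in> heis" and "u \<in> L" "v \<in> L" and N: "N > 0"
    and u: "\<And>i. cmod (cusp_coords N x u $ i) \<le> \<eta>0 TYPE('k)"
    and v: "\<And>i. cmod (cusp_coords N x v $ i) \<le> 3 / 2 * \<eta>0 TYPE('k)"
  shows "hB u v = 0"
proof (rule ccontr)
  assume nz: "hB u v \<noteq> 0"
  have "norm (cusp_coords N x u) \<le> 1/2" "norm (cusp_coords N x v) \<le> 3/4"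
    using norm_le_card_mult[of "cusp_coords N x u", OF u] norm_le_card_mult[of "cusp_coords N x v", OF v]
    by (simp_all add: \<eta>0_def)
  then have "norm (cusp_coords N x u) * norm (cusp_coords N x v) \<le> 1/2 * (3/4)"
    by (intro mult_mono) auto
  then have "cmod (hB u v) \<le> 3/8"
    using cmod_hB_le[of "cusp_coords N x u" "cusp_coords N x v"] hB_cusp_coords[OF x, of N u v] N by simp
  then show False using R_cmod_ge_1[OF hB_in_R[OF assms(2,3)] nz] by simp
qed

text \<open>If short vectors existed at all late times, each would be isotropic and orthogonal to
  its successor, hence all multiples of one vector \<open>V M\<close>. The multiples are bounded
  below because lattice vectors have norm at least 1, so N times the fixed nonzero number
  \<open>hB (V M) (lift x)\<close> would stay bounded.\<close>

lemma exists_no_short_vector: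
  fixes x :: "'k::finite heis"
  assumes ir: "irrat x"
  shows "\<exists>N\<ge>N0. N > 0 \<and> \<not> (\<exists>v\<in>L. v \<noteq> 0 \<and> (\<forall>i. cmod (cusp_coords (real N) x v $ i) \<le> \<eta>0 TYPE('k)))"
proof (rule ccontr)
  assume "\<not> ?thesis"
  then have "\<forall>N\<in>{max N0 2..}. \<exists>v\<in>L. v \<noteq> 0 \<and> (\<forall>i. cmod (cusp_coords (real N) x v $ i) \<le> \<eta>0 TYPE('k))"
    by auto
  then obtain V where V: "\<And>N. N \<ge> max N0 2 \<Longrightarrow> V N \<in> L" "\<And>N. N \<ge> max N0 2 \<Longrightarrow> V N \<noteq> 0"
     "\<And>N i. N \<ge> max N0 2 \<Longrightarrow> cmod (cusp_coords (real N) x (V N) $ i) \<le> \<eta>0 TYPE('k)"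
    by (metis atLeast_iff)
  define M where "M = max N0 2"
  have x: "x \<in> heis" using ir by (simp add: irrat_def)
  have \<eta>0: "\<eta>0 TYPE('k) > 0" by (simp add: \<eta>0_def)
  have iso: "hB (V N) (V N) = 0" if "N \<ge> M" for N
  proof (rule hB_zero_if_short[OF x, of _ _ "real N"])
    show "V N \<in> L" "V N \<in> L" "0 < real N" using V that by (auto simp: M_def)
    show c: "cmod (cusp_coords (real N) x (V N) $ i) \<le> \<eta>0 TYPE('k)" for i using V that by (auto simp: M_def)
    show "cmod (cusp_coords (real N) x (V N) $ i) \<le> 3 / 2 * \<eta>0 TYPE('k)" for i
      using c[of i] \<eta>0 by linarith
  qed
  have orth: "hB (V N) (V (Suc N)) = 0" if N: "N \<ge> M" for N
  proof (rule hB_zero_if_short[OF x, of _ _ "real N"])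
    show "V N \<in> L" "V (Suc N) \<in> L" "0 < real N" using V N by (auto simp: M_def)
    show "cmod (cusp_coords (real N) x (V N) $ i) \<le> \<eta>0 TYPE('k)" for i using V N by (auto simp: M_def)
    show "cmod (cusp_coords (real N) x (V (Suc N)) $ i) \<le> 3 / 2 * \<eta>0 TYPE('k)" for i
    proof -
      have h: "cmod (cusp_coords (real (Suc N)) x (V (Suc N)) $ i) \<le> \<eta>0 TYPE('k)"
        using V(3)[of "Suc N"] N by (simp add: M_def)
      have N2: "2 \<le> real N" using N by (simp add: M_def)
      show ?thesis
      proof (cases i)
        case Top
        have "real N * cmod (hB (V (Suc N)) (lift x)) \<le> real (Suc N) * cmod (hB (V (Suc N)) (lift x))"
          by (intro mult_right_mono) auto
        moreover have ct: "cmod (cusp_coords r x (V (Suc N)) $ Top) = r * cmod (hB (V (Suc N)) (lift x))"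
          if "0 \<le> r" for r
          using that by (simp add: norm_mult)
        ultimately show ?thesis
          using h[unfolded Top ct[OF of_nat_0_le_iff[of "Suc N"]]] \<eta>0 unfolding Top
            ct[OF of_nat_0_le_iff[of N]] ct[OF of_nat_0_le_iff[of "Suc N"]] by linarith
      next
        case Bot
        have "cmod (V (Suc N) $ Bot) \<le> real (Suc N) * \<eta>0 TYPE('k)"
        proof -
          have "cmod (cusp_coords (real (Suc N)) x (V (Suc N)) $ Bot) = cmod (V (Suc N) $ Bot) / real (Suc N)"
            by (simp add: norm_divide del: of_nat_Suc)
          then show ?thesis using h[unfolded Bot] by (simp add: pos_divide_le_eq mult.commute del: of_nat_Suc)
        qed
        \<comment> \<open>N + 1 is at most 3 N / 2 because N is at least 2; this is the reason for
          the 2 in \<open>max N0 2\<close>.\<close>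
        also have "\<dots> \<le> (3/2 * real N) * \<eta>0 TYPE('k)"
          using N2 \<eta>0 by (intro mult_right_mono) auto
        finally show ?thesis using Bot N2 by (simp add: norm_divide field_simps)
      next
        case (Mid j)
        then show ?thesis using h \<eta>0 by simp
      qed
    qed
  qed
  have coll: "\<exists>c. V N = c *s V M" if "N \<ge> M" for N
    using that
  proof (induction N rule: dec_induct)
    case base
    show ?case by (intro exI[of _ 1]) simp
  next
    case (step n)
    then obtain c where c: "V n = c *s V M" by blast
    have "hB (V (Suc n)) (V n) = 0" using orth[OF step(1)] by (metis cnj_hB complex_cnj_zero)
    then obtain d where d: "V (Suc n) = d *s V n"
      using isotropic_collinear[OF iso iso] step(1) V(2)[of n] by (metis M_def le_Suc_eq)
    show ?case by (intro exI[of _ "d * c"]) (simp add: d c)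
  qed
  define h where "h = cmod (hB (V M) (lift x))"
  have "V M \<in> L" "V M \<noteq> 0" "hB (V M) (V M) = 0" using V iso by (auto simp: M_def)
  then have h0: "h > 0" using ir by (simp add: h_def irrat_def)
  have bound: "real N * h \<le> norm (V M) * \<eta>0 TYPE('k)" if N: "N \<ge> M" for N
  proof -
    obtain c where c: "V N = c *s V M" using coll[OF N] by blast
    have "1 \<le> norm (V N)" using V N by (intro L_norm_ge_1) (auto simp: M_def)
    then have 1: "1 \<le> cmod c * norm (V M)" by (simp add: c norm_scalar_mult)
    have "real N * cmod (hB (V N) (lift x)) \<le> \<eta>0 TYPE('k)"
      using V(3)[of N Top] N by (simp add: norm_mult M_def)
    then have 2: "cmod c * (real N * h) \<le> \<eta>0 TYPE('k)" by (simp add: c norm_mult h_def mult_ac)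
    have "real N * h * 1 \<le> real N * h * (cmod c * norm (V M))"
      using 1 h0 by (intro mult_left_mono) auto
    also have "\<dots> = norm (V M) * (cmod c * (real N * h))" by (simp add: mult_ac)
    also have "\<dots> \<le> norm (V M) * \<eta>0 TYPE('k)" using 2 by (intro mult_left_mono) auto
    finally show ?thesis by simp
  qed
  obtain N where "norm (V M) * \<eta>0 TYPE('k) < real N * h" using h0 reals_Archimedean3 by blast
  moreover have "real N * h \<le> real (max N M) * h" using h0 by (intro mult_right_mono) auto
  ultimately show False using bound[of "max N M"] by simp
qed

end

section \<open>The congruence group, the orbit of infinity and reduction of lattice frames\<close>

locale cusp_ideal = quad_order +
  fixes I :: "complex set"
  assumes ideal: "is_ideal R I" and I_nz: "I \<noteq> {0}"
begin

lemma I_R: "x \<in> I \<Longrightarrow> x \<in> R" and I_zero: "0 \<in> I" and I_diff: "x \<in> I \<Longrightarrow> y \<in> I \<Longrightarrow> x - y \<in> I"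
  and I_mult: "r \<in> R \<Longrightarrow> x \<in> I \<Longrightarrow> r * x \<in> I"
  using ideal unfolding is_ideal_def by auto

lemma I_add: "x \<in> I \<Longrightarrow> y \<in> I \<Longrightarrow> x + y \<in> I"
  using I_diff[of x "0 - y"] I_diff[OF I_zero] by simp

lemma I_sum: "(\<And>i. i \<in> A \<Longrightarrow> f i \<in> I) \<Longrightarrow> sum f A \<in> I"
  by (induction A rule: infinite_finite_induct) (auto simp: I_zero I_add)

lemma I_nat: "\<exists>l::nat. l > 0 \<and> of_nat l \<in> I"
proof -
  obtain y where y: "y \<in> I" "y \<noteq> 0" using I_nz I_zero by blast
  obtain l :: nat where l: "y * cnj y = of_nat l" using R_norm_nat[OF I_R[OF y(1)]] by blast
  have "l \<noteq> 0" using l y(2) by (cases "l = 0") auto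
  moreover have "of_nat l \<in> I" unfolding l[symmetric] mult.commute[of y]
    by (intro I_mult R_cnj y I_R)
  ultimately show ?thesis by blast
qed

text \<open>The inverse is demanded as part of membership; the finiteness argument below produces
  the elements in inverse pairs.\<close>

definition G1 :: "(complex ^ 'k::finite blk ^ 'k blk) set" where
  "G1 = {g \<in> Gamma' R I. \<exists>g'\<in>Gamma' R I. g ** g' = mat 1 \<and> g' ** g = mat 1}"

definition V :: "'k::finite cvec set" where
  "V = {g *v e_inf | g. g \<in> Gamma' R I}"

lemma Gamma'_hB: "g \<in> Gamma' R I \<Longrightarrow> hB (g *v u) (g *v v) = hB u v"
  by (rule hB_invariant) (simp add: Gamma'_def SU_Q_def)

lemma Gamma'_L: "g \<in> Gamma' R I \<Longrightarrow> v \<in> L \<Longrightarrow> g *v v \<in> L"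
  by (auto simp: Gamma'_def SL_over_def L_def matrix_vector_mult_def intro!: R_sum R_mult)

lemma mult_e_inf: "(g *v e_inf) $ i = g $ i $ Top"
  by (simp add: matrix_vector_mult_def sum_blk)

lemma Gamma'_mult:
  assumes "g \<in> Gamma' R I" "h \<in> Gamma' R I"
  shows "g ** h \<in> Gamma' R I"
proof -
  have q: "herm_Q (g ** h *v v) = herm_Q v" for v
    using assms by (simp add: Gamma'_def SU_Q_def matrix_vector_mul_assoc[symmetric])
  have d: "det (g ** h) = 1" using assms by (simp add: Gamma'_def SU_Q_def det_mul)
  have r: "(g ** h) $ i $ j \<in> R" for i j
    using assms by (auto simp: Gamma'_def SL_over_def matrix_matrix_mult_def intro!: R_sum R_mult)
  have "(g ** h) $ i $ Top \<in> I" if "i \<noteq> Top" for i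
  proof -
    have gR: "\<And>i j. g $ i $ j \<in> R" and hR: "\<And>i j. h $ i $ j \<in> R"
      using assms by (auto simp: Gamma'_def SL_over_def)
    have gI: "\<And>i. i \<noteq> Top \<Longrightarrow> g $ i $ Top \<in> I" and hI: "\<And>i. i \<noteq> Top \<Longrightarrow> h $ i $ Top \<in> I"
      using assms by (auto simp: Gamma'_def)
    have "g $ i $ l * h $ l $ Top \<in> I" for l
    proof (cases "l = Top")
      case True
      then show ?thesis using I_mult[OF hR gI[OF that]] by (simp add: mult.commute)
    next
      case False
      then show ?thesis using I_mult[OF gR hI] by simp
    qed
    then show ?thesis by (simp add: matrix_matrix_mult_def I_sum)
  qed
  then show ?thesis using q d r by (simp add: Gamma'_def SU_Q_def SL_over_def)
qed

lemma Gamma'_one: "mat 1 \<in> Gamma' R I"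
  by (simp add: Gamma'_def SU_Q_def SL_over_def mat_def[of 1] R_one R_zero I_zero)
     (simp add: mat_def[symmetric])

lemma G1_one: "mat 1 \<in> G1"
  unfolding G1_def using Gamma'_one by force

lemma G1_mult:
  assumes "g \<in> G1" "h \<in> G1" shows "g ** h \<in> G1"
proof -
  obtain g' h' where *: "g' \<in> Gamma' R I" "g ** g' = mat 1" "g' ** g = mat 1"
    "h' \<in> Gamma' R I" "h ** h' = mat 1" "h' ** h = mat 1"
    using assms by (auto simp: G1_def)
  have "(g ** h) ** (h' ** g') = g ** (h ** h') ** g'" "(h' ** g') ** (g ** h) = h' ** (g' ** g) ** h"
    by (simp_all only: matrix_mul_assoc)
  then have "(g ** h) ** (h' ** g') = mat 1" "(h' ** g') ** (g ** h) = mat 1"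
    by (simp_all add: *)
  then show ?thesis using assms * Gamma'_mult unfolding G1_def by blast
qed

lemma G1_inverse:
  assumes "g \<in> G1"
  obtains g' where "g' \<in> G1" "\<And>v. g' *v (g *v v) = v" "\<And>v. g *v (g' *v v) = v"
proof -
  obtain g' where *: "g' \<in> Gamma' R I" "g ** g' = mat 1" "g' ** g = mat 1"
    using assms by (auto simp: G1_def)
  then have "g' \<in> G1" using assms by (auto simp: G1_def)
  then show ?thesis using that * by (simp add: matrix_vector_mul_assoc)
qed

lemma G1_hB: "g \<in> G1 \<Longrightarrow> hB (g *v u) (g *v v) = hB u v"
  and G1_L: "g \<in> G1 \<Longrightarrow> v \<in> L \<Longrightarrow> g *v v \<in> L"
  by (auto simp: G1_def Gamma'_hB Gamma'_L)

lemma G1_V: "g \<in> G1 \<Longrightarrow> v \<in> V \<Longrightarrow> g *v v \<in> V"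
proof -
  assume "g \<in> G1" "v \<in> V"
  then obtain h where "g \<in> Gamma' R I" "h \<in> Gamma' R I" "v = h *v e_inf"
    by (auto simp: G1_def V_def)
  then show "g *v v \<in> V" unfolding V_def
    by (intro CollectI exI[of _ "g ** h"]) (simp add: Gamma'_mult matrix_vector_mul_assoc)
qed

lemma e_inf_V: "e_inf \<in> V"
  unfolding V_def using Gamma'_one by (intro CollectI exI[of _ "mat 1"]) simp

lemma e_inf_L: "e_inf \<in> L"
  by (simp add: L_def e_inf_def axis_def R_one R_zero)

lemma V_L: "v \<in> V \<Longrightarrow> v \<in> L" and V_iso: "v \<in> V \<Longrightarrow> hB v v = 0" and V_nz: "v \<in> V \<Longrightarrow> v \<noteq> 0"
proof -
  assume "v \<in> V"
  then obtain g where g: "g \<in> Gamma' R I" "v = g *v e_inf" by (auto simp: V_def)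
  show "v \<in> L" using Gamma'_L g e_inf_L by simp
  show "hB v v = 0" unfolding g(2) Gamma'_hB[OF g(1)] by simp
  have "hB v (g *v axis Bot 1) = -1" unfolding g(2) Gamma'_hB[OF g(1)]
    by (simp add: hB_def axis_def)
  then show "v \<noteq> 0" by auto
qed

text \<open>Reduction modulo Q, encoded by the residues of the coordinates in an integer basis of
  the order.\<close>

lemma residue_map:
  assumes "Q > (0::nat)"
  shows "\<exists>f :: complex \<Rightarrow> int \<times> int. finite (range f) \<and>
     (\<forall>x\<in>R. \<forall>y\<in>R. f x = f y \<longrightarrow> (\<exists>r\<in>R. x - y = of_nat Q * r))"
proof -
  obtain u v where uv: "R = {of_int p * u + of_int q * v | p q :: int. True}"
    using order unfolding is_order_def by blast
  then have "\<forall>x\<in>R. \<exists>pq. x = of_int (fst pq) * u + of_int (snd pq) * v" by auto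
  then obtain c :: "complex \<Rightarrow> int \<times> int" where c: "\<And>x. x \<in> R \<Longrightarrow> x = of_int (fst (c x)) * u + of_int (snd (c x)) * v"
    by metis
  define f where "f x = (fst (c x) mod int Q, snd (c x) mod int Q)" for x
  have "range f \<subseteq> {0..<int Q} \<times> {0..<int Q}" using assms by (auto simp: f_def)
  then have "finite (range f)" by (rule finite_subset) simp
  moreover have "\<exists>r\<in>R. x - y = of_nat Q * r" if "x \<in> R" "y \<in> R" "f x = f y" for x y
  proof -
    have "int Q dvd fst (c x) - fst (c y)" "int Q dvd snd (c x) - snd (c y)"
      using that(3) by (auto simp: f_def mod_eq_dvd_iff)
    then obtain p q where pq: "fst (c x) - fst (c y) = int Q * p" "snd (c x) - snd (c y) = int Q * q"
      by (auto elim!: dvdE)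
    have "x - y = of_int (fst (c x) - fst (c y)) * u + of_int (snd (c x) - snd (c y)) * v"
      by (subst c[OF that(1)], subst c[OF that(2)]) (simp add: algebra_simps)
    also have "\<dots> = of_nat Q * (of_int p * u + of_int q * v)"
      unfolding pq by (simp add: algebra_simps)
    finally show ?thesis by (intro bexI[of _ "of_int p * u + of_int q * v"]) (auto simp: uv)
  qed
  ultimately show ?thesis by blast
qed

text \<open>Take g = c b^(-1). Since \<open>c\<close> is \<open>b\<close> plus Q times an integral
  matrix, g is the identity plus Q times an integral matrix times b^(-1). The determinant factor in
  Q makes b^(-1) integral, and the factor l puts the difference in \<open>I\<close>. Equal Gram
  matrices make g preserve the form, equal determinants give determinant 1.\<close>

lemma congruent_frames:
  fixes b c :: "complex ^ 'k::finite blk ^ 'k blk"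
  assumes bR: "\<And>i j. b $ i $ j \<in> R" and cR: "\<And>i j. c $ i $ j \<in> R"
    and d: "det b \<noteq> 0" "det c = det b" and gram: "gram c = gram b"
    and r: "\<And>i j. \<exists>r\<in>R. c $ i $ j - b $ i $ j = of_nat Q * r"
    and l: "of_nat l \<in> I" and Q: "of_nat Q = det b * cnj (det b) * of_nat (l * s)"
  shows "\<exists>g\<in>Gamma' R I. g ** b = c"
proof -
  obtain bi where bi: "b ** bi = mat 1" "bi ** b = mat 1"
    using d(1) unfolding invertible_det_nz[symmetric] invertible_def by blast
  have dR: "det b \<in> R" by (rule R_det[OF bR])
  \<comment> \<open>Entries of the adjugate: by Cramer's rule they are determinants with entries in
    \<open>R\<close>.\<close>
  have adj: "det b * bi $ i $ j \<in> R" for i j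
  proof -
    have "b *v (bi *v axis j 1) = axis j 1" by (simp add: matrix_vector_mul_assoc bi)
    then have "bi *v axis j 1 = (\<chi> k. det (\<chi> i l. if l = k then axis j 1 $ i else b $ i $ l) / det b)"
      using cramer[OF d(1)] by blast
    then have "(bi *v axis j 1) $ i = det (\<chi> i' l. if l = i then axis j 1 $ i' else b $ i' $ l) / det b"
      by simp
    moreover have "(bi *v axis j 1) $ i = bi $ i $ j" by (simp add: matrix_vector_mult_def axis_def mult_delta_right)
    ultimately have "det b * bi $ i $ j = det (\<chi> i' l. if l = i then axis j 1 $ i' else b $ i' $ l)"
      using d(1) by simp
    also have "\<dots> \<in> R" by (rule R_det) (auto simp: axis_def bR R_one R_zero)
    finally show ?thesis .
  qed
  define g where "g = c ** bi"
  have gb: "g ** b = c" by (simp add: g_def matrix_mul_assoc[symmetric] bi)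
  have ent: "g $ i $ j - mat 1 $ i $ j = (\<Sum>q\<in>UNIV. (c $ i $ q - b $ i $ q) * bi $ q $ j)" for i j
    unfolding g_def bi(1)[symmetric]
    by (simp add: matrix_matrix_mult_def left_diff_distrib sum_subtractf)
  have gI: "g $ i $ j - mat 1 $ i $ j \<in> I" for i j
    unfolding ent
  proof (rule I_sum)
    fix q
    obtain t where t: "t \<in> R" "c $ i $ q - b $ i $ q = of_nat Q * t" using r by blast
    have "(c $ i $ q - b $ i $ q) * bi $ q $ j = (cnj (det b) * of_nat s * t * (det b * bi $ q $ j)) * of_nat l"
      unfolding t Q by (simp add: mult_ac)
    also have "\<dots> \<in> I" by (intro I_mult l R_mult adj t R_of_nat R_cnj dR)
    finally show "(c $ i $ q - b $ i $ q) * bi $ q $ j \<in> I" .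
  qed
  have gR: "g $ i $ j \<in> R" for i j
  proof -
    have m: "(mat 1 :: complex ^ 'k blk ^ 'k blk) $ i $ j \<in> R" by (simp add: mat_def R_one R_zero)
    from R_add[OF I_R[OF gI[of i j]] m] show ?thesis by (simp only: diff_add_cancel)
  qed
  have gI': "g $ i $ Top \<in> I" if "i \<noteq> Top" for i
    using gI[of i Top] that by (simp add: mat_def)
  have "det b * det bi = 1" by (metis bi(1) det_I det_mul)
  then have gd: "det g = 1" by (simp add: g_def det_mul d)
  have "hB (g *v y) (g *v y) = hB y y" for y
  proof -
    have y: "y = b *v (bi *v y)" by (simp add: matrix_vector_mul_assoc bi)
    have "hB (c *v z) (c *v z) = hB (b *v z) (b *v z)" for z
      using gram by (simp add: hB_matrix_mult gram_def vec_eq_iff)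
    moreover have "g *v y = c *v (bi *v y)" by (simp add: g_def matrix_vector_mul_assoc)
    ultimately show ?thesis using y by metis
  qed
  then have "g \<in> Gamma' R I"
    using gR gI' gd by (simp add: Gamma'_def SU_Q_def SL_over_def herm_Q_eq)
  then show ?thesis using gb by blast
qed

definition lattice_frames :: "real \<Rightarrow> (complex ^ 'k::finite blk ^ 'k blk) set" where
  "lattice_frames B = {b. (\<forall>i j. b $ i $ j \<in> R) \<and> det b \<noteq> 0 \<and> (\<forall>i j. cmod (gram b $ i $ j) \<le> B)}"

text \<open>Bounded Gram matrices with entries in \<open>R\<close> are finitely many, and so are the
  determinants and the residues modulo Q. Frames agreeing in these data are equivalent under the
  group, so one representative for each value of the data gives the bound \<open>C\<close>.\<close>

lemma lattice_frames_finite_mod_G1: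
  "\<exists>C. \<forall>b\<in>lattice_frames B :: (complex ^ 'k::finite blk ^ 'k blk) set. \<exists>g\<in>G1. norm (g ** b) \<le> C"
proof -
  let ?F = "lattice_frames B :: (complex ^ 'k blk ^ 'k blk) set"
  define GM where "GM = {A :: complex ^ 'k blk ^ 'k blk. \<forall>i j. A $ i $ j \<in> {x \<in> R. cmod x \<le> B}}"
  have finGM: "finite GM" unfolding GM_def by (intro finite_matrices R_finite_ball)
  have gramGM: "gram b \<in> GM" if "b \<in> ?F" for b
    using that by (auto simp: GM_def lattice_frames_def gram_def intro!: hB_in_R) (auto simp: L_def column_def)
  define dJ where "dJ = cmod (det (swapJ :: complex ^ 'k blk ^ 'k blk))"
  have dJ0: "dJ > 0" using det_swapJ by (simp add: dJ_def)
  define D where "D = nat \<lceil>Max (insert 0 ((\<lambda>A. cmod (det A)) ` GM)) / dJ\<rceil>"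
  have dR: "det b \<in> R" if "b \<in> ?F" for b using that by (intro R_det) (auto simp: lattice_frames_def)
  have detD: "(cmod (det b))\<^sup>2 \<le> real D" if "b \<in> ?F" for b
  proof -
    have "(cmod (det b))\<^sup>2 * dJ = cmod (det (gram b))"
      by (simp add: det_gram norm_mult dJ_def power2_eq_square)
    also have "\<dots> \<le> Max (insert 0 ((\<lambda>A. cmod (det A)) ` GM))"
      using finGM gramGM[OF that] by (intro Max_ge) auto
    finally have "(cmod (det b))\<^sup>2 \<le> Max (insert 0 ((\<lambda>A. cmod (det A)) ` GM)) / dJ"
      using dJ0 by (simp add: pos_le_divide_eq)
    then show ?thesis unfolding D_def by linarith
  qed
  obtain l :: nat where l: "l > 0" "of_nat l \<in> I" using I_nat by blast
  \<comment> \<open>The squared modulus of every determinant that occurs is an integer between 1 and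
    \<open>D\<close>, so the factorial lets one modulus serve all frames.\<close>
  define Q where "Q = fact D * l"
  have "Q > 0" using l by (simp add: Q_def)
  from residue_map[OF this] obtain f :: "complex \<Rightarrow> int \<times> int" where f: "finite (range f)"
     "\<And>x y. x \<in> R \<Longrightarrow> y \<in> R \<Longrightarrow> f x = f y \<Longrightarrow> \<exists>r\<in>R. x - y = of_nat Q * r" by blast
  define key where "key b = (gram b, det b, (\<chi> i j. f (b $ i $ j)) :: (int \<times> int) ^ 'k blk ^ 'k blk)"
    for b :: "complex ^ 'k blk ^ 'k blk"
  have "key ` ?F \<subseteq> GM \<times> {x \<in> R. cmod x \<le> sqrt (real D)} \<times> {A. \<forall>i j. A $ i $ j \<in> range f}"
    using gramGM dR detD by (auto simp: key_def real_le_rsqrt)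
  moreover have "finite (GM \<times> {x \<in> R. cmod x \<le> sqrt (real D)} \<times> {A :: (int \<times> int) ^ 'k blk ^ 'k blk. \<forall>i j. A $ i $ j \<in> range f})"
    by (intro finite_cartesian_product finGM R_finite_ball finite_matrices f(1))
  ultimately have "finite (key ` ?F)" by (rule finite_subset)
  from finite_image_bounded_rep[OF this, of norm] obtain C where
    C: "\<And>b. b \<in> ?F \<Longrightarrow> \<exists>c\<in>?F. key c = key b \<and> norm c \<le> C" by blast
  show ?thesis
  proof (intro exI[of _ C] ballI)
    fix b assume b: "b \<in> ?F"
    then obtain c where c: "c \<in> ?F" "key c = key b" "norm c \<le> C" using C by blast
    obtain k :: nat where k: "det b * cnj (det b) = of_nat k" "(cmod (det b))\<^sup>2 = real k"
      using R_norm_nat[OF dR[OF b]] by blast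
    have "k \<noteq> 0"
    proof
      assume "k = 0"
      then have "det b = 0" using k(2) by simp
      then show False using b by (auto simp: lattice_frames_def)
    qed
    moreover have "k \<le> D" using detD[OF b] k(2) by simp
    ultimately obtain s where s: "fact D = k * s" using dvd_fact[of k D] by (auto elim!: dvdE)
    have Q: "of_nat Q = det b * cnj (det b) * of_nat (l * s)"
      by (simp add: Q_def s k mult_ac)
    have entR: "\<And>i j. b $ i $ j \<in> R" "\<And>i j. c $ i $ j \<in> R" and nz: "det b \<noteq> 0" "det c \<noteq> 0"
      using b c(1) by (auto simp: lattice_frames_def)
    have keys: "gram c = gram b" "det c = det b" "\<And>i j. f (c $ i $ j) = f (b $ i $ j)"
      using c(2) by (simp_all add: key_def vec_eq_iff)
    have "\<exists>g\<in>Gamma' R I. g ** b = c"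
      by (rule congruent_frames[where Q = Q and l = l and s = s]) (use entR nz keys f(2) l Q in auto)
    then obtain g where g: "g \<in> Gamma' R I" "g ** b = c" by blast
    \<comment> \<open>The hypotheses are symmetric in the two frames; the second application
      supplies the inverse.\<close>
    have "\<exists>g'\<in>Gamma' R I. g' ** c = b"
      by (rule congruent_frames[where Q = Q and l = l and s = s]) (use entR nz keys f(2) l Q in auto)
    then obtain g' where g': "g' \<in> Gamma' R I" "g' ** c = b" by blast
    obtain bi where bi: "b ** bi = mat 1" using nz unfolding invertible_det_nz[symmetric] invertible_def by blast
    obtain ci where ci: "c ** ci = mat 1" using nz unfolding invertible_det_nz[symmetric] invertible_def by blast
    have "g' ** g ** (b ** bi) = b ** bi" using g g' by (metis matrix_mul_assoc)
    then have 1: "g' ** g = mat 1" by (simp add: bi)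
    have "g ** g' ** (c ** ci) = c ** ci" using g g' by (metis matrix_mul_assoc)
    then have 2: "g ** g' = mat 1" by (simp add: ci)
    have "g \<in> G1" using g g' 1 2 by (auto simp: G1_def)
    then show "\<exists>g\<in>G1. norm (g ** b) \<le> C" using g c by auto
  qed
qed

lemma matrix_vector_bound:
  fixes A :: "complex ^ 'n::finite ^ 'n"
  assumes "\<And>i. cmod (y $ i) \<le> B" "norm A \<le> C"
  shows "norm (A *v y) \<le> real CARD('n) * (B * C)"
proof -
  have "\<bar>B\<bar> = B" using assms(1)[of undefined] norm_ge_zero order_trans by (metis abs_of_nonneg)
  have col: "norm (column i A) \<le> norm A" for i
  proof -
    have "norm (column i A) \<le> norm (\<chi> i j. A $ i $ j)"
      unfolding column_def norm_vec_def
      by (intro L2_set_mono) (auto simp: norm_vec_def[symmetric] Finite_Cartesian_Product.norm_nth_le)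
    then show ?thesis by simp
  qed
  have "norm (A *v y) \<le> (\<Sum>i\<in>UNIV. norm (y $ i *s column i A))"
    unfolding matrix_mult_sum by (rule norm_sum)
  also have "\<dots> \<le> (\<Sum>i\<in>(UNIV :: 'n set). B * C)"
    using \<open>\<bar>B\<bar> = B\<close> assms col
    by (intro sum_mono) (auto simp: norm_scalar_mult intro!: mult_mono intro: order_trans)
  finally show ?thesis by simp
qed

text \<open>At a time N without short vectors, \<open>dirichlet\<close> gives one lattice vector
  near each coordinate direction. They form a frame with bounded Gram matrix, which some g in
  \<open>G1\<close> makes bounded. In this frame N \<open>lift x\<close> and \<open>e_inf\<close> /
  N have bounded coefficients, so g makes them bounded too.\<close>

lemma recurrence:
  "\<exists>C>0. \<forall>x :: 'k::finite heis. irrat x \<longrightarrow> (\<forall>N0. \<exists>N\<ge>N0. N > 0 \<and>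
     (\<exists>g\<in>G1. norm (g *v (of_nat N *s lift x)) \<le> C \<and> norm (g *v ((1 / of_nat N) *s e_inf)) \<le> C))"
proof -
  let ?\<eta> = "\<eta>0 TYPE('k)"
  have \<eta>: "?\<eta> > 0" "real CARD('k blk) * ?\<eta> \<le> 1 / 2" by (simp_all add: \<eta>0_def)
  have "1 \<le> CARD('k blk)" by (simp add: Suc_leI)
  then have "1 \<le> real CARD('k blk)" by (metis of_nat_1 of_nat_le_iff)
  then have \<eta>1: "?\<eta> \<le> 1" unfolding \<eta>0_def by (subst divide_le_eq_1_pos) linarith+
  from dirichlet[OF \<eta>(1), where 'k = 'k] obtain J :: nat where J: "\<forall>N>0. \<forall>x :: 'k heis. \<forall>j.
     (\<exists>v\<in>L. v \<noteq> 0 \<and> (\<forall>i. cmod (cusp_coords (real N) x v $ i) \<le> ?\<eta>)) \<or>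
     (\<exists>v\<in>L. \<exists>s::nat. 1 \<le> s \<and> s \<le> J \<and>
        (\<forall>i. cmod (cusp_coords (real N) x v $ i - (if i = j then of_nat s else 0)) \<le> ?\<eta>))"
    by (rule exE)
  define B where "B = (real CARD('k blk) * (real J + 1))\<^sup>2"
  obtain C where C: "\<And>b :: complex ^ 'k blk ^ 'k blk. b \<in> lattice_frames B \<Longrightarrow> \<exists>g\<in>G1. norm (g ** b) \<le> C"
    using lattice_frames_finite_mod_G1 by metis
  define C' where "C' = \<bar>real CARD('k blk) * (2 * C)\<bar> + 1"
  show ?thesis
  proof (intro exI[of _ C'] conjI allI impI)
    show "0 < C'" by (simp add: C'_def)
    fix x :: "'k heis" and N0 assume ir: "irrat x"
    then have x: "x \<in> heis" by (simp add: irrat_def)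
    obtain N where N: "N \<ge> N0" "N > 0"
      and long: "\<not> (\<exists>v\<in>L. v \<noteq> 0 \<and> (\<forall>i. cmod (cusp_coords (real N) x v $ i) \<le> ?\<eta>))"
      using exists_no_short_vector[OF ir] by blast
    from J[rule_format, OF N(2), of x] long have "\<forall>j. \<exists>v\<in>L. \<exists>s::nat. 1 \<le> s \<and> s \<le> J \<and>
        (\<forall>i. cmod (cusp_coords (real N) x v $ i - (if i = j then of_nat s else 0)) \<le> ?\<eta>)" by blast
    then obtain u s where u: "\<And>j. u j \<in> L" and s: "\<And>j. 1 \<le> s j" "\<And>j. s j \<le> J"
      and close: "\<And>i j. cmod (cusp_coords (real N) x (u j) $ i - (if i = j then of_nat (s j) else 0)) \<le> ?\<eta>"
      by metis
    define b :: "complex ^ 'k blk ^ 'k blk" where "b = (\<chi> i j. u j $ i)"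
    have col: "column j b = u j" for j by (simp add: b_def column_def vec_eq_iff)
    have coord: "cusp_coords (real N) x (b *v y) = (\<Sum>j\<in>UNIV. y $ j *s cusp_coords (real N) x (u j))" for y
      by (simp add: matrix_mult_sum col cusp_coords_sum cusp_coords_simps)
    have dom: "(\<And>i. cmod (cusp_coords (real N) x (b *v y) $ i) \<le> E) \<Longrightarrow> cmod (y $ i) \<le> 2 * E" for y E i
      unfolding coord by (rule diag_dominant_bound[OF close s(1) \<eta>(2)])
    have inj: "y = 0" if "b *v y = 0" for y
      using dom[of y 0] that by (simp add: cusp_coords_simps vec_eq_iff)
    then have "invertible b"
      unfolding invertible_left_inverse matrix_left_invertible_ker by blast
    then obtain bi where bi: "b ** bi = mat 1" and det: "det b \<noteq> 0"
      unfolding invertible_det_nz[symmetric] by (auto simp: invertible_def)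
    have "norm (cusp_coords (real N) x (u j)) \<le> real CARD('k blk) * (real J + 1)" for j
    proof (rule norm_le_card_mult)
      fix i
      have "cmod (cusp_coords (real N) x (u j) $ i) \<le>
        cmod (cusp_coords (real N) x (u j) $ i - (if i = j then of_nat (s j) else 0)) + cmod (if i = j then of_nat (s j) else 0)"
        by (metis diff_add_cancel norm_triangle_ineq)
      also have "\<dots> \<le> 1 + real J" using close[of j i] \<eta>1 s(2)[of j] by (intro add_mono) auto
      finally show "cmod (cusp_coords (real N) x (u j) $ i) \<le> real J + 1" by simp
    qed
    then have nn: "norm (cusp_coords (real N) x (u i)) * norm (cusp_coords (real N) x (u j)) \<le> B" for i j
      unfolding B_def power2_eq_square by (intro mult_mono) auto
    have "real N \<noteq> 0" using N(2) by simp
    from hB_cusp_coords[OF x this] have "cmod (hB (u i) (u j)) \<le> B" for i j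
      using cmod_hB_le[of "cusp_coords (real N) x (u i)" "cusp_coords (real N) x (u j)"] nn[of i j] by simp
    then have "b \<in> lattice_frames B"
      using det u by (auto simp: lattice_frames_def gram_def col) (auto simp: b_def L_def)
    from C[OF this] obtain g where g: "g \<in> G1" "norm (g ** b) \<le> C" by blast
    \<comment> \<open>A vector with \<open>cusp_coords\<close> at most 1 has coefficients at most 2
      in the frame \<open>b\<close> by diagonal dominance.\<close>
    have main: "norm (g *v w) \<le> C'" if w: "\<And>i. cmod (cusp_coords (real N) x w $ i) \<le> 1" for w
    proof -
      have bw: "b *v (bi *v w) = w" by (simp add: matrix_vector_mul_assoc bi)
      then have "cmod ((bi *v w) $ i) \<le> 2" for i using dom[of "bi *v w" 1 i] w by simp
      from matrix_vector_bound[OF this g(2)] have "norm ((g ** b) *v (bi *v w)) \<le> C'" by (simp add: C'_def)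
      then show ?thesis by (simp add: matrix_vector_mul_assoc[symmetric] bw)
    qed
    have "norm (g *v (of_nat N *s lift x)) \<le> C'" "norm (g *v ((1 / of_nat N) *s e_inf)) \<le> C'"
      using cusp_coords_lift[OF x, of "real N"] N(2) by (auto intro!: main simp: axis_def)
    then show "\<exists>N\<ge>N0. N > 0 \<and>
       (\<exists>g\<in>G1. norm (g *v (of_nat N *s lift x)) \<le> C' \<and> norm (g *v ((1 / of_nat N) *s e_inf)) \<le> C')"
      using N g by blast
  qed
qed

end

section \<open>The approximation constant as an asymptotic height\<close>

text \<open>By left invariance the distance is the gauge of (z', w'), the quotient of the two
  points. Membership in the Heisenberg group turns the squared norm of w' into 2 Re z', so the
  squared gauge is 2 (|z'| + Re z'); moreover \<open>hB (lift x) v\<close> is -z' times the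
  conjugate of c. This explains the shape of \<open>ht\<close>.\<close>

lemma cygan_dist_eq_ht:
  fixes x :: "'k::finite heis"
  assumes x: "x \<in> heis" and v: "hB v v = 0" and c: "v $ Bot \<noteq> 0"
  shows "cmod (v $ Bot) * cygan_dist x (v $ Top / v $ Bot, \<chi> i. v $ Mid i / v $ Bot) = sqrt (ht (lift x) e_inf v)"
proof -
  define a al c where "a = v $ Top" and "al = (\<chi> i. v $ Mid i)" and "c = v $ Bot"
  obtain z w where xz: "x = (z, w)" by fastforce
  define y where "y = (a / c, (1 / c) *s al)"
  have c0: "c \<noteq> 0" using c by (simp add: c_def)
  have "herm_dot al al = a * cnj c + c * cnj a"
    using v by (simp add: hB_def herm_dot_def a_def al_def c_def algebra_simps)
  then have "herm_dot ((1 / c) *s al) ((1 / c) *s al) = (a * cnj c + c * cnj a) / (c * cnj c)"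
    by (simp add: herm_dot_def sum_divide_distrib[symmetric])
  also have "\<dots> = a / c + cnj (a / c)" using c0 by (simp add: field_simps)
  finally have y: "y \<in> heis" by (simp add: y_def heis_iff)
  define z' w' where "z' = cnj (a / c) + z + herm_dot w (- ((1 / c) *s al))" and "w' = - ((1 / c) *s al) + w"
  have m: "heis_mult (heis_inv y) x = (z', w')" by (simp add: y_def xz z'_def w'_def)
  have "(z', w') \<in> heis" unfolding m[symmetric] by (intro heis_mult_closed heis_inv_closed x y)
  then have w': "(norm w')\<^sup>2 = 2 * Re z'" by (simp add: heis_def)
  have hX: "hB (lift x) v = - z * cnj c - cnj a + herm_dot w al"
    by (simp add: hB_def xz a_def al_def c_def herm_dot_def)
  have "herm_dot w ((1 / c) *s al) = herm_dot w al / cnj c"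
    by (simp add: herm_dot_def sum_divide_distrib)
  then have z': "z' = - hB (lift x) v / cnj c"
    using c0 by (simp add: z'_def hX field_simps)
  define q where "q = - hB (lift x) v * hB v e_inf / hB (lift x) e_inf"
  have q: "q = of_real ((cmod c)\<^sup>2) * z'"
    using c0 by (simp add: q_def z' complex_norm_square c_def del: of_real_power)
  have "cmod q = (cmod c)\<^sup>2 * cmod z'" "Re q = (cmod c)\<^sup>2 * Re z'"
    by (simp_all add: q norm_mult del: of_real_power)
  then have "2 * (cmod q + Re q) = (cmod c)\<^sup>2 * (2 * cmod z' + (norm w')\<^sup>2)"
    by (simp add: w' algebra_simps)
  then have "ht (lift x) e_inf v = (cmod c)\<^sup>2 * (2 * cmod z' + (norm w')\<^sup>2)"
    unfolding ht_def Let_def q_def[symmetric] .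
  then have "sqrt (ht (lift x) e_inf v) = cmod c * cygan_dist x y"
    by (simp add: cygan_dist_def m real_sqrt_mult)
  moreover have "y = (v $ Top / v $ Bot, \<chi> i. v $ Mid i / v $ Bot)"
    by (simp add: y_def a_def al_def c_def vec_eq_iff)
  ultimately show ?thesis by (simp add: c_def)
qed

section \<open>Cusps as approximating points and the lower limit of heights\<close>

context cusp_ideal
begin

definition triple :: "'k::finite cvec \<Rightarrow> complex \<times> (complex ^ 'k) \<times> complex" where
  "triple v = (v $ Top, \<chi> i. v $ Mid i, v $ Bot)"

lemma E'_eq: "E' R I = triple ` (V :: 'k::finite cvec set)"
proof (intro equalityI subsetI)
  fix t assume "t \<in> (E' R I :: (complex \<times> (complex ^ 'k) \<times> complex) set)"
  then obtain a al c g where t: "t = (a, al, c)" "g \<in> Gamma' R I" "g $ Top $ Top = a" "\<And>i. g $ Mid i $ Top = al $ i" "g $ Bot $ Top = c"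
    by (auto simp: E'_def)
  have "triple (g *v e_inf) = t" by (simp add: triple_def mult_e_inf t vec_eq_iff)
  moreover have "g *v e_inf \<in> V" using t by (auto simp: V_def)
  ultimately show "t \<in> triple ` V" by blast
next
  fix t assume "t \<in> triple ` (V :: 'k cvec set)"
  then obtain g where g: "g \<in> Gamma' R I" "t = triple (g *v e_inf)" by (auto simp: V_def)
  have "g $ Top $ Top \<in> R" "g $ Bot $ Top \<in> I" "\<And>i. g $ Mid i $ Top \<in> I"
    using g(1) by (auto simp: Gamma'_def SL_over_def)
  then show "t \<in> E' R I" using g by (auto simp: E'_def triple_def mult_e_inf)
qed

definition cusp_filter :: "(complex \<times> (complex ^ 'k::finite) \<times> complex) filter" where
  "cusp_filter = inf (filtercomap (\<lambda>(a, al, c). cmod c) at_top) (principal (E' R I))"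

definition approx_fun :: "'k::finite heis \<Rightarrow> complex \<times> (complex ^ 'k) \<times> complex \<Rightarrow> ereal" where
  "approx_fun x = (\<lambda>(a, al, c). ereal (cmod c * cygan_dist x (a / c, \<chi> i. al $ i / c)))"

lemma approx_const_eq: "approx_const R I x = Liminf cusp_filter (approx_fun x)"
  unfolding approx_const_def cusp_filter_def approx_fun_def ..

lemma eventually_cusp_filter:
  "eventually P cusp_filter \<longleftrightarrow> (\<exists>r. \<forall>v\<in>V. r \<le> cmod (v $ Bot) \<longrightarrow> P (triple v))"
  unfolding cusp_filter_def eventually_inf_principal eventually_filtercomap_at_top_linorder E'_eq
  by (fastforce simp: triple_def)

text \<open>The extra bound 1 keeps \<open>v $ Bot\<close> away from 0, where the quotients a / c
  have the default value 0.\<close>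

lemma eventually_cusp_filter_mono:
  assumes "\<And>v. v \<in> V \<Longrightarrow> 1 \<le> cmod (v $ Bot) \<Longrightarrow> r \<le> cmod (v $ Bot) \<Longrightarrow> P (triple v)"
  shows "eventually P cusp_filter"
  unfolding eventually_cusp_filter using assms by (intro exI[of _ "max 1 r"]) auto

lemma approx_fun_triple:
  assumes "x \<in> heis" "v \<in> V" "1 \<le> cmod (v $ Bot)"
  shows "approx_fun x (triple v) = ereal (sqrt (ht (lift x) e_inf v))"
proof -
  have "v $ Bot \<noteq> 0" using assms(3) by auto
  from cygan_dist_eq_ht[OF assms(1) V_iso[OF assms(2)] this] show ?thesis
    by (simp add: approx_fun_def triple_def)
qed

lemma approx_const_upper:
  assumes x: "x \<in> heis" and ex: "\<And>r. \<exists>v\<in>V. r \<le> cmod (v $ Bot) \<and> ht (lift x) e_inf v \<le> K"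
  shows "approx_const R I x \<le> ereal (sqrt K)"
proof (rule ccontr)
  assume "\<not> ?thesis"
  then have "ereal (sqrt K) < Liminf cusp_filter (approx_fun x)" by (simp add: approx_const_eq not_le)
  then have "eventually (\<lambda>t. ereal (sqrt K) < approx_fun x t) cusp_filter" by (rule less_LiminfD)
  then obtain r where r: "\<And>v. v \<in> V \<Longrightarrow> r \<le> cmod (v $ Bot) \<Longrightarrow> ereal (sqrt K) < approx_fun x (triple v)"
    unfolding eventually_cusp_filter by blast
  obtain v where v: "v \<in> V" "max 1 r \<le> cmod (v $ Bot)" "ht (lift x) e_inf v \<le> K" using ex by blast
  then have "sqrt K < sqrt (ht (lift x) e_inf v)" using r[of v] approx_fun_triple[OF x v(1)] by simp
  with v(3) show False by simp
qed

lemma approx_const_lower: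
  assumes x: "x \<in> heis" and all: "\<And>v. v \<in> V \<Longrightarrow> r \<le> cmod (v $ Bot) \<Longrightarrow> K \<le> ht (lift x) e_inf v"
  shows "ereal (sqrt K) \<le> approx_const R I x"
  unfolding approx_const_eq
  by (rule Liminf_bounded, rule eventually_cusp_filter_mono[of r])
     (simp add: approx_fun_triple[OF x] all)

text \<open>Says that \<open>lam\<close> is the lower limit of \<open>ht\<close> along the cusps,
  hence the square of the approximation constant, by inequalities between real numbers that can be
  transported along the group.\<close>

definition asymptotic_height :: "'k::finite heis \<Rightarrow> real \<Rightarrow> bool" where
  "asymptotic_height x lam \<longleftrightarrow>
     (\<forall>e>0. \<exists>r. \<forall>v\<in>V. r \<le> cmod (v $ Bot) \<longrightarrow> lam - e \<le> ht (lift x) e_inf v) \<and>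
     (\<forall>e>0. \<forall>r. \<exists>v\<in>V. r \<le> cmod (v $ Bot) \<and> ht (lift x) e_inf v \<le> lam + e)"

lemma approx_const_nonneg: "x \<in> heis \<Longrightarrow> 0 \<le> approx_const R I x"
  using approx_const_lower[of x 0 0] ht_nonneg[of "lift x" e_inf] by (simp add: zero_ereal_def)

lemma asymptotic_height_approx_const:
  assumes x: "x \<in> heis" and lam: "asymptotic_height x lam" "0 \<le> lam"
  shows "approx_const R I x = ereal (sqrt lam)"
proof -
  have up: "approx_const R I x \<le> ereal (sqrt (lam + e))" if "e > 0" for e
    using lam that by (intro approx_const_upper x) (auto simp: asymptotic_height_def)
  have lo: "ereal (sqrt (lam - e)) \<le> approx_const R I x" if e: "e > 0" for e
  proof -
    obtain r where "\<And>v. v \<in> V \<Longrightarrow> r \<le> cmod (v $ Bot) \<Longrightarrow> lam - e \<le> ht (lift x) e_inf v"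
      using lam(1) e unfolding asymptotic_height_def by blast
    then show ?thesis by (rule approx_const_lower[OF x])
  qed
  have "approx_const R I x \<noteq> \<infinity>" "approx_const R I x \<noteq> -\<infinity>"
    using up[of 1] approx_const_nonneg[OF x] by auto
  then obtain l where l: "approx_const R I x = ereal l" by (cases "approx_const R I x") auto
  have "(\<lambda>n. sqrt (lam + 1 / real (Suc n))) \<longlonglongrightarrow> sqrt (lam + 0)"
    by (intro tendsto_intros LIMSEQ_Suc[OF lim_1_over_n])
  moreover have "l \<le> sqrt (lam + 1 / real (Suc n))" for n
    using up[of "1 / real (Suc n)"] by (simp add: l)
  ultimately have 1: "l \<le> sqrt lam" by (intro LIMSEQ_le_const) auto
  have "(\<lambda>n. sqrt (lam - 1 / real (Suc n))) \<longlonglongrightarrow> sqrt (lam - 0)"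
    by (intro tendsto_intros LIMSEQ_Suc[OF lim_1_over_n])
  moreover have "sqrt (lam - 1 / real (Suc n)) \<le> l" for n
    using lo[of "1 / real (Suc n)"] by (simp add: l)
  ultimately have 2: "sqrt lam \<le> l" by (intro LIMSEQ_le_const2) auto
  from 1 2 show ?thesis by (simp add: l)
qed

lemma approx_const_asymptotic_height:
  fixes x :: "'k::finite heis"
  assumes x: "x \<in> heis" and l: "approx_const R I x = ereal l"
  shows "0 \<le> l" and "asymptotic_height x (l\<^sup>2)"
proof -
  show l0: "0 \<le> l" using approx_const_nonneg[OF x] by (simp add: l)
  show "asymptotic_height x (l\<^sup>2)" unfolding asymptotic_height_def
  proof (intro conjI allI impI)
    fix e :: real assume e: "e > 0"
    show "\<exists>r. \<forall>v\<in>V. r \<le> cmod (v $ Bot) \<longrightarrow> l\<^sup>2 - e \<le> ht (lift x) e_inf v"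
    proof (cases "l\<^sup>2 - e \<le> 0")
      case True
      then show ?thesis using ht_nonneg order_trans by blast
    next
      case False
      then have "sqrt (l\<^sup>2 - e) < l" using e l0 by (intro real_less_lsqrt) auto
      then have "ereal (sqrt (l\<^sup>2 - e)) < Liminf cusp_filter (approx_fun x)" by (simp add: approx_const_eq[symmetric] l)
      then have "eventually (\<lambda>t. ereal (sqrt (l\<^sup>2 - e)) < approx_fun x t) cusp_filter" by (rule less_LiminfD)
      then obtain r where r: "\<And>v. v \<in> V \<Longrightarrow> r \<le> cmod (v $ Bot) \<Longrightarrow> ereal (sqrt (l\<^sup>2 - e)) < approx_fun x (triple v)"
        unfolding eventually_cusp_filter by blast
      show ?thesis
      proof (intro exI[of _ "max 1 r"] ballI impI)
        fix v :: "'k cvec" assume "v \<in> V" "max 1 r \<le> cmod (v $ Bot)"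
        then show "l\<^sup>2 - e \<le> ht (lift x) e_inf v" using r[of v] approx_fun_triple[OF x, of v] by simp
      qed
    qed
    fix r
    show "\<exists>v\<in>V. r \<le> cmod (v $ Bot) \<and> ht (lift x) e_inf v \<le> l\<^sup>2 + e"
    proof (rule ccontr)
      assume "\<not> ?thesis"
      then have "ereal (sqrt (l\<^sup>2 + e)) \<le> approx_const R I x"
        by (intro approx_const_lower[OF x, of r]) force
      then have "sqrt (l\<^sup>2 + e) \<le> l" by (simp add: l)
      moreover have "l < sqrt (l\<^sup>2 + e)" using e by (intro real_less_rsqrt) simp
      ultimately show False by simp
    qed
  qed
qed

lemma norm_e_inf [simp]: "norm (e_inf :: 'k::finite cvec) = 1"
  by (simp add: e_inf_def norm_axis_1)

text \<open>Each return supplies the cusp carried to infinity by g. Its products with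
  \<open>lift x\<close> and \<open>e_inf\<close> are at most C / N and C N, so its height is at most
  4 C^2. Its denominator must become large: cusps with bounded denominator and bounded product with
  \<open>lift x\<close> are finitely many, and irrationality keeps those products away from
  0.\<close>

lemma approx_const_finite:
  fixes x :: "'k::finite heis"
  assumes ir: "irrat x"
  shows "\<exists>l. approx_const R I x = ereal l"
proof -
  have x: "x \<in> heis" using ir by (simp add: irrat_def)
  note fr = frame_lift[OF x]
  obtain C where C: "C > 0" and rec: "\<And>N0. \<exists>N\<ge>N0. N > 0 \<and>
     (\<exists>g\<in>G1. norm (g *v (of_nat N *s lift x)) \<le> C \<and> norm (g *v ((1 / of_nat N) *s e_inf)) \<le> C)"
    using recurrence[where 'k='k] ir by blast
  have "\<exists>v\<in>V. r \<le> cmod (v $ Bot) \<and> ht (lift x) e_inf v \<le> 4 * (C * C)" for r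
  proof -
    define S where "S = {v \<in> L. hB v v = 0 \<and> v \<noteq> 0 \<and> cmod (hB v (lift x)) \<le> C \<and> cmod (v $ Bot) \<le> r}"
    define k where "k = max (norm (lift x)) 1"
    have "norm v \<le> 3 * k * (C + r)" if "v \<in> S" for v
    proof -
      have "norm v \<le> 3 * k * (cmod (hB v (lift x)) + cmod (hB v e_inf))"
        using that by (intro frame_norm_le(1)[OF fr]) (auto simp: S_def k_def)
      also have "\<dots> \<le> 3 * k * (C + r)"
        using that by (intro mult_left_mono add_mono) (auto simp: S_def k_def)
      finally show ?thesis .
    qed
    then have "S \<subseteq> {v \<in> L. norm v \<le> 3 * k * (C + r)}" by (auto simp: S_def)
    then have fin: "finite S" using L_finite_ball finite_subset by blast
    \<comment> \<open>The inserted 1 covers the case that \<open>S\<close> is empty.\<close>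
    define d where "d = Min (insert 1 ((\<lambda>v. cmod (hB v (lift x))) ` S))"
    have "d \<in> insert 1 ((\<lambda>v. cmod (hB v (lift x))) ` S)" unfolding d_def using fin by (intro Min_in) auto
    then have d0: "d > 0" using ir by (auto simp: S_def irrat_def)
    have dS: "d \<le> cmod (hB v (lift x))" if "v \<in> S" for v
      unfolding d_def using fin that by (intro Min_le) auto
    obtain N0 where N0: "C / d < real N0" using reals_Archimedean2 by blast
    obtain N g where N: "N \<ge> N0" "N > 0" and g: "g \<in> G1" "norm (g *v (of_nat N *s lift x)) \<le> C"
        "norm (g *v ((1 / of_nat N) *s e_inf)) \<le> C" using rec by blast
    obtain g' where g': "g' \<in> G1" "\<And>v. g' *v (g *v v) = v" "\<And>v. g *v (g' *v v) = v"
      using G1_inverse[OF g(1)] by blast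
    define v where "v = g' *v e_inf"
    have v: "v \<in> V" unfolding v_def by (intro G1_V g' e_inf_V)
    have "g *v v = e_inf" by (simp add: v_def g')
    then have hv: "hB v u = hB e_inf (g *v u)" for u using G1_hB[OF g(1), of v u] by simp
    have "real N * cmod (hB v (lift x)) = cmod (hB v (of_nat N *s lift x))" by (simp add: norm_mult)
    also have "\<dots> \<le> C" unfolding hv using cmod_hB_le[of e_inf] g(2) by (metis norm_e_inf mult_1 order_trans)
    finally have 1: "real N * cmod (hB v (lift x)) \<le> C" .
    have "cmod (v $ Bot) / real N = cmod (hB v ((1 / of_nat N) *s e_inf))" by (simp add: norm_divide)
    also have "\<dots> \<le> C" unfolding hv using cmod_hB_le[of e_inf] g(3) by (metis norm_e_inf mult_1 order_trans)
    finally have 2: "cmod (v $ Bot) \<le> real N * C" using N(2) by (simp add: field_simps)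
    have "real N * (cmod (hB v (lift x)) * cmod (v $ Bot)) = (real N * cmod (hB v (lift x))) * cmod (v $ Bot)" by simp
    also have "\<dots> \<le> C * (real N * C)" using 1 2 C by (intro mult_mono) auto
    finally have "real N * (cmod (hB v (lift x)) * cmod (v $ Bot)) \<le> real N * (C * C)" by (simp add: mult_ac)
    then have "cmod (hB v (lift x)) * cmod (v $ Bot) \<le> C * C" using N(2) by simp
    then have 3: "ht (lift x) e_inf v \<le> 4 * (C * C)"
      using ht_frame(2)[OF fr V_iso[OF v]] by simp
    have "real N * cmod (hB v (lift x)) < real N * d"
    proof -
      have "C < real N0 * d" using N0 d0 by (simp add: field_simps)
      also have "\<dots> \<le> real N * d" using N(1) d0 by simp
      finally show ?thesis using 1 by simp
    qed
    then have 4: "cmod (hB v (lift x)) < d" using N(2) by simp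
    have 5: "cmod (hB v (lift x)) \<le> C"
    proof -
      have "1 * cmod (hB v (lift x)) \<le> real N * cmod (hB v (lift x))" using N(2) by (intro mult_right_mono) auto
      then show ?thesis using 1 by simp
    qed
    have "\<not> cmod (v $ Bot) \<le> r"
      using 4 5 dS[of v] v V_L V_iso V_nz by (force simp: S_def)
    then show ?thesis using 3 v by (intro bexI[of _ v]) auto
  qed
  then have "approx_const R I x \<le> ereal (sqrt (4 * (C * C)))" by (rule approx_const_upper[OF x])
  then show ?thesis using approx_const_nonneg[OF x] by (cases "approx_const R I x") auto
qed

section \<open>Long geodesic segments that start and end near a common geodesic\<close>

text \<open>A segment running from the frame (P, Q) to (T P, Q / T), with h carrying its end near
  (X, Y), where it also starts. The parameter d measures all errors at once. The witness cusp is
  visited far from both ends: products with Q at the start and with T P at the end are at least 1 /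
  d. The last clause keeps \<open>Q\<close> in the orbit of infinity up to scale.\<close>

definition stage ::
  "real \<Rightarrow> real \<Rightarrow> 'k::finite cvec \<Rightarrow> 'k cvec \<Rightarrow> 'k cvec \<Rightarrow> 'k cvec \<Rightarrow> real \<Rightarrow> (complex ^ 'k blk ^ 'k blk) \<Rightarrow> bool"
  where "stage d lam X Y P Q T h \<longleftrightarrow> frame P Q \<and> h \<in> G1 \<and> 1 / d \<le> T
    \<and> norm (P - X) \<le> d \<and> norm (Q - Y) \<le> d
    \<and> norm (h *v (of_real T *s P) - X) \<le> d \<and> norm (h *v (of_real (1 / T) *s Q) - Y) \<le> d
    \<and> (\<forall>v\<in>V. d \<le> cmod (hB v Q) \<longrightarrow> lam - d \<le> ht P Q v)
    \<and> (\<exists>v\<in>V. 1 / d \<le> cmod (hB v Q) \<and> 1 / d \<le> T * cmod (hB v P) \<and> ht P Q v \<le> lam + d)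
    \<and> (\<exists>g\<in>G1. \<exists>s. s \<noteq> 0 \<and> Q = s *s (g *v e_inf))"

lemma ht_G1: "g \<in> G1 \<Longrightarrow> ht (g *v u) (g *v y) (g *v v) = ht u y v"
  by (simp add: ht_def G1_hB)

definition accumulates :: "'k::finite heis \<Rightarrow> 'k cvec \<times> 'k cvec \<Rightarrow> bool" where
  "accumulates x F \<longleftrightarrow> (\<forall>d>0. \<forall>N0. \<exists>N\<ge>N0. N > 0 \<and> (\<exists>g\<in>G1.
      norm (g *v (of_nat N *s lift x) - fst F) < d \<and> norm (g *v ((1 / of_nat N) *s e_inf) - snd F) < d))"

lemma tendsto_pair_norm:
  assumes "f \<longlonglongrightarrow> (F :: 'a::real_normed_vector \<times> 'b::real_normed_vector)" "d > 0"
  shows "\<exists>n0. \<forall>n\<ge>n0. norm (fst (f n) - fst F) < d \<and> norm (snd (f n) - snd F) < d"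
proof -
  have "eventually (\<lambda>n. dist (fst (f n)) (fst F) < d \<and> dist (snd (f n)) (snd F) < d) sequentially"
    using tendstoD[OF tendsto_fst[OF assms(1)] assms(2)] tendstoD[OF tendsto_snd[OF assms(1)] assms(2)]
    by eventually_elim auto
  then show ?thesis by (simp add: eventually_sequentially dist_norm)
qed

lemma exists_accumulation:
  obtains K :: "('k::finite cvec \<times> 'k cvec) set"
  where "compact K" "\<And>x. irrat x \<Longrightarrow> \<exists>F\<in>K. accumulates x F"
proof -
  obtain C where C: "\<And>(x :: 'k heis) N0. irrat x \<Longrightarrow> \<exists>N\<ge>N0. N > 0 \<and>
     (\<exists>g\<in>G1. norm (g *v (of_nat N *s lift x)) \<le> C \<and> norm (g *v ((1 / of_nat N) *s e_inf)) \<le> C)"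
    using recurrence[where 'k='k] by blast
  define K where "K = (cball 0 C \<times> cball 0 C :: ('k cvec \<times> 'k cvec) set)"
  have cK: "compact K" unfolding K_def by (intro compact_Times compact_cball)
  have "\<exists>F\<in>K. accumulates x F" if ir: "irrat x" for x
  proof -
    have "\<forall>n. \<exists>N g. n \<le> N \<and> N > 0 \<and> g \<in> G1 \<and> norm (g *v (of_nat N *s lift x)) \<le> C \<and> norm (g *v ((1 / of_nat N) *s e_inf)) \<le> C"
      using C[OF ir] by blast
    then obtain N g where Ng: "\<And>n. n \<le> N n \<and> N n > 0 \<and> g n \<in> G1 \<and> norm (g n *v (of_nat (N n) *s lift x)) \<le> C
       \<and> norm (g n *v ((1 / of_nat (N n)) *s e_inf)) \<le> C" by metis
    define f where "f n = (g n *v (of_nat (N n) *s lift x), g n *v ((1 / of_nat (N n)) *s e_inf))" for n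
    have "\<forall>n. f n \<in> K" using Ng by (simp add: f_def K_def)
    then obtain F r where F: "F \<in> K" "strict_mono r" "(f \<circ> r) \<longlonglongrightarrow> F"
      using cK unfolding compact_def by blast
    have "accumulates x F" unfolding accumulates_def
    proof (intro allI impI)
      fix d :: real and N0 :: nat assume "d > 0"
      then obtain n0 where n0: "\<And>n. n \<ge> n0 \<Longrightarrow> norm (fst ((f \<circ> r) n) - fst F) < d \<and> norm (snd ((f \<circ> r) n) - snd F) < d"
        using tendsto_pair_norm[OF F(3)] by blast
      define n where "n = max n0 N0"
      have "N0 \<le> r n" using seq_suble[OF F(2), of n] by (simp add: n_def)
      then have "N0 \<le> N (r n)" using Ng[of "r n"] by linarith
      then show "\<exists>N\<ge>N0. N > 0 \<and> (\<exists>g\<in>G1. norm (g *v (of_nat N *s lift x) - fst F) < d \<and>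
         norm (g *v ((1 / of_nat N) *s e_inf) - snd F) < d)"
        using n0[of n] Ng[of "r n"]
        by (intro exI[of _ "N (r n)"] conjI bexI[of _ "g (r n)"]) (auto simp: f_def n_def)
    qed
    then show ?thesis using F(1) by blast
  qed
  then show ?thesis using that cK by blast
qed

text \<open>The order of choices matters: the start N is a return so late that the lower bound holds
  for every cusp seen from it, then a cusp v' nearly realising the height with denominator at least
  N / d is fixed, and only then the end M is taken as a return well beyond v'. The segment has T = M
  / N.\<close>

lemma stage_of_accumulation:
  fixes x :: "'k::finite heis"
  assumes ir: "irrat x" and h: "asymptotic_height x lam'" and acc: "accumulates x F" and d: "d > 0"
    and lam: "\<bar>lam' - lam\<bar> < d / 2" and F: "norm (fst F - X) < d / 2" "norm (snd F - Y) < d / 2"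
  shows "\<exists>P Q T h. stage d lam X Y P Q T h"
proof -
  have x: "x \<in> heis" using ir by (simp add: irrat_def)
  note fr = frameD[OF frame_lift[OF x]]
  have near: "norm (u - Z) \<le> d" if "norm (u - Z') < d / 2" "norm (Z' - Z) < d / 2" for u Z' Z :: "'k cvec"
    using norm_triangle_ineq[of "u - Z'" "Z' - Z"] that by simp
  have d2: "d / 2 > 0" using d by simp
  obtain r where r: "\<And>v. v \<in> V \<Longrightarrow> r \<le> cmod (v $ Bot) \<Longrightarrow> lam' - d / 2 \<le> ht (lift x) e_inf v"
    using h d2 unfolding asymptotic_height_def by blast
  obtain N0 where N0: "r / d < real N0" using reals_Archimedean2 by blast
  obtain N g where N: "N \<ge> N0" "N > 0" and g: "g \<in> G1"
    "norm (g *v (of_nat N *s lift x) - fst F) < d / 2" "norm (g *v ((1 / of_nat N) *s e_inf) - snd F) < d / 2"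
    using acc d2 unfolding accumulates_def by blast
  have Nr: "r \<le> real N * d"
  proof -
    have "r \<le> real N0 * d" using N0 d by (simp add: field_simps)
    also have "\<dots> \<le> real N * d" using N d by simp
    finally show ?thesis .
  qed
  obtain g' where g': "g' \<in> G1" "\<And>v. g' *v (g *v v) = v" "\<And>v. g *v (g' *v v) = v"
    using G1_inverse[OF g(1)] by blast
  define P Q where "P = g *v (of_nat N *s lift x)" and "Q = g *v ((1 / of_nat N) *s e_inf)"
  have PQ: "frame P Q" using fr N by (simp add: frame_def P_def Q_def G1_hB[OF g(1)])
  have htg: "ht P Q (g *v v) = ht (lift x) e_inf v" for v
    unfolding P_def Q_def ht_G1[OF g(1)] using N by (intro ht_scale) auto
  have hQ: "cmod (hB (g *v v) Q) = cmod (v $ Bot) / real N" for v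
    by (simp add: Q_def G1_hB[OF g(1)] norm_divide del: hB_e_inf) (simp add: norm_divide)
  have hP: "cmod (hB (g *v v) P) = real N * cmod (hB v (lift x))" for v
    by (simp add: P_def G1_hB[OF g(1)] norm_mult)
  obtain v' where v': "v' \<in> V" "real N / d \<le> cmod (v' $ Bot)" "ht (lift x) e_inf v' \<le> lam' + d / 2"
    using h d2 unfolding asymptotic_height_def by blast
  \<comment> \<open>Irrationality makes this product nonzero, so a late enough end M satisfies M |hB
    v' (lift x)| \<ge> 1 / d.\<close>
  have nz: "cmod (hB v' (lift x)) > 0" using ir v'(1) V_L V_iso V_nz by (auto simp: irrat_def)
  obtain M0 where M0: "max (real N / d) (1 / (d * cmod (hB v' (lift x)))) < real M0" using reals_Archimedean2 by blast
  obtain M k where M: "M \<ge> M0" "M > 0" and k: "k \<in> G1"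
    "norm (k *v (of_nat M *s lift x) - fst F) < d / 2" "norm (k *v ((1 / of_nat M) *s e_inf) - snd F) < d / 2"
    using acc d2 unfolding accumulates_def by blast
  have MM0: "real M0 \<le> real M" using M by simp
  define T where "T = real M / real N"
  have "real N / d < real M" using M0 MM0 by linarith
  then have "1 / d \<le> T"
    using N d by (simp add: T_def field_simps)
  moreover have TP: "(k ** g') *v (of_real T *s P) = k *v (of_nat M *s lift x)"
    using N by (simp add: P_def T_def matrix_vector_mul_assoc[symmetric] vector_scalar_commute g' vector_smult_assoc)
  moreover have TQ: "(k ** g') *v (of_real (1 / T) *s Q) = k *v ((1 / of_nat M) *s e_inf)"
    using N by (simp add: Q_def T_def matrix_vector_mul_assoc[symmetric] vector_scalar_commute g' vector_smult_assoc)
  moreover have "lam - d \<le> ht P Q v" if v: "v \<in> V" "d \<le> cmod (hB v Q)" for v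
  proof -
    have vg: "v = g *v (g' *v v)" by (simp add: g')
    have "d \<le> cmod ((g' *v v) $ Bot) / real N" using v(2) hQ[of "g' *v v"] by (simp add: g')
    then have "r \<le> cmod ((g' *v v) $ Bot)" using Nr N by (simp add: field_simps)
    then have "lam' - d / 2 \<le> ht P Q v" using r[OF G1_V[OF g'(1) v(1)]] htg[of "g' *v v"] by (simp add: g')
    then show ?thesis using lam by linarith
  qed
  moreover have "\<exists>v\<in>V. 1 / d \<le> cmod (hB v Q) \<and> 1 / d \<le> T * cmod (hB v P) \<and> ht P Q v \<le> lam + d"
  proof (intro bexI[of _ "g *v v'"] conjI G1_V g v')
    show "1 / d \<le> cmod (hB (g *v v') Q)" unfolding hQ using v'(2) N d by (simp add: field_simps)
    have "1 / (d * cmod (hB v' (lift x))) \<le> real M" using M0 MM0 by simp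
    then have "1 / d \<le> real M * cmod (hB v' (lift x))" using nz d by (simp add: field_simps)
    then show "1 / d \<le> T * cmod (hB (g *v v') P)" unfolding hP using N by (simp add: T_def)
    show "ht P Q (g *v v') \<le> lam + d" unfolding htg using v'(3) lam by linarith
  qed
  moreover have "\<exists>g\<in>G1. \<exists>s. s \<noteq> 0 \<and> Q = s *s (g *v e_inf)"
    using N g(1) by (intro bexI[of _ g] exI[of _ "1 / of_nat N"]) (simp_all add: Q_def vector_scalar_commute)
  ultimately have "stage d lam X Y P Q T (k ** g')"
    unfolding stage_def TP TQ using PQ G1_mult[OF k(1) g'(1)] near[OF g(2) F(1)] near[OF g(3) F(2)]
      near[OF k(2) F(1)] near[OF k(3) F(2)] by (simp add: P_def Q_def)
  then show ?thesis by blast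
qed

text \<open>A second use of compactness, now over the points \<open>x n\<close>: the geodesics at
  which they accumulate subconverge to a single pair, so segments of different points can be
  glued.\<close>

lemma stages_exist:
  fixes x :: "nat \<Rightarrow> 'k::finite heis"
  assumes "\<And>n. irrat (x n)" "\<And>n. asymptotic_height (x n) (mu n)" "mu \<longlonglongrightarrow> lam"
  obtains X Y :: "'k cvec" where "\<And>d. d > 0 \<Longrightarrow> \<exists>P Q T h. stage d lam X Y P Q T h"
proof -
  obtain K :: "('k cvec \<times> 'k cvec) set" where K: "compact K" "\<And>x. irrat x \<Longrightarrow> \<exists>F\<in>K. accumulates x F"
    using exists_accumulation by blast
  then have "\<forall>n. \<exists>F. F \<in> K \<and> accumulates (x n) F" using assms(1) by blast
  then obtain F where F: "\<And>n. F n \<in> K" "\<And>n. accumulates (x n) (F n)" by metis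
  then obtain Z r where Z: "strict_mono r" "(F \<circ> r) \<longlonglongrightarrow> Z"
    using K(1) unfolding compact_def by blast
  have "\<exists>P Q T h. stage d lam (fst Z) (snd Z) P Q T h" if d: "d > 0" for d
  proof -
    have d2: "d / 2 > 0" using d by simp
    obtain n0 where n0: "\<And>n. n \<ge> n0 \<Longrightarrow> norm (fst ((F \<circ> r) n) - fst Z) < d / 2 \<and> norm (snd ((F \<circ> r) n) - snd Z) < d / 2"
      using tendsto_pair_norm[OF Z(2) d2] by blast
    obtain n1 where n1: "\<And>n. n \<ge> n1 \<Longrightarrow> \<bar>mu n - lam\<bar> < d / 2"
      using LIMSEQ_D[OF assms(3) d2] by (auto simp: real_norm_def)
    define n where "n = max n0 n1"
    have "n1 \<le> r n" using seq_suble[OF Z(1), of n] by (simp add: n_def)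
    then show ?thesis
      using n0[of n] n1[of "r n"]
      by (intro stage_of_accumulation[OF assms(1)[of "r n"] assms(2)[of "r n"] F(2)[of "r n"] d]) (auto simp: n_def)
  qed
  then show ?thesis using that by blast
qed

end

section \<open>Shadowing a sequence of segments by one geodesic\<close>

text \<open>The third condition on \<open>u\<close> makes it projectively close to \<open>P\<close>:
  normalised by its product with \<open>Q\<close> it lies within 4 k t of \<open>P\<close>, hence
  close to \<open>P2\<close>. Its product b with \<open>Q2\<close> is then within 1 / 4 of -1 and
  that with \<open>P2\<close> is at most 1 / 4, which gives the factors 3 / 4, 5 / 4 and 3.\<close>

lemma frame_transfer:
  assumes f: "frame P Q" "frame P2 Q2" and k: "1 \<le> k" "norm P \<le> k" "norm Q \<le> k" "norm P2 \<le> k" "norm Q2 \<le> k"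
    and d: "norm (P - P2) \<le> d" and u: "hB u u = 0" "hB u Q \<noteq> 0" "cmod (hB u P) \<le> t\<^sup>2 * cmod (hB u Q)"
    and t: "0 \<le> t" "t \<le> 1" and small: "k * (4 * k * t + d) \<le> 1 / 4"
  shows "hB u Q2 \<noteq> 0" and "3 / 4 * cmod (hB u Q) \<le> cmod (hB u Q2)" and "cmod (hB u Q2) \<le> 5 / 4 * cmod (hB u Q)"
    and "3 * cmod (hB u P2) \<le> cmod (hB u Q2)"
    and "norm ((- 1 / hB u Q2) *s u - P2) \<le> 3 * k\<^sup>2 * (4 * k * t + d)"
proof -
  define w where "w = (- 1 / hB u Q) *s u"
  define e where "e = 4 * k * t + d"
  have "hB w w = 0" "hB w Q = -1" using u by (simp_all add: w_def)
  moreover have "cmod (hB w P) \<le> t\<^sup>2" using u by (simp add: w_def norm_divide divide_le_eq)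
  ultimately have "norm (w - P) \<le> 4 * k * t"
    by (intro frame_norm_diff_le[OF f(1)] k t)
  then have we: "norm (w - P2) \<le> e"
    using norm_triangle_ineq[of "w - P" "P - P2"] d by (simp add: e_def)
  have e0: "0 \<le> e" using we norm_ge_zero order_trans by blast
  define b where "b = hB w Q2"
  have "b + 1 = hB (w - P2) Q2" using frameD(3)[OF f(2)] by (simp add: b_def)
  also have "cmod \<dots> \<le> norm (w - P2) * norm Q2" by (rule cmod_hB_le)
  also have "\<dots> \<le> e * k" using we k e0 by (intro mult_mono) auto
  finally have b1: "cmod (b + 1) \<le> k * e" by (simp add: mult.commute)
  then have b14: "cmod (b + 1) \<le> 1 / 4" using small by (simp add: e_def)
  have bl: "3 / 4 \<le> cmod b" and bu: "cmod b \<le> 5 / 4"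
    using norm_triangle_ineq2[of 1 "b + 1"] norm_triangle_ineq4[of "b + 1" 1] b14 by auto
  have hu: "hB u Q2 = - hB u Q * b" using u(2) by (simp add: b_def w_def)
  show "hB u Q2 \<noteq> 0" using u(2) bl hu by auto
  have c: "cmod (hB u Q2) = cmod (hB u Q) * cmod b" by (simp add: hu norm_mult)
  show "3 / 4 * cmod (hB u Q) \<le> cmod (hB u Q2)" unfolding c using mult_left_mono[OF bl, of "cmod (hB u Q)"] by simp
  show "cmod (hB u Q2) \<le> 5 / 4 * cmod (hB u Q)" unfolding c using mult_left_mono[OF bu, of "cmod (hB u Q)"] by simp
  have "hB w P2 = hB (w - P2) P2" using frameD(1)[OF f(2)] by simp
  also have "cmod \<dots> \<le> norm (w - P2) * norm P2" by (rule cmod_hB_le)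
  also have "\<dots> \<le> e * k" using we k e0 by (intro mult_mono) auto
  finally have "cmod (hB w P2) \<le> 1 / 4" using small by (simp add: e_def mult.commute)
  moreover have "cmod (hB u P2) = cmod (hB u Q) * cmod (hB w P2)"
    using u(2) by (simp add: w_def norm_mult norm_divide)
  ultimately have "3 * cmod (hB u P2) \<le> cmod (hB u Q) * (3 / 4)"
    using mult_left_mono[of "cmod (hB w P2)" "1 / 4" "cmod (hB u Q)"] by simp
  then show "3 * cmod (hB u P2) \<le> cmod (hB u Q2)" unfolding c using mult_left_mono[OF bl, of "cmod (hB u Q)"] by simp
  have b0: "b \<noteq> 0" using bl by auto
  have eq: "(- 1 / hB u Q2) *s u - P2 = (- 1 / b) *s ((w - P2) + (b + 1) *s P2)"
    using u(2) b0 by (simp add: hu w_def vec_eq_iff field_simps)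
  have "norm ((- 1 / hB u Q2) *s u - P2) = norm ((w - P2) + (b + 1) *s P2) / cmod b"
    unfolding eq norm_scalar_mult by (simp add: norm_divide)
  also have "\<dots> \<le> (k\<^sup>2 * e + k\<^sup>2 * e) / (3 / 4)"
  proof (rule frac_le)
    have "1 * e \<le> k\<^sup>2 * e" using k(1) e0 by (intro mult_right_mono) auto
    moreover have "cmod (b + 1) * norm P2 \<le> (k * e) * k" using b1 k e0 by (intro mult_mono) auto
    then have "cmod (b + 1) * norm P2 \<le> k\<^sup>2 * e" by (simp only: power2_eq_square mult_ac)
    moreover have "norm ((w - P2) + (b + 1) *s P2) \<le> norm (w - P2) + cmod (b + 1) * norm P2"
      using norm_triangle_ineq[of "w - P2" "(b + 1) *s P2"] unfolding norm_scalar_mult .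
    ultimately show "norm ((w - P2) + (b + 1) *s P2) \<le> k\<^sup>2 * e + k\<^sup>2 * e"
      using we by linarith
  qed (use bl e0 in auto)
  also have "\<dots> \<le> 3 * k\<^sup>2 * e" using e0 by (simp add: mult_right_mono)
  finally show "norm ((- 1 / hB u Q2) *s u - P2) \<le> 3 * k\<^sup>2 * (4 * k * t + d)" by (simp add: e_def)
qed

text \<open>Used with s = T^2. A', D' are the products of a cusp with the normalised ends of the
  shadowing geodesic, A, D those with the frame of the stage. The errors are so small that a window
  for the ratio of the former costs at most a factor 2 at either side for the latter.\<close>

lemma window_bounds:
  fixes A D A' D' s \<theta> :: real
  assumes pos: "0 \<le> A" "0 \<le> D" "0 \<le> \<theta>" "\<theta> \<le> 1 / 32" "1 \<le> s"
    and D: "\<bar>D' - D\<bar> \<le> \<theta> * (A + D)" and A: "\<bar>A' - A\<bar> \<le> \<theta> * (A + D / s)"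
    and w: "A' \<le> D'" "D' \<le> 2 * s * A'"
  shows "A \<le> 2 * D" "D \<le> 4 * s * A"
proof -
  have s0: "0 < s" using pos(5) by simp
  have 1: "\<bar>D' - D\<bar> \<le> (1 / 32) * (A + D)"
    by (rule order_trans[OF D]) (use assms in \<open>intro mult_right_mono, auto\<close>)
  have 2: "\<bar>A' - A\<bar> \<le> (1 / 32) * (A + D / s)"
    by (rule order_trans[OF A]) (use assms in \<open>intro mult_right_mono, auto\<close>)
  define B where "B = D / s"
  note 2 = 2[folded B_def]
  have ds: "B \<le> D" unfolding B_def using assms s0 by (simp add: divide_le_eq mult_le_cancel_left1)
  show "A \<le> 2 * D"
  proof (rule ccontr)
    assume "\<not> A \<le> 2 * D"
    then have "2 * D < A" by simp
    moreover have "A - A' \<le> (1 / 32) * (A + B)" "D' - D \<le> (1 / 32) * (A + D)"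
      using 1 2 by (simp_all only: abs_le_iff minus_diff_eq)
    then have "31 * A \<le> 32 * A' + B" "32 * D' \<le> 33 * D + A" by simp_all
    ultimately show False using ds w(1) assms(1,2) by linarith
  qed
  have Ds: "D = s * B" using assms s0 by (simp add: B_def)
  have "D' / s \<le> 2 * A'" using w(2) assms s0 by (simp add: divide_le_eq mult_ac)
  moreover have "D / s - D' / s \<le> (1 / 32) * (A + D) / s"
  proof -
    have "D - D' \<le> (1 / 32) * (A + D)" using 1 by (simp only: abs_le_iff minus_diff_eq)
    then have "(D - D') / s \<le> (1 / 32) * (A + D) / s" using s0 by (intro divide_right_mono) auto
    then show ?thesis by (simp only: diff_divide_distrib)
  qed
  moreover have "A / s \<le> A" using assms s0 by (simp add: divide_le_eq mult_le_cancel_left1)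
  ultimately have 3: "B - 2 * A' \<le> (1 / 32) * (A + B)" by (simp add: B_def add_divide_distrib)
  have "A' - A \<le> (1 / 32) * (A + B)" using 2 by (simp only: abs_le_iff)
  then have "32 * A' \<le> 33 * A + B" "31 * B \<le> 64 * A' + A" using 3 by simp_all
  then have "B \<le> 4 * A"
    using assms(1) by linarith
  then show "D \<le> 4 * s * A" using s0 by (simp add: B_def divide_le_eq mult_ac)
qed

text \<open>Three factors with relative error s each change q by at most 4 s |q0|, hence the height
  by at most 16 s |q0|. This is relative to the height since \<open>ht_frame\<close> bounds it below
  by 2 |q0|; Re q0 alone could be much smaller than |q0|.\<close>

lemma ht_perturb:
  assumes f: "frame P Q" and v: "hB v v = 0"
    and u: "cmod (hB v u - hB v P) \<le> s * cmod (hB v P)" and y: "cmod (hB v y - hB v Q) \<le> s * cmod (hB v Q)"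
    and uy: "cmod (hB u y + 1) \<le> s" and s: "s \<le> 1 / 8"
  shows "\<bar>ht u y v - ht P Q v\<bar> \<le> 8 * s * ht P Q v"
proof -
  define a a0 b b0 e where "a = hB u v" "a0 = hB P v" "b = hB v y" "b0 = hB v Q" "e = - hB u y"
  note defs = this
  have s0: "0 \<le> s" using uy norm_ge_zero order_trans by blast
  have "a - a0 = cnj (hB v u - hB v P)" by (simp add: defs)
  then have "cmod (a - a0) = cmod (hB v u - hB v P)" by (simp only: complex_mod_cnj)
  then have a: "cmod (a - a0) \<le> s * cmod a0" using u by (simp add: defs cmod_hB_commute[of P])
  have b: "cmod (b - b0) \<le> s * cmod b0" using y by (simp add: defs)
  have "e - 1 = - (hB u y + 1)" by (simp add: defs)
  then have e: "cmod (e - 1) \<le> s" using uy by (simp only: norm_minus_cancel)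
  define q q0 where "q = a * b / e" "q0 = a0 * b0"
  note q = this
  have htu: "ht u y v = 2 * (cmod q + Re q)" by (simp add: ht_def Let_def q defs)
  have hq0: "- hB P v * hB v Q / hB P Q = q0" using frameD(3)[OF f] by (simp add: q defs)
  have htP: "ht P Q v = 2 * (cmod q0 + Re q0)" unfolding ht_def Let_def hq0 ..
  have "cmod b \<le> cmod b0 + s * cmod b0" using b norm_triangle_ineq2[of b b0] by simp
  then have bb: "cmod b \<le> (1 + s) * cmod b0" by (simp add: algebra_simps)
  have "a * b - e * q0 = (a - a0) * b + a0 * (b - b0) - (e - 1) * q0" by (simp add: q algebra_simps)
  then have "cmod (a * b - e * q0) \<le> cmod (a - a0) * cmod b + cmod a0 * cmod (b - b0) + cmod (e - 1) * cmod q0"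
    using norm_triangle_ineq4[of "(a - a0) * b + a0 * (b - b0)" "(e - 1) * q0"]
      norm_triangle_ineq[of "(a - a0) * b" "a0 * (b - b0)"] by (simp add: norm_mult)
  also have "\<dots> \<le> (s * cmod a0) * ((1 + s) * cmod b0) + cmod a0 * (s * cmod b0) + s * cmod q0"
    using a b bb e s0 by (intro add_mono mult_mono) auto
  also have "\<dots> = (3 * s + s * s) * cmod q0" by (simp add: q norm_mult algebra_simps)
  also have "\<dots> \<le> (7 / 2 * s) * cmod q0"
    using s s0 mult_left_mono[of s "1/8" s] by (intro mult_right_mono) auto
  finally have n: "cmod (a * b - e * q0) \<le> 7 / 2 * s * cmod q0" .
  have el: "7 / 8 \<le> cmod e" using norm_triangle_ineq2[of 1 "1 - e"] e s by (simp add: norm_minus_commute)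
  then have e0: "e \<noteq> 0" by auto
  have "q - q0 = (a * b - e * q0) / e" using e0 by (simp add: q field_simps)
  then have "cmod (q - q0) = cmod (a * b - e * q0) / cmod e" by (simp add: norm_divide)
  also have "\<dots> \<le> (7 / 2 * s * cmod q0) / (7 / 8)"
    using n el s0 by (intro frac_le) auto
  finally have qd: "cmod (q - q0) \<le> 4 * s * cmod q0" by simp
  have "ht u y v - ht P Q v = 2 * (cmod q - cmod q0) + 2 * Re (q - q0)"
    unfolding htu htP by (simp add: algebra_simps)
  then have "\<bar>ht u y v - ht P Q v\<bar> \<le> 2 * \<bar>cmod q - cmod q0\<bar> + 2 * \<bar>Re (q - q0)\<bar>"
    using abs_triangle_ineq[of "2 * (cmod q - cmod q0)" "2 * Re (q - q0)"] by (simp only: abs_mult abs_numeral)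
  also have "\<dots> \<le> 2 * cmod (q - q0) + 2 * cmod (q - q0)"
    using norm_triangle_ineq3[of q q0] abs_Re_le_cmod[of "q - q0"] by simp
  also have "\<dots> \<le> 4 * (4 * s * cmod q0)" using qd by simp
  also have "\<dots> = 8 * s * (2 * (cmod (hB v P) * cmod (hB v Q)))"
    by (simp add: q defs norm_mult cmod_hB_commute[of P])
  also have "\<dots> \<le> 8 * s * ht P Q v" using ht_frame(1)[OF f v] s0 by (intro mult_left_mono) auto
  finally show ?thesis .
qed

lemma continuous_on_hB:
  assumes "continuous_on S f" "continuous_on S g"
  shows "continuous_on S (\<lambda>x. hB (f x) (g x))"
  unfolding hB_def by (intro continuous_intros continuous_on_cnj assms)

lemma continuous_on_matrix_vector_mult:
  fixes A :: "complex ^ 'n::finite ^ 'm::finite"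
  assumes "continuous_on S f"
  shows "continuous_on S (\<lambda>x. A *v f x)"
  unfolding matrix_vector_mult_def by (intro continuous_intros assms)

text \<open>\<open>\<kappa>\<close> bounds all frame vectors. Its fourth power absorbs the product
  of the bounds 3 \<kappa> and 36 \<kappa>^3 d below, and 30000 leaves room for the numerical
  margins. The slow decay of d makes consecutive errors comparable, so a bound by d n is also one by
  d (n + 1).\<close>

locale shadowing = cusp_ideal m R I for m R I +
  fixes lam :: real and X Y :: "'k::finite cvec" and P Q :: "nat \<Rightarrow> 'k cvec" and T :: "nat \<Rightarrow> real"
    and h :: "nat \<Rightarrow> complex ^ 'k blk ^ 'k blk" and \<kappa> :: real and d :: "nat \<Rightarrow> real"
  assumes stages: "stage (d n) lam X Y (P n) (Q n) (T n) (h n)"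
    and \<kappa>_def: "\<kappa> = norm X + norm Y + 1" and d_def: "d n = 1 / (30000 * \<kappa> ^ 4) / (real n + 1)"
begin

lemma \<kappa>_ge: "1 \<le> \<kappa>" by (simp add: \<kappa>_def)

lemma d_pos: "0 < d n" using \<kappa>_ge by (simp add: d_def)

lemma \<kappa>4_d: "\<kappa> ^ 4 * d n = 1 / 30000 / (real n + 1)"
  using \<kappa>_ge by (simp add: d_def)

lemma \<kappa>4_d_le: "\<kappa> ^ 4 * d n \<le> 1 / 30000"
  unfolding \<kappa>4_d by (simp add: divide_le_eq)

lemma \<kappa>_power_d_le: assumes "i \<le> 4" shows "\<kappa> ^ i * d n \<le> \<kappa> ^ 4 * d n"
  using assms \<kappa>_ge d_pos[of n] by (intro mult_right_mono power_increasing) auto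

lemma d_le: "d n \<le> 1 / 30000"
  using \<kappa>_power_d_le[of 0 n] \<kappa>4_d_le[of n] by simp

lemma d_Suc: "d (Suc n) \<le> d n" "d n \<le> 2 * d (Suc n)"
proof -
  define c where "c = 1 / (30000 * \<kappa> ^ 4)"
  have c: "0 < c" using \<kappa>_ge by (simp add: c_def)
  show "d (Suc n) \<le> d n" unfolding d_def c_def[symmetric]
    using c by (intro divide_left_mono) auto
  show "d n \<le> 2 * d (Suc n)" unfolding d_def c_def[symmetric]
    using c by (simp add: field_simps)
qed

lemma stageD:
  "frame (P n) (Q n)" "h n \<in> G1" "1 / d n \<le> T n" "norm (P n - X) \<le> d n" "norm (Q n - Y) \<le> d n"
  using stages[of n] by (auto simp: stage_def)

lemma T_ge: "30000 \<le> T n"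
proof -
  have "30000 * d n \<le> 1" using d_le[of n] by simp
  then have "30000 \<le> 1 / d n" using d_pos[of n] by (simp add: le_divide_eq)
  then show ?thesis using stageD(3)[of n] by simp
qed

lemma T_inverse: "1 / T n \<le> d n"
  using stageD(3)[of n] T_ge[of n] d_pos[of n] by (simp add: divide_le_eq mult.commute)

definition P' where "P' n = h n *v (of_real (T n) *s P n)"
definition Q' where "Q' n = h n *v (of_real (1 / T n) *s Q n)"

lemma end_close: "norm (P' n - X) \<le> d n" "norm (Q' n - Y) \<le> d n"
  using stages[of n] by (auto simp: stage_def P'_def Q'_def)

lemma norm_le_\<kappa>: "norm (P n) \<le> \<kappa>" "norm (Q n) \<le> \<kappa>" "norm (P' n) \<le> \<kappa>" "norm (Q' n) \<le> \<kappa>"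
proof -
  have *: "norm u \<le> \<kappa>" if "norm (u - Z) \<le> d n" "Z = X \<or> Z = Y" for u Z :: "'k cvec"
  proof -
    have "norm Z \<le> \<kappa> - 1" using that(2) by (auto simp: \<kappa>_def)
    moreover have "norm u \<le> norm (u - Z) + norm Z" using norm_triangle_ineq[of "u - Z" Z] by simp
    ultimately show ?thesis using that(1) d_le[of n] by linarith
  qed
  show "norm (P n) \<le> \<kappa>" "norm (Q n) \<le> \<kappa>" "norm (P' n) \<le> \<kappa>" "norm (Q' n) \<le> \<kappa>"
    by (blast intro: * stageD end_close)+
qed

lemma hB_end:
  "hB (h n *v u) (P' n) = of_real (T n) * hB u (P n)" "hB (h n *v u) (Q' n) = hB u (Q n) / of_real (T n)"
  by (simp_all add: P'_def Q'_def G1_hB[OF stageD(2)])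

lemma frame_end: "frame (P' n) (Q' n)"
  using frameD[OF stageD(1)[of n]] T_ge[of n]
  by (simp add: frame_def P'_def Q'_def G1_hB[OF stageD(2)])

lemma end_start_close: "norm (P (Suc n) - P' n) \<le> 2 * d n" "norm (Q' n - Q (Suc n)) \<le> 2 * d n"
proof -
  have "P (Suc n) - P' n = (P (Suc n) - X) - (P' n - X)" "Q' n - Q (Suc n) = (Q' n - Y) - (Q (Suc n) - Y)" by simp_all
  then have "norm (P (Suc n) - P' n) \<le> norm (P (Suc n) - X) + norm (P' n - X)"
     "norm (Q' n - Q (Suc n)) \<le> norm (Q' n - Y) + norm (Q (Suc n) - Y)"
    by (metis norm_triangle_ineq4)+
  then show "norm (P (Suc n) - P' n) \<le> 2 * d n" "norm (Q' n - Q (Suc n)) \<le> 2 * d n"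
    using stageD(4,5)[of "Suc n"] end_close[of n] d_Suc(1)[of n] by linarith+
qed

lemma small: assumes "0 \<le> t" "t \<le> d n"
  shows "\<kappa> * (4 * \<kappa> * t + 2 * d n) \<le> 1 / 4" "3 * \<kappa>\<^sup>2 * (4 * \<kappa> * t + 2 * d n) \<le> 18 * \<kappa> ^ 3 * d n" "t \<le> 1"
proof -
  have "4 * \<kappa> * t \<le> 4 * \<kappa> * d n" using assms \<kappa>_ge by (intro mult_left_mono) auto
  moreover have "2 * d n \<le> 2 * (\<kappa> * d n)" using \<kappa>_ge d_pos[of n] by simp
  ultimately have *: "4 * \<kappa> * t + 2 * d n \<le> 6 * (\<kappa> * d n)" by simp
  then have "\<kappa> * (4 * \<kappa> * t + 2 * d n) \<le> \<kappa> * (6 * (\<kappa> * d n))" using \<kappa>_ge by (intro mult_left_mono) auto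
  also have "\<dots> = 6 * (\<kappa> ^ 2 * d n)" by (simp add: power2_eq_square)
  also have "\<dots> \<le> 1 / 4" using \<kappa>_power_d_le[of 2 n] \<kappa>4_d_le[of n] by simp
  finally show "\<kappa> * (4 * \<kappa> * t + 2 * d n) \<le> 1 / 4" .
  have "3 * \<kappa>\<^sup>2 * (4 * \<kappa> * t + 2 * d n) \<le> 3 * \<kappa>\<^sup>2 * (6 * (\<kappa> * d n))" using * by (intro mult_left_mono) auto
  then show "3 * \<kappa>\<^sup>2 * (4 * \<kappa> * t + 2 * d n) \<le> 18 * \<kappa> ^ 3 * d n" by (simp add: power2_eq_square power3_eq_cube)
  show "t \<le> 1" using assms d_le[of n] by simp
qed

text \<open>Hyperbolic stability across one joint: a vector that is on the forward side at the end
  of stage n + 1 is, seen from its start, within 1 / T^2 of the forward end, so it stays on the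
  forward side at the end of stage n with a factor 3 to spare.\<close>

lemma transfer_back:
  assumes "hB u u = 0" "hB u (Q (Suc n)) \<noteq> 0" "(T (Suc n))\<^sup>2 * cmod (hB u (P (Suc n))) \<le> cmod (hB u (Q (Suc n)))"
  shows "hB u (Q' n) \<noteq> 0" "3 / 4 * cmod (hB u (Q (Suc n))) \<le> cmod (hB u (Q' n))"
    "cmod (hB u (Q' n)) \<le> 5 / 4 * cmod (hB u (Q (Suc n)))" "3 * cmod (hB u (P' n)) \<le> cmod (hB u (Q' n))"
    "norm ((- 1 / hB u (Q' n)) *s u - P' n) \<le> 18 * \<kappa> ^ 3 * d n"
proof -
  define t where "t = 1 / T (Suc n)"
  have t: "0 \<le> t" "t \<le> d n" using T_ge[of "Suc n"] T_inverse[of "Suc n"] d_Suc(1)[of n] by (auto simp: t_def)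
  have r: "cmod (hB u (P (Suc n))) \<le> t\<^sup>2 * cmod (hB u (Q (Suc n)))"
    using assms(3) T_ge[of "Suc n"] by (simp add: t_def power_divide field_simps)
  note * = frame_transfer[OF stageD(1) frame_end \<kappa>_ge norm_le_\<kappa> end_start_close(1) assms(1,2) r t(1) small(3)[OF t] small(1)[OF t]]
  show "hB u (Q' n) \<noteq> 0" "3 / 4 * cmod (hB u (Q (Suc n))) \<le> cmod (hB u (Q' n))"
    "cmod (hB u (Q' n)) \<le> 5 / 4 * cmod (hB u (Q (Suc n)))" "3 * cmod (hB u (P' n)) \<le> cmod (hB u (Q' n))"
    by (rule *)+
  show "norm ((- 1 / hB u (Q' n)) *s u - P' n) \<le> 18 * \<kappa> ^ 3 * d n"
    by (rule order_trans[OF *(5) small(2)[OF t]])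
qed

text \<open>The same with time reversed and the roles of \<open>P\<close> and \<open>Q\<close>
  exchanged, for the backward endpoint. The final bound is rewritten in terms of d (n + 1) at the
  cost of a factor 2.\<close>

lemma transfer_forward:
  assumes "hB u u = 0" "hB u (P' n) \<noteq> 0" "(T n)\<^sup>2 * cmod (hB u (Q' n)) \<le> cmod (hB u (P' n))"
  shows "hB u (P (Suc n)) \<noteq> 0" "3 / 4 * cmod (hB u (P' n)) \<le> cmod (hB u (P (Suc n)))"
    "3 * cmod (hB u (Q (Suc n))) \<le> cmod (hB u (P (Suc n)))" "cmod (hB u (P (Suc n))) \<le> 5 / 4 * cmod (hB u (P' n))"
    "norm ((- 1 / hB u (P (Suc n))) *s u - Q (Suc n)) \<le> 36 * \<kappa> ^ 3 * d (Suc n)"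
proof -
  define t where "t = 1 / T n"
  have t: "0 \<le> t" "t \<le> d n" using T_ge[of n] T_inverse[of n] by (auto simp: t_def)
  have r: "cmod (hB u (Q' n)) \<le> t\<^sup>2 * cmod (hB u (P' n))"
    using assms(3) T_ge[of n] by (simp add: t_def power_divide field_simps)
  note * = frame_transfer[OF frame_commute[OF frame_end] frame_commute[OF stageD(1)] \<kappa>_ge norm_le_\<kappa>(4,3,2,1)
      end_start_close(2) assms(1,2) r t(1) small(3)[OF t] small(1)[OF t]]
  show "hB u (P (Suc n)) \<noteq> 0" "3 / 4 * cmod (hB u (P' n)) \<le> cmod (hB u (P (Suc n)))"
    "cmod (hB u (P (Suc n))) \<le> 5 / 4 * cmod (hB u (P' n))" "3 * cmod (hB u (Q (Suc n))) \<le> cmod (hB u (P (Suc n)))"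
    by (rule *)+
  have "norm ((- 1 / hB u (P (Suc n))) *s u - Q (Suc n)) \<le> 18 * \<kappa> ^ 3 * d n"
    by (rule order_trans[OF *(5) small(2)[OF t]])
  also have "\<dots> \<le> 18 * \<kappa> ^ 3 * (2 * d (Suc n))" using \<kappa>_ge d_Suc(2)[of n] by (intro mult_left_mono) auto
  finally show "norm ((- 1 / hB u (P (Suc n))) *s u - Q (Suc n)) \<le> 36 * \<kappa> ^ 3 * d (Suc n)" by simp
qed

section \<open>The glued chain and the forward endpoint of the shadowing geodesic\<close>

primrec g :: "nat \<Rightarrow> complex ^ 'k blk ^ 'k blk" where
  "g 0 = mat 1" | "g (Suc n) = h n ** g n"

lemma g_G1: "g n \<in> G1"
  by (induction n) (simp_all add: G1_one G1_mult stageD)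

lemma g_Suc_mult: "g (Suc n) *v u = h n *v (g n *v u)"
  by (simp add: matrix_vector_mul_assoc)

lemma g_nonzero: assumes "u \<noteq> 0" shows "g n *v u \<noteq> 0"
proof -
  obtain g' where "\<And>v. g' *v (g n *v v) = v" using G1_inverse[OF g_G1] by metis
  then show ?thesis using assms by (metis matrix_vector_mult_0_right)
qed

lemma nonzero_coordinate:
  assumes "hB u u = 0" "u \<noteq> 0" "cmod (hB u (P n)) \<le> cmod (hB u (Q n))"
  shows "hB u (Q n) \<noteq> 0"
proof -
  have "norm u \<le> 3 * \<kappa> * (cmod (hB u (P n)) + cmod (hB u (Q n)))"
    by (rule frame_norm_le(1)[OF stageD(1) assms(1) norm_le_\<kappa>(1,2)])
  then show ?thesis using assms(2,3) by auto
qed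

lemma T2_mono: assumes "(T n)\<^sup>2 * a \<le> b" "0 \<le> a" shows "a \<le> b"
proof -
  have "1 \<le> (T n)\<^sup>2" using T_ge[of n] by (simp add: one_le_power)
  then have "1 * a \<le> (T n)\<^sup>2 * a" using assms(2) by (intro mult_right_mono) auto
  then show ?thesis using assms(1) by simp
qed

text \<open>A closed cone condition: at the end of stage j, \<open>Z\<close> lies on the side of the
  forward end, whose product with \<open>P' j\<close> is 0.\<close>

definition tracks :: "nat \<Rightarrow> 'k cvec \<Rightarrow> bool" where
  "tracks j Z \<longleftrightarrow> cmod (hB (g (Suc j) *v Z) (P' j)) \<le> cmod (hB (g (Suc j) *v Z) (Q' j))"

lemma tracks_iff: "tracks j Z \<longleftrightarrow> (T j)\<^sup>2 * cmod (hB (g j *v Z) (P j)) \<le> cmod (hB (g j *v Z) (Q j))"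
  using T_ge[of j] unfolding tracks_def g_Suc_mult hB_end
  by (simp add: norm_mult norm_divide field_simps power2_eq_square)

lemma tracks_scale: "tracks j Z \<Longrightarrow> tracks j (c *s Z)"
  by (simp add: tracks_def vector_scalar_commute norm_mult mult_left_mono del: g.simps)

lemma g_iso: "hB Z Z = 0 \<Longrightarrow> hB (g n *v Z) (g n *v Z) = 0"
  by (simp add: G1_hB[OF g_G1])

lemma tracks_nonzero:
  assumes "hB Z Z = 0" "Z \<noteq> 0" "tracks j Z"
  shows "hB (g j *v Z) (Q j) \<noteq> 0"
proof -
  have "cmod (hB (g j *v Z) (P j)) \<le> cmod (hB (g j *v Z) (Q j))"
    using assms(3) unfolding tracks_iff by (rule T2_mono) simp
  then show ?thesis by (rule nonzero_coordinate[OF g_iso[OF assms(1)] g_nonzero[OF assms(2)]])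
qed

text \<open>Stability in the backward direction makes the cones nested, so the condition at the last
  stage implies all earlier ones.\<close>

lemma tracks_pred:
  assumes "hB Z Z = 0" "Z \<noteq> 0" "tracks (Suc j) Z"
  shows "tracks j Z"
proof -
  have "3 * cmod (hB (g (Suc j) *v Z) (P' j)) \<le> cmod (hB (g (Suc j) *v Z) (Q' j))"
    by (rule transfer_back(4)[OF g_iso[OF assms(1)] tracks_nonzero[OF assms] assms(3)[unfolded tracks_iff]])
  then show ?thesis unfolding tracks_def using norm_ge_zero[of "hB (g (Suc j) *v Z) (P' j)"] by linarith
qed

definition limit_set :: "nat \<Rightarrow> 'k cvec set" where
  "limit_set K = {Z. hB Z Z = 0 \<and> hB Z (Q 0) = -1 \<and> (\<forall>j\<le>K. tracks j Z)}"

text \<open>The forward end of stage K, pulled back by the group and rescaled, satisfies all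
  conditions up to K.\<close>

lemma limit_set_nonempty: "limit_set K \<noteq> {}"
proof -
  obtain g' where g': "g' \<in> G1" "\<And>v. g' *v (g (Suc K) *v v) = v" "\<And>v. g (Suc K) *v (g' *v v) = v"
    using G1_inverse[OF g_G1] by blast
  define Z where "Z = g' *v P' K"
  have gZ: "g (Suc K) *v Z = P' K" by (simp only: Z_def g')
  have Z0: "hB Z Z = 0" using frameD(1)[OF frame_end] by (simp add: Z_def G1_hB[OF g'(1)])
  have "hB (g (Suc K) *v Z) (Q' K) = -1" unfolding gZ using frameD(3)[OF frame_end] .
  then have Znz: "Z \<noteq> 0" by auto
  have trK: "tracks K Z" unfolding tracks_def gZ using frameD(1)[OF frame_end] by simp
  have tr: "tracks j Z" if "j \<le> K" for j
    using that by (induction j rule: inc_induct) (auto intro: trK tracks_pred[OF Z0 Znz])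
  have nz: "hB Z (Q 0) \<noteq> 0" using tracks_nonzero[OF Z0 Znz tr[of 0]] by simp
  have "(- 1 / hB Z (Q 0)) *s Z \<in> limit_set K"
    unfolding limit_set_def mem_Collect_eq
  proof (intro conjI allI impI tracks_scale tr)
    show "hB ((- 1 / hB Z (Q 0)) *s Z) ((- 1 / hB Z (Q 0)) *s Z) = 0" "hB ((- 1 / hB Z (Q 0)) *s Z) (Q 0) = - 1"
      using Z0 nz by simp_all
  qed
  then show ?thesis by blast
qed

lemma limit_set_compact: "compact (limit_set K)"
proof -
  have "closed {Z :: 'k cvec. hB Z Z = 0}" "closed {Z. hB Z (Q 0) = -1}"
    by (intro closed_Collect_eq continuous_on_hB continuous_intros)+
  moreover have "closed {Z. tracks j Z}" for j
    unfolding tracks_def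
    by (intro closed_Collect_le continuous_on_norm continuous_on_hB continuous_on_matrix_vector_mult continuous_intros)
  then have "closed (\<Inter>j\<in>{..K}. {Z. tracks j Z})" by (intro closed_INT) auto
  ultimately have "closed ({Z. hB Z Z = 0} \<inter> {Z. hB Z (Q 0) = -1} \<inter> (\<Inter>j\<in>{..K}. {Z. tracks j Z}))"
    by (intro closed_Int)
  also have "({Z. hB Z Z = 0} \<inter> {Z. hB Z (Q 0) = -1} \<inter> (\<Inter>j\<in>{..K}. {Z. tracks j Z})) = limit_set K"
    by (auto simp: limit_set_def)
  finally have cl: "closed (limit_set K)" .
  \<comment> \<open>The normalisation by \<open>Q 0\<close> removes the scaling freedom; tracking at
    stage 0 then bounds both frame coordinates by 1.\<close>
  have "norm Z \<le> 3 * \<kappa> * (1 + 1)" if Z: "Z \<in> limit_set K" for Z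
  proof -
    have "tracks 0 Z" using Z by (simp add: limit_set_def)
    then have "cmod (hB Z (P 0)) \<le> cmod (hB Z (Q 0))" using T2_mono[of 0 "cmod (hB Z (P 0))" "cmod (hB Z (Q 0))"] unfolding tracks_iff by simp
    then have *: "cmod (hB Z (P 0)) \<le> 1" "cmod (hB Z (Q 0)) \<le> 1" using Z by (simp_all add: limit_set_def)
    have "norm Z \<le> 3 * \<kappa> * (cmod (hB Z (P 0)) + cmod (hB Z (Q 0)))"
      using Z by (intro frame_norm_le(1)[OF stageD(1) _ norm_le_\<kappa>(1,2)]) (simp add: limit_set_def)
    also have "\<dots> \<le> 3 * \<kappa> * (1 + 1)" using * \<kappa>_ge by (intro mult_left_mono add_mono) auto
    finally show ?thesis .
  qed
  then have "bounded (limit_set K)" by (rule boundedI)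
  with cl show ?thesis by (simp add: compact_eq_bounded_closed)
qed

lemma limit_exists: "\<exists>Z. hB Z Z = 0 \<and> hB Z (Q 0) = -1 \<and> (\<forall>j. tracks j Z)"
proof -
  have "\<Inter>(range limit_set) \<noteq> {}"
    by (rule compact_nest) (auto simp: limit_set_compact limit_set_nonempty, auto simp: limit_set_def)
  then obtain Z where "\<And>K. Z \<in> limit_set K" by blast
  then show ?thesis by (auto simp: limit_set_def)
qed

definition Z where "Z = (SOME Z. hB Z Z = 0 \<and> hB Z (Q 0) = -1 \<and> (\<forall>j. tracks j Z))"

lemma Z: "hB Z Z = 0" "hB Z (Q 0) = -1" "tracks j Z"
  using someI_ex[OF limit_exists] unfolding Z_def by auto

lemma Z_nonzero: "Z \<noteq> 0" using Z(2) by auto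

section \<open>The shadowing geodesic compared with the frame of each stage\<close>

definition z where "z n = g n *v Z"
definition y where "y n = g n *v Q 0"
definition za where "za n = cmod (hB (z n) (Q n))"
definition yb where "yb n = cmod (hB (y n) (P n))"

lemma z_iso: "hB (z n) (z n) = 0" by (simp add: z_def g_iso Z)
lemma y_iso: "hB (y n) (y n) = 0" using frameD(2)[OF stageD(1)[of 0]] by (simp add: y_def g_iso)

lemma z_tracks: "(T n)\<^sup>2 * cmod (hB (z n) (P n)) \<le> cmod (hB (z n) (Q n))"
  using Z(3)[of n] unfolding tracks_iff by (simp add: z_def)

lemma z_nz: "hB (z n) (Q n) \<noteq> 0" unfolding z_def by (rule tracks_nonzero[OF Z(1) Z_nonzero Z(3)])

lemma za_pos: "0 < za n" using z_nz by (simp add: za_def)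

lemma za_Suc: "3 / 4 * za (Suc n) \<le> za n / T n" "za n / T n \<le> 5 / 4 * za (Suc n)"
proof -
  have "cmod (hB (z (Suc n)) (Q' n)) = za n / T n"
    unfolding z_def g_Suc_mult hB_end using T_ge[of n] by (simp add: norm_divide za_def z_def)
  then show "3 / 4 * za (Suc n) \<le> za n / T n" "za n / T n \<le> 5 / 4 * za (Suc n)"
    using transfer_back(2,3)[OF z_iso z_nz z_tracks, of n] by (simp_all add: za_def)
qed

lemma y_end: "cmod (hB (y (Suc n)) (P' n)) = T n * yb n" "cmod (hB (y (Suc n)) (Q' n)) = cmod (hB (y n) (Q n)) / T n"
  unfolding y_def g_Suc_mult hB_end using T_ge[of n] by (simp_all add: norm_divide norm_mult yb_def y_def)

lemma y_end_tracks:
  assumes "cmod (hB (y n) (Q n)) \<le> yb n" "0 < yb n"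
  shows "hB (y (Suc n)) (P' n) \<noteq> 0"
    and "(T n)\<^sup>2 * cmod (hB (y (Suc n)) (Q' n)) \<le> cmod (hB (y (Suc n)) (P' n))"
proof -
  have T: "0 < T n" using T_ge[of n] by simp
  show "hB (y (Suc n)) (P' n) \<noteq> 0"
    using y_end(1)[of n] assms(2) T by auto
  have "(T n)\<^sup>2 * cmod (hB (y (Suc n)) (Q' n)) = T n * cmod (hB (y n) (Q n))"
    unfolding y_end using T by (simp add: power2_eq_square)
  also have "\<dots> \<le> T n * yb n" using assms(1) T by (intro mult_left_mono) auto
  finally show "(T n)\<^sup>2 * cmod (hB (y (Suc n)) (Q' n)) \<le> cmod (hB (y (Suc n)) (P' n))" unfolding y_end .
qed

lemma y_tracks: "cmod (hB (y n) (Q n)) \<le> yb n" "0 < yb n"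
proof (induction n)
  case 0
  show "cmod (hB (y 0) (Q 0)) \<le> yb 0" "0 < yb 0"
    using frameD[OF stageD(1)[of 0]] by (simp_all add: y_def yb_def)
next
  case (Suc n)
  note * = transfer_forward[OF y_iso y_end_tracks[OF Suc]]
  show "cmod (hB (y (Suc n)) (Q (Suc n))) \<le> yb (Suc n)"
    using *(3) norm_ge_zero[of "hB (y (Suc n)) (Q (Suc n))"] unfolding yb_def by linarith
  show "0 < yb (Suc n)" using *(1) by (simp add: yb_def)
qed

lemmas yb_pos = y_tracks(2)
lemmas y_Suc_facts = y_end_tracks[OF y_tracks]

lemma yb_Suc: "3 / 4 * (T n * yb n) \<le> yb (Suc n)" "yb (Suc n) \<le> 5 / 4 * (T n * yb n)"
  using transfer_forward(2,4)[OF y_iso y_Suc_facts] unfolding y_end by (simp_all add: yb_def)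

lemma yb_0: "yb 0 = 1" using frameD(4)[OF stageD(1)[of 0]] by (simp add: yb_def y_def)

lemma yb_ge: "2 ^ n \<le> yb n"
proof (induction n)
  case (Suc n)
  have "30000 * yb n \<le> T n * yb n" using T_ge[of n] yb_pos[of n] by (intro mult_right_mono) auto
  then show ?case using Suc yb_Suc(1)[of n] yb_pos[of n] unfolding power_Suc by linarith
qed (simp add: yb_0)

definition zn where "zn n = (- 1 / hB (z n) (Q n)) *s z n"
definition yn where "yn n = (- 1 / hB (y n) (P n)) *s y n"

text \<open>The forward endpoint is compared at the end of the stage, not at its start. This is what
  produces the weight 1 / T^2 in \<open>compare_z\<close>.\<close>

lemma zn_end_close: "norm (of_real (T n) *s (h n *v zn n) - P' n) \<le> 18 * \<kappa> ^ 3 * d n"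
proof -
  have "hB (z (Suc n)) (Q' n) = hB (z n) (Q n) / of_real (T n)"
    unfolding z_def g_Suc_mult hB_end ..
  then have "- 1 / hB (z (Suc n)) (Q' n) = of_real (T n) * (- 1 / hB (z n) (Q n))"
    by simp
  moreover have "of_real (T n) *s (h n *v zn n) = (of_real (T n) * (- 1 / hB (z n) (Q n))) *s z (Suc n)"
    unfolding zn_def z_def g_Suc_mult by (simp only: vector_scalar_commute vector_smult_assoc)
  ultimately have "(- 1 / hB (z (Suc n)) (Q' n)) *s z (Suc n) = of_real (T n) *s (h n *v zn n)"
    by (simp only:)
  then show ?thesis using transfer_back(5)[OF z_iso z_nz z_tracks, of n] by simp
qed

lemma zn_norm: "norm (zn n) \<le> 2 * \<kappa>"
proof -
  have T: "0 < T n" using T_ge[of n] by simp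
  have "hB (zn n) (zn n) = 0" "hB (zn n) (Q n) = -1" using z_iso z_nz by (simp_all add: zn_def)
  moreover have "cmod (hB (zn n) (P n)) \<le> (1 / T n)\<^sup>2"
    using z_tracks[of n] za_pos[of n] T by (simp add: zn_def norm_divide za_def field_simps power_divide)
  ultimately have "norm (zn n - P n) \<le> 4 * \<kappa> * (1 / T n)"
    using T T_ge[of n] by (intro frame_norm_diff_le[OF stageD(1) _ norm_le_\<kappa>(1,2)]) auto
  also have "\<dots> \<le> 4 * \<kappa> * d n" using T_inverse[of n] \<kappa>_ge by (intro mult_left_mono) auto
  also have "\<dots> \<le> 1" using \<kappa>_power_d_le[of 1 n] \<kappa>4_d_le[of n] by simp
  finally show ?thesis using norm_triangle_ineq[of "zn n - P n" "P n"] norm_le_\<kappa>(1)[of n] \<kappa>_ge by simp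
qed

lemma yn_close: "norm (yn n - Q n) \<le> 36 * \<kappa> ^ 3 * d n"
proof (cases n)
  case 0
  have "yn 0 = Q 0" using frameD(4)[OF stageD(1)[of 0]] by (simp add: yn_def y_def)
  then show ?thesis using 0 \<kappa>_ge d_pos[of n] by simp
next
  case (Suc k)
  then show ?thesis using transfer_forward(5)[OF y_iso y_Suc_facts, of k] by (simp add: yn_def)
qed

text \<open>108 = 3 * 36, the constants of \<open>frame_norm_le\<close> and
  \<open>yn_close\<close>.\<close>

definition \<theta> where "\<theta> n = 108 * (\<kappa> ^ 4 * d n)"

lemma \<theta>_bounds: "0 \<le> \<theta> n" "\<theta> n \<le> 1 / 200"
  using \<kappa>4_d_le[of n] d_pos[of n] \<kappa>_ge by (simp_all add: \<theta>_def)

lemma compare_y: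
  assumes v: "hB v v = 0"
  shows "cmod (hB v (yn n) - hB v (Q n)) \<le> \<theta> n * (cmod (hB v (P n)) + cmod (hB v (Q n)))"
proof -
  have "hB v (yn n) - hB v (Q n) = hB v (yn n - Q n)" by simp
  also have "cmod \<dots> \<le> norm v * norm (yn n - Q n)" by (rule cmod_hB_le)
  also have "\<dots> \<le> (3 * \<kappa> * (cmod (hB v (P n)) + cmod (hB v (Q n)))) * (36 * \<kappa> ^ 3 * d n)"
    using frame_norm_le(1)[OF stageD(1) v norm_le_\<kappa>(1,2)] yn_close \<kappa>_ge by (intro mult_mono) auto
  also have "\<dots> = \<theta> n * (cmod (hB v (P n)) + cmod (hB v (Q n)))"
    by (simp add: \<theta>_def power4_eq_xxxx power3_eq_cube)
  finally show ?thesis .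
qed

text \<open>Apply \<open>h n\<close> and multiply by T. At the end frame the cusp has the
  coordinates T A and D / T, so dividing the error by T again leaves A + D / T^2.\<close>

lemma compare_z:
  assumes v: "hB v v = 0"
  shows "cmod (hB v (zn n) - hB v (P n)) \<le> \<theta> n * (cmod (hB v (P n)) + cmod (hB v (Q n)) / (T n)\<^sup>2)"
proof -
  have T: "0 < T n" using T_ge[of n] by simp
  have hv: "hB (h n *v v) (h n *v v) = 0" by (simp add: G1_hB[OF stageD(2)] v)
  have "of_real (T n) * (hB v (zn n) - hB v (P n)) = hB (h n *v v) (of_real (T n) *s (h n *v zn n) - P' n)"
    by (simp add: P'_def G1_hB[OF stageD(2)] vector_scalar_commute[symmetric] algebra_simps)
  then have "T n * cmod (hB v (zn n) - hB v (P n)) = cmod (hB (h n *v v) (of_real (T n) *s (h n *v zn n) - P' n))"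
    using T by (metis norm_mult norm_of_real abs_of_pos)
  also have "\<dots> \<le> norm (h n *v v) * norm (of_real (T n) *s (h n *v zn n) - P' n)" by (rule cmod_hB_le)
  also have "\<dots> \<le> (3 * \<kappa> * (cmod (hB (h n *v v) (P' n)) + cmod (hB (h n *v v) (Q' n)))) * (36 * \<kappa> ^ 3 * d n)"
    using frame_norm_le(1)[OF frame_end hv norm_le_\<kappa>(3,4)] zn_end_close[of n] \<kappa>_ge d_pos[of n]
    by (intro mult_mono) (auto intro: order_trans)
  also have "\<dots> = T n * (\<theta> n * (cmod (hB v (P n)) + cmod (hB v (Q n)) / (T n)\<^sup>2))"
    unfolding hB_end using T
    by (simp add: \<theta>_def power4_eq_xxxx power3_eq_cube norm_mult norm_divide power2_eq_square field_simps)
  finally show ?thesis using T by simp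
qed

lemma compare_zy: "cmod (hB (zn n) (yn n) + 1) \<le> \<theta> n"
proof -
  have "hB (zn n) (Q n) = -1" using z_nz by (simp add: zn_def)
  then have "hB (zn n) (yn n) + 1 = hB (zn n) (yn n - Q n)" by simp
  also have "cmod \<dots> \<le> norm (zn n) * norm (yn n - Q n)" by (rule cmod_hB_le)
  also have "\<dots> \<le> (2 * \<kappa>) * (36 * \<kappa> ^ 3 * d n)" using zn_norm yn_close \<kappa>_ge by (intro mult_mono) auto
  also have "\<dots> = 72 * (\<kappa> ^ 4 * d n)" by (simp add: power4_eq_xxxx power3_eq_cube)
  also have "\<dots> \<le> \<theta> n" using d_pos[of n] \<kappa>_ge by (simp add: \<theta>_def)
  finally show ?thesis .
qed

text \<open>Inside the window both error sums are at most 5 times the single coordinate concerned,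
  so \<open>ht_perturb\<close> applies with 5 \<theta>; hence 40 = 8 * 5.\<close>

lemma compare_ht:
  assumes v: "hB v v = 0" and w: "cmod (hB v (P n)) \<le> 2 * cmod (hB v (Q n))"
    "cmod (hB v (Q n)) \<le> 4 * (T n)\<^sup>2 * cmod (hB v (P n))"
  shows "\<bar>ht (z n) (y n) v - ht (P n) (Q n) v\<bar> \<le> 40 * \<theta> n * ht (P n) (Q n) v"
proof -
  have T2: "0 < (T n)\<^sup>2" using T_ge[of n] by simp
  have "ht (z n) (y n) v = ht (zn n) (yn n) v"
    unfolding zn_def yn_def using z_nz[of n] yb_pos[of n] by (subst ht_scale) (auto simp: yb_def)
  moreover have "\<bar>ht (zn n) (yn n) v - ht (P n) (Q n) v\<bar> \<le> 8 * (5 * \<theta> n) * ht (P n) (Q n) v"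
  proof (rule ht_perturb[OF stageD(1) v])
    have "cmod (hB v (Q n)) / (T n)\<^sup>2 \<le> 4 * cmod (hB v (P n))" using w(2) T2 by (simp add: divide_le_eq mult_ac)
    then have "\<theta> n * (cmod (hB v (P n)) + cmod (hB v (Q n)) / (T n)\<^sup>2) \<le> \<theta> n * (5 * cmod (hB v (P n)))"
      using \<theta>_bounds by (intro mult_left_mono) auto
    then show "cmod (hB v (zn n) - hB v (P n)) \<le> 5 * \<theta> n * cmod (hB v (P n))"
      using compare_z[OF v, of n] by simp
    have "cmod (hB v (P n)) + cmod (hB v (Q n)) \<le> 5 * cmod (hB v (Q n))"
      using w(1) norm_ge_zero[of "hB v (Q n)"] by linarith
    then have "\<theta> n * (cmod (hB v (P n)) + cmod (hB v (Q n))) \<le> \<theta> n * (5 * cmod (hB v (Q n)))"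
      using \<theta>_bounds by (intro mult_left_mono) auto
    then show "cmod (hB v (yn n) - hB v (Q n)) \<le> 5 * \<theta> n * cmod (hB v (Q n))"
      using compare_y[OF v, of n] by simp
    show "cmod (hB (zn n) (yn n) + 1) \<le> 5 * \<theta> n" using compare_zy[of n] \<theta>_bounds[of n] by linarith
    show "5 * \<theta> n \<le> 1 / 8" using \<theta>_bounds[of n] by simp
  qed
  ultimately show ?thesis by simp
qed

lemma hB_zn: "cmod (hB (g n *v v) (zn n)) = cmod (hB v Z) / za n"
  by (simp add: zn_def z_def G1_hB[OF g_G1] norm_mult norm_divide za_def
      cmod_hB_commute[of "Q n" "g n *v Z"])

lemma hB_yn: "cmod (hB (g n *v v) (yn n)) = cmod (hB v (Q 0)) / yb n"
  by (simp add: yn_def y_def G1_hB[OF g_G1] norm_mult norm_divide yb_def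
      cmod_hB_commute[of "P n" "g n *v Q 0"])

lemma ht_Z: "ht (z n) (y n) (g n *v v) = ht Z (Q 0) v"
  by (simp add: z_def y_def ht_G1[OF g_G1])

lemma abs_cmod_diff: "\<bar>cmod a - cmod b\<bar> \<le> cmod (a - b)"
  by (rule norm_triangle_ineq3)

text \<open>If \<open>hB v Z\<close> were 0, the coordinate of \<open>v\<close> along
  \<open>P n\<close> would be negligible in every frame and the other one comparable to |hB v (Q 0)|
  / yb n, which tends to 0. Then the image of \<open>v\<close> would be a nonzero lattice vector of
  norm below 1.\<close>

lemma Z_not_rational:
  assumes v: "v \<in> L" "v \<noteq> 0" "hB v v = 0"
  shows "hB v Z \<noteq> 0"
proof
  assume 0: "hB v Z = 0"
  have bound: "1 \<le> 6 * \<kappa> * (cmod (hB v (Q 0)) / yb n)" for n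
  proof -
    let ?w = "g n *v v"
    define A D where "A = cmod (hB ?w (P n))" and "D = cmod (hB ?w (Q n))"
    have w: "hB ?w ?w = 0" by (simp add: g_iso v)
    have AD: "0 \<le> A" "0 \<le> D" by (auto simp: A_def D_def)
    have T1: "1 \<le> (T n)\<^sup>2" using T_ge[of n] by (simp add: one_le_power)
    have "A \<le> \<theta> n * (A + D / (T n)\<^sup>2)"
      using compare_z[OF w, of n] hB_zn[of n v] 0 by (simp add: A_def D_def)
    also have "\<dots> \<le> (1 / 200) * (A + D)"
    proof (intro mult_mono add_left_mono \<theta>_bounds)
      show "D / (T n)\<^sup>2 \<le> D" using AD T1 by (simp add: divide_le_eq mult_le_cancel_left1)
    qed (use AD in auto)
    finally have a: "A \<le> (1 / 200) * (A + D)" .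
    have "D - cmod (hB ?w (yn n)) \<le> \<theta> n * (A + D)"
      using compare_y[OF w, of n] abs_cmod_diff[of "hB ?w (yn n)" "hB ?w (Q n)"] by (simp add: A_def D_def)
    also have "\<dots> \<le> (1 / 200) * (A + D)" using AD \<theta>_bounds by (intro mult_right_mono) auto
    finally have *: "D - cmod (hB v (Q 0)) / yb n \<le> (1 / 200) * (A + D)" unfolding hB_yn .
    define E where "E = cmod (hB v (Q 0)) / yb n"
    have "199 * D \<le> 200 * E + A" using * unfolding E_def[symmetric] by simp
    moreover have "199 * A \<le> D" using a by simp
    moreover have "0 \<le> E" using yb_pos[of n] by (simp add: E_def)
    ultimately have "A + D \<le> 2 * E"
      using AD by linarith
    have "1 \<le> norm ?w" by (intro L_norm_ge_1 G1_L g_G1 v g_nonzero)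
    also have "\<dots> \<le> 3 * \<kappa> * (A + D)"
      unfolding A_def D_def by (rule frame_norm_le(1)[OF stageD(1) w norm_le_\<kappa>(1,2)])
    also have "\<dots> \<le> 3 * \<kappa> * (2 * E)" using \<open>A + D \<le> 2 * E\<close> \<kappa>_ge by (intro mult_left_mono) auto
    finally show ?thesis by (simp add: E_def)
  qed
  define c where "c = 6 * \<kappa> * cmod (hB v (Q 0))"
  obtain n where "c < 2 ^ n" using real_arch_pow[of 2 c] by auto
  then have "c < yb n" using yb_ge[of n] by linarith
  then have "c / yb n < 1" using yb_pos[of n] by simp
  then show False using bound[of n] by (simp add: c_def)
qed

text \<open>In frame n a cusp has products approximately A0 / za n and D0 / yb n; these balance when
  D0 / A0 equals \<open>s n\<close>. The values \<open>s n\<close> cut the cusps into windows, one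
  for each stage.\<close>

definition s where "s n = yb n / za n"

lemma s_pos: "0 < s n" using yb_pos za_pos by (simp add: s_def)

text \<open>The lower bound lets the windows exhaust all ratios; the upper bound shows that the
  window from \<open>s n\<close> to \<open>s (Suc n)\<close> is no longer than stage n allows, so
  there are no gaps.\<close>

lemma s_Suc: "2 * s n \<le> s (Suc n)" "s (Suc n) \<le> 2 * (T n)\<^sup>2 * s n"
proof -
  have T: "0 < T n" "2 \<le> T n" using T_ge[of n] by auto
  have z: "0 < za n" "0 < za (Suc n)" and y: "0 < yb n" "0 < yb (Suc n)" using za_pos yb_pos by auto
  have zl: "za (Suc n) \<le> 4 / 3 * (za n / T n)" and zu: "4 / 5 * (za n / T n) \<le> za (Suc n)"
    using za_Suc[of n] by linarith+
  have "(9 / 16) * (T n)\<^sup>2 * s n = (3 / 4 * (T n * yb n)) / (4 / 3 * (za n / T n))"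
    using T z by (simp add: s_def power2_eq_square field_simps)
  also have "\<dots> \<le> s (Suc n)" unfolding s_def
    using yb_Suc(1)[of n] zl z y T by (intro frac_le) auto
  finally have "(9 / 16) * (T n)\<^sup>2 * s n \<le> s (Suc n)" .
  moreover have "2 * s n \<le> (9 / 16) * (T n)\<^sup>2 * s n"
  proof (intro mult_right_mono)
    have "(30000::real)\<^sup>2 \<le> (T n)\<^sup>2" using T_ge[of n] by (intro power_mono) auto
    then show "2 \<le> 9 / 16 * (T n)\<^sup>2" by simp
  qed (use s_pos[of n] in auto)
  ultimately show "2 * s n \<le> s (Suc n)" by linarith
  have "s (Suc n) \<le> (5 / 4 * (T n * yb n)) / (4 / 5 * (za n / T n))" unfolding s_def
    using yb_Suc(2)[of n] zu z y T by (intro frac_le) auto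
  also have "\<dots> = (25 / 16) * (T n)\<^sup>2 * s n"
    using T z by (simp add: s_def power2_eq_square field_simps)
  also have "\<dots> \<le> 2 * (T n)\<^sup>2 * s n" using s_pos[of n] by (intro mult_right_mono) auto
  finally show "s (Suc n) \<le> 2 * (T n)\<^sup>2 * s n" .
qed

lemma s_unbounded: "\<exists>n. c < s n"
proof -
  have "2 ^ n * s 0 \<le> s n" for n
  proof (induction n)
    case (Suc n)
    then show ?case using s_Suc(1)[of n] by simp
  qed simp
  moreover obtain n where "c / s 0 < 2 ^ n" using real_arch_pow[of 2 "c / s 0"] by auto
  ultimately have "c < s n" using s_pos[of 0] by (metis less_le_trans mult.commute pos_divide_less_eq)
  then show ?thesis ..
qed

section \<open>Heights of cusps along the shadowing geodesic\<close>

lemma frame_Z: "frame Z (Q 0)"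
  using Z frameD(2)[OF stageD(1)[of 0]] by (simp add: frame_def)

lemma \<theta>_tendsto: "\<theta> \<longlonglongrightarrow> 0"
proof -
  have "(\<lambda>n. 1 / (real n + 1)) \<longlonglongrightarrow> 0" using LIMSEQ_Suc[OF lim_1_over_n] by (simp add: add.commute)
  then have "(\<lambda>n. 108 * (1 / 30000 * (1 / (real n + 1)))) \<longlonglongrightarrow> 108 * (1 / 30000 * 0)" by (intro tendsto_intros)
  moreover have "\<theta> = (\<lambda>n. 108 * (1 / 30000 * (1 / (real n + 1))))"
    by (rule ext) (simp only: \<theta>_def \<kappa>4_d times_divide_eq_right mult_1_right)
  ultimately show ?thesis by simp
qed

lemma d_tendsto: "d \<longlonglongrightarrow> 0"
proof -
  have "(\<lambda>n. (1 / (30000 * \<kappa> ^ 4)) * (1 / real (Suc n))) \<longlonglongrightarrow> (1 / (30000 * \<kappa> ^ 4)) * 0"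
    by (intro tendsto_intros LIMSEQ_Suc[OF lim_1_over_n])
  then show ?thesis by (simp add: d_def[abs_def] add.commute)
qed

text \<open>A cusp is compared with the stage during which the geodesic passes closest to it.\<close>

lemma Z_lower:
  assumes e: "e > 0"
  shows "\<exists>r. \<forall>v\<in>V. r \<le> cmod (hB v (Q 0)) \<longrightarrow> lam - e \<le> ht Z (Q 0) v"
proof -
  have "(\<lambda>n. (1 - 40 * \<theta> n) * (lam - d n)) \<longlonglongrightarrow> (1 - 40 * 0) * (lam - 0)"
    by (intro tendsto_intros \<theta>_tendsto d_tendsto)
  then have "(\<lambda>n. (1 - 40 * \<theta> n) * (lam - d n)) \<longlonglongrightarrow> lam" by simp
  moreover have "lam - e < lam" using e by simp
  ultimately have "eventually (\<lambda>n. lam - e < (1 - 40 * \<theta> n) * (lam - d n)) sequentially" by (rule order_tendstoD(1))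
  then obtain k where k: "\<And>n. n \<ge> k \<Longrightarrow> lam - e < (1 - 40 * \<theta> n) * (lam - d n)"
    unfolding eventually_sequentially by blast
  show ?thesis
  \<comment> \<open>The threshold disposes of cusps whose window lies before stage k: there D0 < s k
    A0, so A0 D0 \<ge> |lam| and the height is at least 2 |lam|.\<close>
  proof (intro exI[of _ "max 1 (s k * \<bar>lam\<bar>)"] ballI impI)
    fix v assume v: "v \<in> V" and r: "max 1 (s k * \<bar>lam\<bar>) \<le> cmod (hB v (Q 0))"
    define A0 D0 where "A0 = cmod (hB v Z)" and "D0 = cmod (hB v (Q 0))"
    have A0: "0 < A0" using Z_not_rational[OF V_L[OF v] V_nz[OF v] V_iso[OF v]] by (simp add: A0_def)
    have D0: "1 \<le> D0" "s k * \<bar>lam\<bar> \<le> D0" using r by (auto simp: D0_def)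
    show "lam - e \<le> ht Z (Q 0) v"
    proof (cases "s k * A0 \<le> D0")
      case False
      then have "s k * \<bar>lam\<bar> * 1 \<le> D0 * D0" using D0 by (intro mult_mono) auto
      also have "\<dots> \<le> D0 * (s k * A0)" using False D0 by (intro mult_left_mono) auto
      finally have "s k * \<bar>lam\<bar> \<le> s k * (A0 * D0)" by (simp add: mult_ac)
      then have "\<bar>lam\<bar> \<le> A0 * D0" using s_pos[of k] by simp
      moreover have "0 \<le> A0 * D0" using A0 D0 by simp
      ultimately show ?thesis using ht_frame(1)[OF frame_Z V_iso[OF v]] e by (simp add: A0_def D0_def)
    next
      case True
      \<comment> \<open>The least index with \<open>B\<close> is one past the wanted stage;
        \<open>k < n\<close> in \<open>B\<close> guarantees that it is a successor and that the
        stage is at least k.\<close>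
      define B where "B n \<longleftrightarrow> k < n \<and> D0 < s n * A0" for n
      have "\<exists>n. B n"
      proof -
        obtain n where n: "max (D0 / A0) (s k) < s n" using s_unbounded by blast
        have "s n \<le> s k" if "n \<le> k"
        proof -
          have "mono s" unfolding mono_iff_le_Suc using s_Suc(1) s_pos by (smt (verit))
          then show ?thesis using that by (simp add: monoD)
        qed
        then have "k < n" using n by (meson leI max_less_iff_conj not_less)
        then show ?thesis using n A0 by (auto simp: B_def divide_less_eq)
      qed
      then have B1: "B (LEAST n. B n)" by (rule LeastI_ex)
      then obtain n where n: "(LEAST n. B n) = Suc n" by (metis B_def less_nat_zero_code old.nat.exhaust)
      have "B (Suc n)" using B1 unfolding n .
      then have nk: "k \<le> n" and up: "D0 < s (Suc n) * A0" by (simp_all add: B_def)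
      have lo: "s n * A0 \<le> D0"
      proof (cases "n = k")
        case False
        have "\<not> B n" using not_less_Least[of n B] n by simp
        then show ?thesis using False nk by (simp add: B_def)
      qed (use True in simp)
      let ?w = "g n *v v"
      have wV: "?w \<in> V" by (rule G1_V[OF g_G1 v])
      have w: "hB ?w ?w = 0" by (rule V_iso[OF wV])
      define A D where "A = cmod (hB ?w (P n))" and "D = cmod (hB ?w (Q n))"
      have pos: "0 < za n" "0 < yb n" using za_pos yb_pos by auto
      have T1: "1 \<le> (T n)\<^sup>2" using T_ge[of n] by (simp add: one_le_power)
      have win: "A \<le> 2 * D" "D \<le> 4 * (T n)\<^sup>2 * A"
      proof -
        have 1: "\<bar>D0 / yb n - D\<bar> \<le> \<theta> n * (A + D)"
          using compare_y[OF w, of n] abs_cmod_diff[of "hB ?w (yn n)" "hB ?w (Q n)"]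
          unfolding hB_yn by (simp add: A_def D_def D0_def)
        have 2: "\<bar>A0 / za n - A\<bar> \<le> \<theta> n * (A + D / (T n)\<^sup>2)"
          using compare_z[OF w, of n] abs_cmod_diff[of "hB ?w (zn n)" "hB ?w (P n)"]
          unfolding hB_zn by (simp add: A_def D_def A0_def)
        have 3: "A0 / za n \<le> D0 / yb n" using lo pos by (simp add: s_def field_simps)
        have "D0 \<le> 2 * (T n)\<^sup>2 * s n * A0"
          using up mult_right_mono[OF s_Suc(2)[of n] less_imp_le[OF A0]] by linarith
        then have 4: "D0 / yb n \<le> 2 * (T n)\<^sup>2 * (A0 / za n)" using pos by (simp add: s_def field_simps)
        have "0 \<le> A" "0 \<le> D" "0 \<le> \<theta> n" "\<theta> n \<le> 1 / 32"
          using \<theta>_bounds[of n] by (auto simp: A_def D_def)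
        note * = window_bounds[OF this T1 1 2 3 4]
        show "A \<le> 2 * D" "D \<le> 4 * (T n)\<^sup>2 * A" by (rule *)+
      qed
      \<comment> \<open>Discreteness of the lattice bounds D below by d n, which is the condition
        under which the stage guarantees its lower bound on heights.\<close>
      have "1 \<le> norm ?w" using L_norm_ge_1 V_L V_nz wV by blast
      also have "\<dots> \<le> 3 * \<kappa> * (A + D)"
        unfolding A_def D_def by (rule frame_norm_le(1)[OF stageD(1) w norm_le_\<kappa>(1,2)])
      also have "\<dots> \<le> 3 * \<kappa> * (3 * D)" using win \<kappa>_ge by (intro mult_left_mono) auto
      finally have "1 * d n \<le> (9 * \<kappa> * D) * d n" using d_pos[of n] by (intro mult_right_mono) auto
      also have "\<dots> = (9 * (\<kappa> ^ 1 * d n)) * D" by simp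
      also have "\<dots> \<le> 1 * D" using \<kappa>_power_d_le[of 1 n] \<kappa>4_d_le[of n] by (intro mult_right_mono) (auto simp: D_def)
      finally have "lam - d n \<le> ht (P n) (Q n) ?w"
        using stages[of n] wV by (auto simp: stage_def D_def)
      then have "(1 - 40 * \<theta> n) * (lam - d n) \<le> (1 - 40 * \<theta> n) * ht (P n) (Q n) ?w"
        using \<theta>_bounds[of n] by (intro mult_left_mono) auto
      also have "\<dots> \<le> ht (z n) (y n) ?w"
        using compare_ht[OF w, of n] win by (simp add: A_def D_def algebra_simps)
      finally show ?thesis using k[OF nk] unfolding ht_Z by simp
    qed
  qed
qed

text \<open>Pull back the witness cusp of a late stage. The product A D is bounded in terms of
  \<open>lam\<close> while D and T A are large, so the witness lies inside the window. Its product
  with \<open>Q 0\<close> is about D times yb n, hence large.\<close>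

lemma Z_upper:
  assumes e: "e > 0"
  shows "\<exists>v\<in>V. r \<le> cmod (hB v (Q 0)) \<and> ht Z (Q 0) v \<le> lam + e"
proof -
  have "(\<lambda>n. (1 + 40 * \<theta> n) * (lam + d n)) \<longlonglongrightarrow> (1 + 40 * 0) * (lam + 0)"
    by (intro tendsto_intros \<theta>_tendsto d_tendsto)
  then have "(\<lambda>n. (1 + 40 * \<theta> n) * (lam + d n)) \<longlonglongrightarrow> lam" by simp
  moreover have "lam < lam + e" using e by simp
  ultimately have 1: "eventually (\<lambda>n. (1 + 40 * \<theta> n) * (lam + d n) < lam + e) sequentially" by (rule order_tendstoD(2))
  have "0 < 1 / (2 * (\<bar>r\<bar> + \<bar>lam\<bar> + 1))" by simp
  from order_tendstoD(2)[OF d_tendsto this]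
  have 2: "eventually (\<lambda>n. d n < 1 / (2 * (\<bar>r\<bar> + \<bar>lam\<bar> + 1))) sequentially" .
  obtain n where n1: "(1 + 40 * \<theta> n) * (lam + d n) < lam + e" and n2: "d n < 1 / (2 * (\<bar>r\<bar> + \<bar>lam\<bar> + 1))"
    using eventually_happens[OF eventually_conj[OF 1 2]] by auto
  have n3: "2 * (\<bar>r\<bar> + \<bar>lam\<bar> + 1) < 1 / d n"
    using n2 d_pos[of n] by (simp add: field_simps)
  obtain w where w: "w \<in> V" "1 / d n \<le> cmod (hB w (Q n))" "1 / d n \<le> T n * cmod (hB w (P n))" "ht (P n) (Q n) w \<le> lam + d n"
    using stages[of n] by (auto simp: stage_def)
  define A D where "A = cmod (hB w (P n))" and "D = cmod (hB w (Q n))"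
  have wi: "hB w w = 0" by (rule V_iso[OF w(1)])
  \<comment> \<open>One number that dominates A D, the target r and 1; the choice of n makes both D
    and T A at least 2 c.\<close>
  define c where "c = \<bar>r\<bar> + \<bar>lam\<bar> + 1"
  have c: "1 \<le> c" "\<bar>lam\<bar> + 1 \<le> c" "\<bar>r\<bar> \<le> c" by (auto simp: c_def)
  have D: "2 * c \<le> D" and TA: "2 * c \<le> T n * A" using n3 w(2,3) by (simp_all add: A_def D_def c_def)
  have A0: "0 \<le> A" by (simp add: A_def)
  have "2 * (A * D) \<le> lam + d n" using ht_frame(1)[OF stageD(1) wi, of n] w(4) by (simp add: A_def D_def)
  then have AD: "A * D \<le> c" using c d_le[of n] by linarith
  have "A * 1 \<le> A * D" using D c A0 by (intro mult_left_mono) auto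
  then have win1: "A \<le> 2 * D" using AD D c by simp
  have Apos: "0 < A"
    using TA c T_ge[of n] A0 by (cases "A = 0") auto
  have win2: "D \<le> 4 * (T n)\<^sup>2 * A"
  proof -
    have "c * 1 \<le> (2 * c) * (2 * c)" using c by (intro mult_mono) auto
    then have "A * D \<le> (2 * c) * (2 * c)" using AD by linarith
    also have "\<dots> \<le> (T n * A) * (T n * A)" by (rule mult_mono[OF TA TA]) (use TA c in linarith)+
    finally have "A * D \<le> A * ((T n)\<^sup>2 * A)" by (simp add: power2_eq_square mult_ac)
    then have "D \<le> (T n)\<^sup>2 * A" using Apos by simp
    also have "\<dots> \<le> 4 * (T n)\<^sup>2 * A" using A0 by simp
    finally show ?thesis .
  qed
  obtain g' where g': "g' \<in> G1" "\<And>v. g n *v (g' *v v) = v" using G1_inverse[OF g_G1] by metis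
  define v where "v = g' *v w"
  have v: "v \<in> V" unfolding v_def by (rule G1_V[OF g'(1) w(1)])
  have gv: "g n *v v = w" by (simp add: v_def g')
  have "ht Z (Q 0) v \<le> (1 + 40 * \<theta> n) * ht (P n) (Q n) w"
    using compare_ht[OF wi, of n] win1 win2 ht_Z[of n v] by (simp add: gv A_def D_def algebra_simps)
  also have "\<dots> \<le> (1 + 40 * \<theta> n) * (lam + d n)" using w(4) \<theta>_bounds[of n] by (intro mult_left_mono) auto
  finally have up: "ht Z (Q 0) v \<le> lam + e" using n1 by simp
  have "D - cmod (hB w (yn n)) \<le> \<theta> n * (A + D)"
    using compare_y[OF wi, of n] abs_cmod_diff[of "hB w (yn n)" "hB w (Q n)"] by (simp add: A_def D_def)
  also have "\<dots> \<le> (1 / 200) * (A + D)" using \<theta>_bounds A0 by (intro mult_right_mono) (auto simp: D_def)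
  finally have "199 * D \<le> 200 * cmod (hB w (yn n)) + A" by simp
  then have "D / 2 \<le> cmod (hB w (yn n))" using win1 D c by linarith
  then have "c \<le> cmod (hB w (yn n))" using D by linarith
  then have "c \<le> cmod (hB v (Q 0)) / yb n" using hB_yn[of n v] by (simp only: gv)
  then have "c * yb n \<le> cmod (hB v (Q 0))" using yb_pos[of n] by (simp add: le_divide_eq)
  moreover have "c * 1 \<le> c * yb n" using yb_ge[of n] c one_le_power[of "2::real" n] by (intro mult_left_mono) linarith+
  ultimately have "r \<le> cmod (hB v (Q 0))" using c by linarith
  then show ?thesis using v up by blast
qed

text \<open>Since \<open>Q 0\<close> is a multiple of k \<open>e_inf\<close>, the inverse of k moves
  the geodesic to one starting at infinity. Its other end W has nonzero \<open>Bot\<close> because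
  its product with \<open>e_inf\<close> is nonzero, so it is the lift of a Heisenberg point.\<close>

lemma shadow: "\<exists>x :: 'k heis. irrat x \<and> asymptotic_height x lam"
proof -
  obtain k a where k: "k \<in> G1" "a \<noteq> 0" "Q 0 = a *s (k *v e_inf)"
    using stages[of 0] by (auto simp: stage_def)
  obtain k' where k': "k' \<in> G1" "\<And>v. k' *v (k *v v) = v" "\<And>v. k *v (k' *v v) = v"
    using G1_inverse[OF k(1)] by metis
  define W where "W = k' *v Z"
  have W: "hB W W = 0" by (simp add: W_def G1_hB[OF k'(1)] Z)
  have kW: "k *v W = Z" by (simp add: W_def k')
  have hW: "hB (k *v v) Z = hB v W" for v using G1_hB[OF k(1), of v W] by (simp add: kW)
  have "hB W e_inf = hB Z (k *v e_inf)" using G1_hB[OF k(1), of W e_inf] by (simp add: kW)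
  then have "cnj a * hB W e_inf = -1" using Z(2) by (simp add: k(3))
  then have WB: "W $ Bot \<noteq> 0" by auto
  define x where "x = (W $ Top / W $ Bot, \<chi> i. W $ Mid i / W $ Bot)"
  have lx: "lift x = (1 / W $ Bot) *s W" using WB by (simp add: blk_vec_eq_iff x_def)
  have "hB (lift x) (lift x) = 0" by (simp add: lx W)
  then have x: "x \<in> heis" by (cases x) (simp add: heis_iff hB_def herm_dot_def algebra_simps)
  have irr: "irrat x" unfolding irrat_def
  proof (intro conjI x ballI impI)
    fix v :: "'k cvec" assume v: "v \<in> L" "v \<noteq> 0" "hB v v = 0"
    have "k *v v \<noteq> 0" using v(2) k'(2)[of v] by (metis matrix_vector_mult_0_right)
    then have "hB (k *v v) Z \<noteq> 0"
      using v by (intro Z_not_rational G1_L[OF k(1)]) (auto simp: G1_hB[OF k(1)])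
    then show "hB v (lift x) \<noteq> 0" using WB by (simp add: lx hW)
  qed
  have ht: "ht Z (Q 0) (k *v v) = ht (lift x) e_inf v" for v
  proof -
    have "ht Z (Q 0) (k *v v) = ht (1 *s (k *v W)) (a *s (k *v e_inf)) (k *v v)" by (simp add: kW k(3))
    also have "\<dots> = ht W e_inf v" using k(2) by (simp only: ht_scale[OF one_neq_zero] ht_G1[OF k(1)] not_False_eq_True)
    also have "\<dots> = ht ((1 / W $ Bot) *s W) (1 *s e_inf) v" using WB by (subst ht_scale) auto
    finally show ?thesis by (simp add: lx)
  qed
  have hq: "cmod (hB (k *v v) (Q 0)) = cmod a * cmod (v $ Bot)" for v
    by (simp add: k(3) G1_hB[OF k(1)] norm_mult)
  have a0: "0 < cmod a" using k(2) by simp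
  have "asymptotic_height x lam" unfolding asymptotic_height_def
  proof (intro conjI allI impI)
    fix e :: real assume e: "e > 0"
    obtain r where r: "\<And>v. v \<in> V \<Longrightarrow> r \<le> cmod (hB v (Q 0)) \<Longrightarrow> lam - e \<le> ht Z (Q 0) v"
      using Z_lower[OF e] by blast
    show "\<exists>r. \<forall>v\<in>V. r \<le> cmod (v $ Bot) \<longrightarrow> lam - e \<le> ht (lift x) e_inf v"
    proof (intro exI[of _ "r / cmod a"] ballI impI)
      fix v assume v: "(v :: 'k cvec) \<in> V" "r / cmod a \<le> cmod (v $ Bot)"
      then have "r \<le> cmod (hB (k *v v) (Q 0))" unfolding hq using a0 by (simp add: field_simps)
      then show "lam - e \<le> ht (lift x) e_inf v" using r[OF G1_V[OF k(1) v(1)]] by (simp add: ht)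
    qed
    fix r
    obtain v where v: "v \<in> V" "cmod a * r \<le> cmod (hB v (Q 0))" "ht Z (Q 0) v \<le> lam + e"
      using Z_upper[OF e] by blast
    have kv: "k *v (k' *v v) = v" by (rule k')
    show "\<exists>v\<in>V. r \<le> cmod (v $ Bot) \<and> ht (lift x) e_inf v \<le> lam + e"
    proof (intro bexI[of _ "k' *v v"] conjI G1_V k' v)
      show "r \<le> cmod ((k' *v v) $ Bot)" using v(2) hq[of "k' *v v"] a0 by (simp add: kv)
      show "ht (lift x) e_inf (k' *v v) \<le> lam + e" using v(3) ht[of "k' *v v"] by (simp add: kv)
    qed
  qed
  with irr show ?thesis by blast
qed

end

section \<open>Closedness of the set of constants\<close>

context cusp_ideal
begin

lemma asymptotic_height_limit:
  fixes x :: "nat \<Rightarrow> 'k::finite heis"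
  assumes "\<And>n. irrat (x n)" "\<And>n. asymptotic_height (x n) (mu n)" "mu \<longlonglongrightarrow> lam"
  shows "\<exists>x :: 'k heis. irrat x \<and> asymptotic_height x lam"
proof -
  obtain X Y :: "'k cvec" where XY: "\<And>d. d > 0 \<Longrightarrow> \<exists>P Q T h. stage d lam X Y P Q T h"
    using stages_exist[OF assms] by blast
  define k where "k = norm X + norm Y + 1"
  define d where "d n = 1 / (30000 * k ^ 4) / (real n + 1)" for n
  have "1 \<le> k" by (simp add: k_def)
  then have "d n > 0" for n by (simp add: d_def)
  then have "\<forall>n. \<exists>P Q T h. stage (d n) lam X Y P Q T h" using XY by blast
  then obtain P Q T h where "\<And>n. stage (d n) lam X Y (P n) (Q n) (T n) (h n)" by metis
  then interpret shadowing m R I lam X Y P Q T h k d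
    by unfold_locales (simp_all add: k_def d_def)
  show ?thesis by (rule shadow)
qed

end

theorem theorem6:
  fixes n m :: nat and R I :: "complex set"
  assumes "n \<ge> 2" and "CARD('k::finite) = n - 1"
    and "m > 0" and "squarefree m"
    and "is_order m R"
    and "is_ideal R I" and "I \<noteq> {0}"
  shows "\<exists>S :: real set. closed S \<and>
    ereal ` S = {approx_const R I x | x :: 'k heis. x \<in> heis - heis_rat m}"
proof -
  interpret cusp_ideal m R I using assms by unfold_locales
  have irr: "x \<in> heis - heis_rat m \<longleftrightarrow> irrat x" for x :: "'k heis"
    using irrat_iff[of x] by (auto simp: irrat_def)
  define S where "S = {l. \<exists>x :: 'k heis. irrat x \<and> approx_const R I x = ereal l}"
  have "closed S" unfolding closed_sequential_limits
  proof (intro allI impI, elim conjE)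
    fix l :: "nat \<Rightarrow> real" and l0 assume l: "\<forall>n. l n \<in> S" "l \<longlonglongrightarrow> l0"
    then obtain x :: "nat \<Rightarrow> 'k heis" where x: "\<And>n. irrat (x n)" "\<And>n. approx_const R I (x n) = ereal (l n)"
      unfolding S_def mem_Collect_eq by metis
    have h: "x n \<in> heis" for n using x(1) by (simp add: irrat_def)
    note ah = approx_const_asymptotic_height[OF h x(2)]
    have l0: "0 \<le> l0" using ah(1) l(2) by (intro LIMSEQ_le_const) auto
    \<comment> \<open>Asymptotic heights are squares of the constants; nonnegativity of
      \<open>l0\<close> lets the square root recover it.\<close>
    have "(\<lambda>n. (l n)\<^sup>2) \<longlonglongrightarrow> l0\<^sup>2" by (intro tendsto_intros l)
    from asymptotic_height_limit[OF x(1) ah(2) this] obtain x0 :: "'k heis"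
      where x0: "irrat x0" "asymptotic_height x0 (l0\<^sup>2)" by blast
    then have "approx_const R I x0 = ereal (sqrt (l0\<^sup>2))"
      by (intro asymptotic_height_approx_const) (auto simp: irrat_def)
    then show "l0 \<in> S" unfolding S_def mem_Collect_eq using x0 l0 by (intro exI[of _ x0]) simp
  qed
  moreover have "ereal ` S = {approx_const R I x | x :: 'k heis. x \<in> heis - heis_rat m}"
    unfolding irr
  proof (intro equalityI subsetI)
    fix c assume "c \<in> {approx_const R I x | x :: 'k heis. irrat x}"
    then obtain x :: "'k heis" where x: "irrat x" "c = approx_const R I x" by blast
    \<comment> \<open>Finiteness of the constant at every irrational point is what identifies the
      set of extended reals with the image of \<open>S\<close>.\<close>
    then obtain l where "c = ereal l" using approx_const_finite by metis
    with x show "c \<in> ereal ` S" unfolding S_def by (intro image_eqI[of _ _ l] CollectI exI[of _ x]) auto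
  next
    fix c assume "c \<in> ereal ` S"
    then obtain l where l: "c = ereal l" "l \<in> S" by blast
    from l(2) obtain x :: "'k heis" where "irrat x" "approx_const R I x = ereal l"
      unfolding S_def mem_Collect_eq by (rule exE) (erule conjE)
    with l(1) show "c \<in> {approx_const R I x | x :: 'k heis. irrat x}" by (intro CollectI exI[of _ x]) simp
  qed
  ultimately show ?thesis by blast
qed

end
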